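(* Let $X$ be a subshift and let $R$ be a field. The socle of $\widetilde{\mathcal A}_R(X)$ is strongly $\mathbb Z$-graded (with its natural $\mathbb Z$-grading) if and only if the graph $E$ associated with $X$ satisfies Condition (Y).
   Context: Notation: $\mathbb N=\{0,1,2,\dots\}$. Let $\mathfrak A$ be a nonempty set (the alphabet) and let $\mathfrak A^*$ be the set of finite words over $\mathfrak A$, including the empty word $\omega$; $|\alpha|$ is the length of $\alpha$. For a nonempty word $\beta$, $\beta^\infty=\beta\beta\beta\cdots\in\mathfrak A^{\mathbb N}$. The shift is $\sigma((x_n)_{n\in\mathbb N})=(x_{n+1})_{n\in\mathbb N}$. A subshift over $\mathfrak A$ is a set $X\subseteq\mathfrak A^{\mathbb N}$ of the form $X=X_F$ for some $F\subseteq\mathfrak A^*$, where $X_F$ is the set of all sequences in which no word of $F$ occurs as a block; then $\sigma(X)\subseteq X$ and $\sigma$ is regarded as a map $X\to X$. Every letter of $\mathfrak A$ is assumed to occur in some element of $X$. The language $\mathcal L_X$ is the set of all finite words (including $\omega$) occurring in some element of $X$. For $\alpha,\beta\in\mathcal L_X$ put $C(\alpha,\beta)=\{\beta x\in X:\alpha x\in X\}$. Let $\mathcal U$ be the Boolean algebra of subsets of $X$ generated by all $C(\alpha,\beta)$, $\alpha,\beta\in\mathcal L_X$ (closed under finite unions, finite intersections and complements in $X$). The unital subshift algebra $\widetilde{\mathcal A}_R(X)$ is the universal unital (associative) $R$-algebra with generators $\{p_A:A\in\mathcal U\}$ and $\{s_a,s_a^*:a\in\mathfrak A\}$ subject to: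 (i) $p_X=1$, $p_{A\cap B}=p_Ap_B$, $p_{A\cup B}=p_A+p_B-p_{A\cap B}$, $p_\emptyset=0$ for all $A,B\in\mathcal U$; (ii) $s_as_a^*s_a=s_a$ and $s_a^*s_as_a^*=s_a^*$ for all $a\in\mathfrak A$; (iii) $s_\beta s_\alpha^*s_\alpha s_\beta^*=p_{C(\alpha,\beta)}$ for all $\alpha,\beta\in\mathcal L_X$, where $s_\omega=s_\omega^*=1$, $s_\alpha=s_{\alpha_1}\cdots s_{\alpha_n}$ and $s_\alpha^*=s_{\alpha_n}^*\cdots s_{\alpha_1}^*$ for $\alpha=\alpha_1\cdots\alpha_n$. It is $\mathbb Z$-graded by $\widetilde{\mathcal A}_R(X)_n=\mathrm{span}_R\{s_\alpha p_As_\beta^*:\alpha,\beta\in\mathcal L_X,\ A\in\mathcal U,\ |\alpha|-|\beta|=n\}$. The socle $\mathrm{Soc}(B)$ of an algebra $B$ is the sum of all minimal left ideals of $B$ (zero if there are none). The socle of $\widetilde{\mathcal A}_R(X)$ is a graded two-sided ideal, with grading $\mathrm{Soc}_n=\mathrm{Soc}\cap\widetilde{\mathcal A}_R(X)_n$. A $\mathbb Z$-graded algebra $B=\bigoplus_nB_n$ is strongly graded if $B_mB_n=B_{m+n}$ for all $m,n\in\mathbb Z$, where $B_mB_n$ is the additive span of products. $\mathcal Q_X$ denotes the set of all one-point sets $\{p\}\in\mathcal U$ such that $p\neq\alpha\beta^\infty$ for all $\alpha,\beta\in\mathcal L_X$ with $\beta\ne\omega$; such a set is identified with its element. For $x,y\in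 X$ write $x\sim y$ if $\sigma^m(x)=\sigma^n(y)$ for some $m,n\in\mathbb N$. The graph $E$ associated with $X$: for $\{p\}\in\mathcal Q_X$ let $J_0=\{\sigma^n(p):n\in\mathbb N\}$, $J_n=\sigma^{-1}(J_{n-1})\setminus(J_0\cup\dots\cup J_{n-1})$ for $n\ge1$, and $J=\bigcup_{n\ge0}J_n$. The directed graph $E_p$ has one vertex $v_z$ and one edge $e_z$ for each $z\in J$, with source $s(e_z)=v_z$ and range $r(e_z)=v_{\sigma(z)}$. The graph $E$ is the disjoint union of the graphs $E_p$, taken over one representative $p$ of each class in $\mathcal Q_X/{\sim}$. Condition (Y): for each infinite path $e_1e_2e_3\cdots$ in the graph (meaning $r(e_i)=s(e_{i+1})$ for all $i\geq 1$) there exist $k\in\mathbb N$ and a finite path $\alpha$ with $r(\alpha)=s(e_{k+1})$ and $|\alpha|=k+1$, where $|\alpha|$ is the number of edges of $\alpha$. *)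

theory Defs
  imports
    "HOL-Library.Omega_Words_Fun"
    "HOL-Library.Poly_Mapping"
    "HOL-Algebra.Module"
    "HOL-Algebra.QuotRing"
    "HOL-Algebra.Generated_Groups"
    "Graph_Theory.Arc_Walk"
begin

section \<open>Subshifts\<close>

text \<open>The alphabet is the universe of the type variable \<open>'a\<close>; finite words are lists, and
  sequences are the omega-words \<open>nat \<Rightarrow> 'a\<close> of the library.\<close>

definition shift :: "'a word \<Rightarrow> 'a word" where
  "shift x = Omega_Words_Fun.suffix 1 x"

definition occurs_in :: "'a list \<Rightarrow> 'a word \<Rightarrow> bool" where
  "occurs_in w x \<longleftrightarrow> (\<exists>i. subsequence x i (i + length w) = w)"

definition subshift :: "'a word set \<Rightarrow> bool" where
  "subshift X \<longleftrightarrow> (\<exists>F. X = {x. \<forall>w\<in>F. \<not> occurs_in w x})"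

definition all_letters_occur :: "'a word set \<Rightarrow> bool" where
  "all_letters_occur X \<longleftrightarrow> (\<forall>a. \<exists>x\<in>X. a \<in> range x)"

definition language :: "'a word set \<Rightarrow> 'a list set" where
  "language X = {w. \<exists>x\<in>X. occurs_in w x}"

definition C_set :: "'a word set \<Rightarrow> 'a list \<Rightarrow> 'a list \<Rightarrow> 'a word set" where
  "C_set X \<alpha> \<beta> = {\<beta> \<frown> x | x. \<beta> \<frown> x \<in> X \<and> \<alpha> \<frown> x \<in> X}"

inductive_set bool_alg :: "'a word set \<Rightarrow> 'a word set set" for X where
  C: "\<alpha> \<in> language X \<Longrightarrow> \<beta> \<in> language X \<Longrightarrow> C_set X \<alpha> \<beta> \<in> bool_alg X"
| union: "A \<in> bool_alg X \<Longrightarrow> B \<in> bool_alg X \<Longrightarrow> A \<union> B \<in> bool_alg X"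
| inter: "A \<in> bool_alg X \<Longrightarrow> B \<in> bool_alg X \<Longrightarrow> A \<inter> B \<in> bool_alg X"
| compl: "A \<in> bool_alg X \<Longrightarrow> X - A \<in> bool_alg X"


section \<open>The unital subshift algebra\<close>

text \<open>Free monoid, written additively because \<open>Poly_Mapping\<close> builds monoid algebras
  from additive exponent monoids.\<close>

datatype 'g fmon = FMon (letters: "'g list")

instantiation fmon :: (type) monoid_add
begin

definition zero_fmon :: "'a fmon" where
  "0 = FMon []"

definition plus_fmon :: "'a fmon \<Rightarrow> 'a fmon \<Rightarrow> 'a fmon" where
  "u + v = FMon (letters u @ letters v)"

instance
  by standard (simp_all add: zero_fmon_def plus_fmon_def)

end

text \<open>Consequently \<open>'g fmon \<Rightarrow>\<^sub>0 'r\<close> is the free unital algebra on the type \<open>'g\<close>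
  over \<open>'r\<close>, with scalars \<open>Poly_Mapping.single 0 r\<close>; below is its subalgebra on a set
  \<open>G\<close> of generators.\<close>

definition free_algebra :: "'g set \<Rightarrow> ('g fmon \<Rightarrow>\<^sub>0 'r::field) ring" where
  "free_algebra G =
    \<lparr>carrier = {f. \<forall>w\<in>Poly_Mapping.keys f. set (letters w) \<subseteq> G},
     mult = (*), one = 1, zero = 0, add = (+)\<rparr>"

lemma ring_free_algebra:
  fixes G :: "'g set"
  shows "ring (free_algebra G :: ('g fmon \<Rightarrow>\<^sub>0 'r::field) ring)"
proof (rule ringI)
  have m: "set (letters w) \<subseteq> G"
    if fg: "\<forall>w\<in>Poly_Mapping.keys f. set (letters w) \<subseteq> G" "\<forall>w\<in>Poly_Mapping.keys g. set (letters w) \<subseteq> G"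
      and w: "w \<in> Poly_Mapping.keys (f * g)" for f g :: "'g fmon \<Rightarrow>\<^sub>0 'r" and w
  proof -
    obtain u v where "w = u + v" "u \<in> Poly_Mapping.keys f" "v \<in> Poly_Mapping.keys g"
      using w keys_mult[of f g] by blast
    thus ?thesis using fg by (auto simp: plus_fmon_def)
  qed
  have a: "set (letters w) \<subseteq> G"
    if fg: "\<forall>w\<in>Poly_Mapping.keys f. set (letters w) \<subseteq> G" "\<forall>w\<in>Poly_Mapping.keys g. set (letters w) \<subseteq> G"
      and w: "w \<in> Poly_Mapping.keys (f + g)" for f g :: "'g fmon \<Rightarrow>\<^sub>0 'r" and w
    using w keys_add[of f g] fg by blast
  show "abelian_group (free_algebra G :: ('g fmon \<Rightarrow>\<^sub>0 'r) ring)"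
  proof (rule abelian_groupI)
    fix x assume "x \<in> carrier (free_algebra G :: ('g fmon \<Rightarrow>\<^sub>0 'r) ring)"
    thus "\<exists>y\<in>carrier (free_algebra G). y \<oplus>\<^bsub>free_algebra G\<^esub> x = \<zero>\<^bsub>free_algebra G\<^esub>"
      by (intro bexI[of _ "- x"]) (auto simp: free_algebra_def)
  qed (auto simp: free_algebra_def add.assoc add.commute dest: a)
  show "monoid (free_algebra G :: ('g fmon \<Rightarrow>\<^sub>0 'r) ring)"
    by (rule monoidI)
      (auto simp: free_algebra_def mult.assoc zero_fmon_def split: if_splits dest: m)
qed (auto simp: free_algebra_def algebra_simps)

datatype 'a gen = Gen_p "'a word set" | Gen_s 'a | Gen_s_star 'a

definition gens :: "'a word set \<Rightarrow> 'a gen set" where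
  "gens X = Gen_p ` bool_alg X \<union> range Gen_s \<union> range Gen_s_star"

definition gen_p :: "'a word set \<Rightarrow> 'a gen fmon \<Rightarrow>\<^sub>0 'r::field" where
  "gen_p A = Poly_Mapping.single (FMon [Gen_p A]) 1"

definition gen_s :: "'a \<Rightarrow> 'a gen fmon \<Rightarrow>\<^sub>0 'r::field" where
  "gen_s a = Poly_Mapping.single (FMon [Gen_s a]) 1"

definition gen_s_star :: "'a \<Rightarrow> 'a gen fmon \<Rightarrow>\<^sub>0 'r::field" where
  "gen_s_star a = Poly_Mapping.single (FMon [Gen_s_star a]) 1"

definition word_s :: "'a list \<Rightarrow> 'a gen fmon \<Rightarrow>\<^sub>0 'r::field" where
  "word_s \<alpha> = prod_list (map gen_s \<alpha>)"

definition word_s_star :: "'a list \<Rightarrow> 'a gen fmon \<Rightarrow>\<^sub>0 'r::field" where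
  "word_s_star \<alpha> = prod_list (map gen_s_star (rev \<alpha>))"

definition relators :: "'a word set \<Rightarrow> ('a gen fmon \<Rightarrow>\<^sub>0 'r::field) set" where
  "relators X =
     {gen_p X - 1, gen_p {}}
   \<union> {gen_p (A \<inter> B) - gen_p A * gen_p B | A B. A \<in> bool_alg X \<and> B \<in> bool_alg X}
   \<union> {gen_p (A \<union> B) - (gen_p A + gen_p B - gen_p (A \<inter> B)) | A B.
        A \<in> bool_alg X \<and> B \<in> bool_alg X}
   \<union> {gen_s a * gen_s_star a * gen_s a - gen_s a | a. True}
   \<union> {gen_s_star a * gen_s a * gen_s_star a - gen_s_star a | a. True}
   \<union> {word_s \<beta> * word_s_star \<alpha> * word_s \<alpha> * word_s_star \<beta> - gen_p (C_set X \<alpha> \<beta>) | \<alpha> \<beta>.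
        \<alpha> \<in> language X \<and> \<beta> \<in> language X}"

definition relation_ideal :: "'a word set \<Rightarrow> ('a gen fmon \<Rightarrow>\<^sub>0 'r::field) set" where
  "relation_ideal X = Idl\<^bsub>free_algebra (gens X)\<^esub> (relators X)"

definition coset_of :: "'a word set \<Rightarrow> ('a gen fmon \<Rightarrow>\<^sub>0 'r::field) \<Rightarrow> ('a gen fmon \<Rightarrow>\<^sub>0 'r) set" where
  "coset_of X f = relation_ideal X +>\<^bsub>free_algebra (gens X)\<^esub> f"

definition subshift_algebra :: "'a word set \<Rightarrow> ('r::field, ('a gen fmon \<Rightarrow>\<^sub>0 'r) set) module" where
  "subshift_algebra X =
    (let Q = free_algebra (gens X) Quot relation_ideal X
     in ring.extend Q
          (module.fields (\<lambda>r x. coset_of X (Poly_Mapping.single 0 r) \<otimes>\<^bsub>Q\<^esub> x)))"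


section \<open>Gradings and socles\<close>

text \<open>The library locale \<open>algebra\<close> is commutative. Here an algebra over a field of type \<open>'r\<close>
  is a \<open>module\<close> record whose ring reduct is a unital, not necessarily commutative ring.\<close>

definition subspace_of :: "('r, 'b, 'm) module_scheme \<Rightarrow> 'b set \<Rightarrow> bool" where
  "subspace_of A V \<longleftrightarrow> additive_subgroup V A \<and> (\<forall>r. \<forall>x\<in>V. r \<odot>\<^bsub>A\<^esub> x \<in> V)"

definition span_of :: "('r, 'b, 'm) module_scheme \<Rightarrow> 'b set \<Rightarrow> 'b set" where
  "span_of A V = generate (add_monoid A) {r \<odot>\<^bsub>A\<^esub> x | r x. x \<in> V}"

definition left_ideal :: "('r, 'b, 'm) module_scheme \<Rightarrow> 'b set \<Rightarrow> bool" where
  "left_ideal A L \<longleftrightarrow>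
     subspace_of A L \<and> (\<forall>a\<in>carrier A. \<forall>x\<in>L. a \<otimes>\<^bsub>A\<^esub> x \<in> L)"

definition minimal_left_ideal :: "('r, 'b, 'm) module_scheme \<Rightarrow> 'b set \<Rightarrow> bool" where
  "minimal_left_ideal A L \<longleftrightarrow>
     left_ideal A L \<and> L \<noteq> {\<zero>\<^bsub>A\<^esub>} \<and>
     (\<forall>K. left_ideal A K \<and> K \<subseteq> L \<longrightarrow> K = {\<zero>\<^bsub>A\<^esub>} \<or> K = L)"

definition socle :: "('r, 'b, 'm) module_scheme \<Rightarrow> 'b set" where
  "socle A = generate (add_monoid A) (\<Union>{L. minimal_left_ideal A L})"

text \<open>\<open>B\<close> is the underlying set of a subalgebra of \<open>A\<close> that need not contain the unit.\<close>

definition graded_by ::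
  "('r, 'b, 'm) module_scheme \<Rightarrow> 'b set \<Rightarrow> (int \<Rightarrow> 'b set) \<Rightarrow> bool" where
  "graded_by A B D \<longleftrightarrow>
     subspace_of A B \<and>
     (\<forall>n. subspace_of A (D n) \<and> D n \<subseteq> B) \<and>
     (\<forall>x\<in>B. \<exists>!f. (\<forall>n. f n \<in> D n) \<and> finite {n. f n \<noteq> \<zero>\<^bsub>A\<^esub>} \<and>
        x = finsum A f {n. f n \<noteq> \<zero>\<^bsub>A\<^esub>}) \<and>
     (\<forall>m n. \<forall>x\<in>D m. \<forall>y\<in>D n. x \<otimes>\<^bsub>A\<^esub> y \<in> D (m + n))"

definition strongly_graded_by ::
  "('r, 'b, 'm) module_scheme \<Rightarrow> 'b set \<Rightarrow> (int \<Rightarrow> 'b set) \<Rightarrow> bool" where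
  "strongly_graded_by A B D \<longleftrightarrow>
     graded_by A B D \<and>
     (\<forall>m n. generate (add_monoid A) (D m <#>\<^bsub>A\<^esub> D n) = D (m + n))"

definition subshift_component ::
  "'a word set \<Rightarrow> int \<Rightarrow> ('a gen fmon \<Rightarrow>\<^sub>0 'r::field) set set" where
  "subshift_component X n = span_of (subshift_algebra X)
     {coset_of X (word_s \<alpha> * gen_p A * word_s_star \<beta>) | \<alpha> A \<beta>.
        \<alpha> \<in> language X \<and> \<beta> \<in> language X \<and> A \<in> bool_alg X \<and>
        int (length \<alpha>) - int (length \<beta>) = n}"


section \<open>The graph of a subshift\<close>

text \<open>One-point sets are identified with their elements.\<close>

definition Q_set :: "'a word set \<Rightarrow> 'a word set" where
  "Q_set X = {p. {p} \<in> bool_alg X \<and>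
     \<not> (\<exists>\<alpha>\<in>language X. \<exists>\<beta>\<in>language X. \<beta> \<noteq> [] \<and> p = \<alpha> \<frown> \<beta>\<^sup>\<omega>)}"

definition tail_equiv :: "'a word \<Rightarrow> 'a word \<Rightarrow> bool" where
  "tail_equiv x y \<longleftrightarrow> (\<exists>m n. (shift ^^ m) x = (shift ^^ n) y)"

definition representatives :: "'a word set \<Rightarrow> 'a word set \<Rightarrow> bool" where
  "representatives X T \<longleftrightarrow> T \<subseteq> Q_set X \<and> (\<forall>q\<in>Q_set X. \<exists>!p. p \<in> T \<and> tail_equiv p q)"

fun J_level :: "'a word set \<Rightarrow> 'a word \<Rightarrow> nat \<Rightarrow> 'a word set" where
  "J_level X p 0 = {(shift ^^ n) p | n. True}"
| "J_level X p (Suc n) = {x\<in>X. shift x \<in> J_level X p n} - (\<Union>k\<in>{..n}. J_level X p k)"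

definition J_set :: "'a word set \<Rightarrow> 'a word \<Rightarrow> 'a word set" where
  "J_set X p = (\<Union>n. J_level X p n)"

text \<open>The pair \<open>(p, z)\<close> is both the vertex \<open>v\<^sub>z\<close> and the edge \<open>e\<^sub>z\<close> of the component \<open>E\<^sub>p\<close>.
  In \<open>Graph_Theory\<close>, an arc goes from its \<open>tail\<close> (source) to its \<open>head\<close> (range).\<close>

definition subshift_graph ::
  "'a word set \<Rightarrow> 'a word set \<Rightarrow> ('a word \<times> 'a word, 'a word \<times> 'a word) pre_digraph" where
  "subshift_graph X T =
    \<lparr>verts = (SIGMA p:T. J_set X p), arcs = (SIGMA p:T. J_set X p),
     tail = (\<lambda>e. e), head = (\<lambda>(p, z). (p, shift z))\<rparr>"

definition infinite_path :: "('v, 'e) pre_digraph \<Rightarrow> (nat \<Rightarrow> 'e) \<Rightarrow> bool" where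
  "infinite_path E e \<longleftrightarrow> (\<forall>i. e i \<in> arcs E \<and> head E (e i) = tail E (e (Suc i)))"

text \<open>Paths \<open>e\<^sub>1 e\<^sub>2 \<dots>\<close> are indexed from 0 here, so \<open>e k\<close> is the edge \<open>e\<^sub>k\<^sub>+\<^sub>1\<close>.\<close>

definition condition_Y :: "('v, 'e) pre_digraph \<Rightarrow> bool" where
  "condition_Y E \<longleftrightarrow>
     (\<forall>e. infinite_path E e \<longrightarrow>
       (\<exists>k \<alpha> u. pre_digraph.awalk E u \<alpha> (tail E (e k)) \<and> length \<alpha> = k + 1))"

end

(* The algebra acts faithfully on matrices indexed by sequences with entries in the Laurent
   polynomials R[t, 1/t]: s_a has the entry t at (ax, x), s_a^* has the entry 1/t at (x, ax), and
   p_A is the diagonal indicator of A. Faithfulness follows from the normal form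
   s_alpha p_A s_beta^*: splitting off first letters via 1 = sum_a s_a s_a^* + p_(rest) removes the
   words alpha, and then the degree in t separates the words beta.

   Call x and y tail equivalent with lag k = m - n if the m-th shift of x is the n-th shift of y. A
   minimal left ideal contains, after right translation, an element with a nonzero diagonal entry
   at an isolated point. That point cannot be ultimately periodic, because there the corner of the
   algebra consists of Laurent polynomials and 1 + t^d is not a unit. Hence the socle is spanned by
   the matrix units t^k e_(x,y) with x, y in Q_X tail equivalent with lag k, which have degree k.
   Strong gradedness thus means that every x in Q_X has partners of every lag. Shifting x provides
   the lags of one sign, and lag 1 is what Condition (Y) supplies for the other sign. *)

theory Submission
  imports Defs
begin

text \<open>Without the variable t the matrices would forget the grading: for the one-point subshift
  {aaa...} the algebra is R[t, 1/t], and it acts faithfully on its single point only because s_a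
  becomes t. The alphabet may be infinite, so only finitely many letters are split off at a time;
  once these include the first letters of all left words, the projection onto the remaining
  sequences kills every term with a nonempty left word.

  The delicate point is why a minimal left ideal reaches an isolated point. Near a diagonal position
  a term s_alpha p_A s_beta^* is scalar, except at the at most one point alpha z = beta z with words
  of different lengths. A nonisolated point has only infinite neighbourhoods, so each contains a
  point v outside the finitely many exceptional ones, and near v an element of the ideal compresses
  to a nonzero multiple of some p_D. If D had a second point it could be cut further, against
  minimality; so D = {v}.

  Lag 1 matches Condition (Y) because a path of length k + 1 ending at the k-th shift of x starts at
  some y whose (k+1)-st shift is that same sequence.\<close>

abbreviation monom :: "'k \<Rightarrow> 'c \<Rightarrow> 'k \<Rightarrow>\<^sub>0 'c::zero" where "monom \<equiv> Poly_Mapping.single"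
abbreviation coeff :: "('k \<Rightarrow>\<^sub>0 'c::zero) \<Rightarrow> 'k \<Rightarrow> 'c" where "coeff \<equiv> Poly_Mapping.lookup"
abbreviation keys :: "('k \<Rightarrow>\<^sub>0 'c::zero) \<Rightarrow> 'k set" where "keys \<equiv> Poly_Mapping.keys"

section \<open>Column-finite matrices\<close>

text \<open>Finite columns make the sums in a matrix product finite while still admitting the
  identity and other infinite diagonal matrices. The index type can then be the whole type of
  sequences.\<close>

typedef (overloaded) ('i, 'c::zero) cmat = "{M :: 'i \<Rightarrow> 'i \<Rightarrow> 'c. \<forall>j. finite {i. M i j \<noteq> 0}}"
  morphisms ent Abs_cmat
  by (intro exI[of _ "\<lambda>_ _. 0"]) simp

setup_lifting type_definition_cmat

lemma finite_column [simp]: "finite {i. ent M i j \<noteq> 0}"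
  using ent[of M] by blast

lemma cmat_eqI: "(\<And>i j. ent M i j = ent N i j) \<Longrightarrow> M = N"
  by (simp add: ent_inject[symmetric] fun_eq_iff)

lemma column_mult_finite:
  fixes M N :: "'i \<Rightarrow> 'i \<Rightarrow> 'c::semiring_0"
  assumes M: "\<And>j. finite {i. M i j \<noteq> 0}" and N: "finite {k. N k j \<noteq> 0}"
  shows "finite {i. (\<Sum>k | N k j \<noteq> 0. M i k * N k j) \<noteq> 0}"
proof (rule finite_subset)
  show "{i. (\<Sum>k | N k j \<noteq> 0. M i k * N k j) \<noteq> 0} \<subseteq> (\<Union>k\<in>{k. N k j \<noteq> 0}. {i. M i k \<noteq> 0})"
  proof
    fix i assume "i \<in> {i. (\<Sum>k | N k j \<noteq> 0. M i k * N k j) \<noteq> 0}"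
    then obtain k where "N k j \<noteq> 0" "M i k * N k j \<noteq> 0"
      by (metis (mono_tags, lifting) mem_Collect_eq sum.neutral)
    thus "i \<in> (\<Union>k\<in>{k. N k j \<noteq> 0}. {i. M i k \<noteq> 0})" by auto
  qed
qed (use assms in auto)

instantiation cmat :: (type, comm_ring_1) ring_1
begin

lift_definition zero_cmat :: "('a, 'b) cmat" is "\<lambda>_ _. 0" by simp

lift_definition one_cmat :: "('a, 'b) cmat" is "\<lambda>i j. if i = j then 1 else 0"
  by simp

lift_definition plus_cmat :: "('a, 'b) cmat \<Rightarrow> ('a, 'b) cmat \<Rightarrow> ('a, 'b) cmat"
  is "\<lambda>M N i j. M i j + N i j"
proof -
  fix M N :: "'a \<Rightarrow> 'a \<Rightarrow> 'b" and j
  assume a: "\<And>j. finite {i. M i j \<noteq> 0}" "\<And>j. finite {i. N i j \<noteq> 0}"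
  show "finite {i. M i j + N i j \<noteq> 0}"
    by (rule finite_subset[of _ "{i. M i j \<noteq> 0} \<union> {i. N i j \<noteq> 0}"]) (use a in auto)
qed

lift_definition uminus_cmat :: "('a, 'b) cmat \<Rightarrow> ('a, 'b) cmat" is "\<lambda>M i j. - M i j"
  by simp

lift_definition minus_cmat :: "('a, 'b) cmat \<Rightarrow> ('a, 'b) cmat \<Rightarrow> ('a, 'b) cmat"
  is "\<lambda>M N i j. M i j - N i j"
proof -
  fix M N :: "'a \<Rightarrow> 'a \<Rightarrow> 'b" and j
  assume a: "\<And>j. finite {i. M i j \<noteq> 0}" "\<And>j. finite {i. N i j \<noteq> 0}"
  show "finite {i. M i j - N i j \<noteq> 0}"
    by (rule finite_subset[of _ "{i. M i j \<noteq> 0} \<union> {i. N i j \<noteq> 0}"]) (use a in auto)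
qed

lift_definition times_cmat :: "('a, 'b) cmat \<Rightarrow> ('a, 'b) cmat \<Rightarrow> ('a, 'b) cmat"
  is "\<lambda>M N i j. \<Sum>k | N k j \<noteq> 0. M i k * N k j"
  by (rule column_mult_finite) auto

text \<open>The product sums over the exact support of a column, which changes with the right
  factor. Passing to a common finite superset lets several products be compared term by
  term.\<close>

lemma ent_mult_superset:
  fixes M N :: "('a, 'b) cmat"
  assumes "finite K" "\<And>k. ent N k j \<noteq> 0 \<Longrightarrow> k \<in> K"
  shows "ent (M * N) i j = (\<Sum>k\<in>K. ent M i k * ent N k j)"
  unfolding times_cmat.rep_eq
  by (rule sum.mono_neutral_left) (use assms in auto)

instance
proof
  fix a b c :: "('a, 'b) cmat"
  show "a * b * c = a * (b * c)"
  proof (rule cmat_eqI)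
    fix i j
    define L where "L = {l. ent c l j \<noteq> 0}"
    define K where "K = (\<Union>l\<in>L. {k. ent b k l \<noteq> 0})"
    have fin: "finite L" "finite K" by (auto simp: L_def K_def)
    have bc: "ent (b * c) k j = (\<Sum>l\<in>L. ent b k l * ent c l j)" for k
      by (rule ent_mult_superset) (use fin in \<open>auto simp: L_def\<close>)
    have ab: "ent (a * b) i l = (\<Sum>k\<in>K. ent a i k * ent b k l)" if "l \<in> L" for l
      by (rule ent_mult_superset) (use fin that in \<open>auto simp: K_def\<close>)
    have "ent (a * (b * c)) i j = (\<Sum>k\<in>K. ent a i k * ent (b * c) k j)"
    proof (rule ent_mult_superset)
      fix k assume "ent (b * c) k j \<noteq> 0"
      then obtain l where "l \<in> L" "ent b k l * ent c l j \<noteq> 0"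
        unfolding bc by (metis (no_types, lifting) sum.neutral)
      moreover from this have "ent b k l \<noteq> 0" by auto
      ultimately show "k \<in> K" by (auto simp: K_def)
    qed (rule fin)
    also have "\<dots> = (\<Sum>k\<in>K. \<Sum>l\<in>L. ent a i k * ent b k l * ent c l j)"
      by (simp add: bc sum_distrib_left mult.assoc)
    also have "\<dots> = (\<Sum>l\<in>L. (\<Sum>k\<in>K. ent a i k * ent b k l) * ent c l j)"
      by (subst sum.swap) (simp add: sum_distrib_right)
    also have "\<dots> = (\<Sum>l\<in>L. ent (a * b) i l * ent c l j)"
      by (simp add: ab)
    also have "\<dots> = ent (a * b * c) i j"
      by (rule ent_mult_superset[symmetric]) (use fin in \<open>auto simp: L_def\<close>)
    finally show "ent (a * b * c) i j = ent (a * (b * c)) i j" ..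
  qed
  show "a + b + c = a + (b + c)" "a + b = b + a" "0 + a = a" "- a + a = 0" "a - b = a + - b"
    by (rule cmat_eqI, simp add: plus_cmat.rep_eq zero_cmat.rep_eq uminus_cmat.rep_eq
      minus_cmat.rep_eq add.assoc add.commute)+
  show "1 * a = a"
  proof (rule cmat_eqI)
    fix i j
    let ?K = "insert i {k. ent a k j \<noteq> 0}"
    have "ent (1 * a) i j = (\<Sum>k\<in>?K. ent 1 i k * ent a k j)"
      by (rule ent_mult_superset) auto
    also have "\<dots> = (\<Sum>k\<in>?K. if k = i then ent a i j else 0)"
      by (rule sum.cong) (auto simp: one_cmat.rep_eq)
    finally show "ent (1 * a) i j = ent a i j"
      by (simp add: sum.delta')
  qed
  show "a * 1 = a"
  proof (rule cmat_eqI)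
    fix i j
    have "ent (a * 1) i j = (\<Sum>k\<in>{j}. ent a i k * ent 1 k j)"
      by (rule ent_mult_superset) (auto simp: one_cmat.rep_eq split: if_splits)
    thus "ent (a * 1) i j = ent a i j" by (simp add: one_cmat.rep_eq)
  qed
  show "(a + b) * c = a * c + b * c"
    by (rule cmat_eqI) (simp add: times_cmat.rep_eq plus_cmat.rep_eq sum.distrib distrib_right)
  show "a * (b + c) = a * b + a * c"
  proof (rule cmat_eqI)
    fix i j
    let ?K = "{k. ent b k j \<noteq> 0} \<union> {k. ent c k j \<noteq> 0}"
    have "ent (a * x) i j = (\<Sum>k\<in>?K. ent a i k * ent x k j)" if "x \<in> {b, c, b + c}" for x
      by (rule ent_mult_superset) (use that in \<open>auto simp: plus_cmat.rep_eq\<close>)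
    thus "ent (a * (b + c)) i j = ent (a * b + a * c) i j"
      by (simp add: plus_cmat.rep_eq sum.distrib[symmetric] distrib_left)
  qed
  show "(0 :: ('a, 'b) cmat) \<noteq> 1"
    by (metis one_cmat.rep_eq zero_cmat.rep_eq zero_neq_one)
qed

end

lemmas ent_simps [simp] =
  zero_cmat.rep_eq plus_cmat.rep_eq uminus_cmat.rep_eq minus_cmat.rep_eq

lemma ent_one: "ent 1 i j = (if i = j then 1 else 0)"
  by (simp add: one_cmat.rep_eq)

lemma cmat_neq_0I: "ent M i j \<noteq> 0 \<Longrightarrow> M \<noteq> 0"
  by auto

lemma ent_sum: "ent (sum f I) i j = (\<Sum>k\<in>I. ent (f k) i j)"
  by (induction I rule: infinite_finite_induct) auto

lemma ent_mult_neq_zeroE: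
  fixes M N :: "('i, 'c::comm_ring_1) cmat"
  assumes "ent (M * N) i j \<noteq> 0"
  obtains k where "ent M i k \<noteq> 0" "ent N k j \<noteq> 0"
proof -
  have "\<exists>k. ent N k j \<noteq> 0 \<and> ent M i k * ent N k j \<noteq> 0"
    using assms unfolding times_cmat.rep_eq by (metis (mono_tags, lifting) mem_Collect_eq sum.neutral)
  then obtain k where k: "ent N k j \<noteq> 0" "ent M i k * ent N k j \<noteq> 0" by blast
  hence "ent M i k \<noteq> 0" by auto
  thus thesis using that k(1) by blast
qed

lift_definition unitm :: "'i \<Rightarrow> 'i \<Rightarrow> 'c \<Rightarrow> ('i, 'c::zero) cmat"
  is "\<lambda>i j c x y. if x = i \<and> y = j then c else 0"
  by (simp add: if_distrib)

lemma ent_unitm: "ent (unitm i j c) x y = (if x = i \<and> y = j then c else 0)"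
  by (simp add: unitm.rep_eq)

lemma ent_unitm_mult:
  fixes M :: "('i, 'c::comm_ring_1) cmat"
  shows "ent (unitm i j c * M) x y = (if x = i then c * ent M j y else 0)"
proof (subst ent_mult_superset[of "insert j {k. ent M k y \<noteq> 0}"])
  have "(\<Sum>k\<in>insert j {k. ent M k y \<noteq> 0}. ent (unitm i j c) x k * ent M k y)
      = (\<Sum>k\<in>insert j {k. ent M k y \<noteq> 0}. if k = j then (if x = i then c * ent M j y else 0) else 0)"
    by (rule sum.cong) (auto simp: ent_unitm)
  thus "(\<Sum>k\<in>insert j {k. ent M k y \<noteq> 0}. ent (unitm i j c) x k * ent M k y) =
    (if x = i then c * ent M j y else 0)"
    by (simp add: sum.delta')
qed auto

lemma ent_mult_unitm:
  fixes M :: "('i, 'c::comm_ring_1) cmat"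
  shows "ent (M * unitm i j c) x y = (if y = j then ent M x i * c else 0)"
proof -
  have "ent (M * unitm i j c) x y = (\<Sum>k\<in>{i}. ent M x k * ent (unitm i j c) k y)"
    by (rule ent_mult_superset) (auto simp: ent_unitm split: if_splits)
  thus ?thesis by (simp add: ent_unitm)
qed

lemma unitm_mult_unitm:
  fixes c d :: "'c::comm_ring_1"
  shows "unitm i j c * unitm k l d = (if j = k then unitm i l (c * d) else 0)"
  by (rule cmat_eqI) (simp add: ent_unitm_mult ent_unitm)

lemma unitm_corner:
  fixes M :: "('i, 'c::comm_ring_1) cmat"
  shows "unitm i i 1 * M * unitm j j 1 = unitm i j (ent M i j)"
  by (rule cmat_eqI) (simp add: ent_unitm_mult ent_mult_unitm ent_unitm)

lift_definition smat :: "'c \<Rightarrow> ('i, 'c::zero) cmat" is "\<lambda>c x y. if x = y then c else 0"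
  by simp

lemma ent_smat: "ent (smat c) x y = (if x = y then c else 0)"
  by (simp add: smat.rep_eq)

lemma ent_smat_mult [simp]:
  fixes M :: "('i, 'c::comm_ring_1) cmat"
  shows "ent (smat c * M) x y = c * ent M x y"
proof (subst ent_mult_superset[of "insert x {k. ent M k y \<noteq> 0}"])
  have "(\<Sum>k\<in>insert x {k. ent M k y \<noteq> 0}. ent (smat c) x k * ent M k y)
      = (\<Sum>k\<in>insert x {k. ent M k y \<noteq> 0}. if k = x then c * ent M x y else 0)"
    by (rule sum.cong) (auto simp: ent_smat)
  thus "(\<Sum>k\<in>insert x {k. ent M k y \<noteq> 0}. ent (smat c) x k * ent M k y) = c * ent M x y"
    by (simp add: sum.delta')
qed auto

lemma ent_mult_smat [simp]:
  fixes M :: "('i, 'c::comm_ring_1) cmat"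
  shows "ent (M * smat c) x y = c * ent M x y"
proof -
  have "ent (M * smat c) x y = (\<Sum>k\<in>{y}. ent M x k * ent (smat c) k y)"
    by (rule ent_mult_superset) (auto simp: ent_smat split: if_splits)
  thus ?thesis by (simp add: ent_smat mult.commute)
qed

lemma smat_commute: "smat c * M = M * smat (c :: 'c::comm_ring_1)"
  by (rule cmat_eqI) simp

lemma smat_add: "smat (c + d) = smat c + smat (d :: 'c::comm_ring_1)"
  by (rule cmat_eqI) (simp add: ent_smat)

lemma smat_mult: "smat (c * d) = smat c * smat (d :: 'c::comm_ring_1)"
  by (rule cmat_eqI) (simp add: ent_smat)

lemma smat_1 [simp]: "smat 1 = (1 :: ('i, 'c::comm_ring_1) cmat)"
  by (rule cmat_eqI) (simp add: ent_smat ent_one)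

lemma smat_mult_unitm: "smat c * unitm x y d = unitm x y (c * d :: 'c::comm_ring_1)"
  by (rule cmat_eqI) (simp add: ent_unitm)


text \<open>A matrix unit on the right selects a single column, and columns are finite. This is why
  spans of matrix units absorb left multiplication.\<close>

lemma mult_unitm_sum:
  fixes M :: "('i, 'c::comm_ring_1) cmat"
  shows "M * unitm i j c = (\<Sum>w | ent M w i \<noteq> 0. unitm w j (ent M w i * c))"
proof (rule cmat_eqI)
  fix x y
  have "(\<Sum>w | ent M w i \<noteq> 0. ent (unitm w j (ent M w i * c)) x y)
      = (\<Sum>w | ent M w i \<noteq> 0. if w = x then (if y = j then ent M x i * c else 0) else 0)"
    by (rule sum.cong) (auto simp: ent_unitm)
  thus "ent (M * unitm i j c) x y = ent (\<Sum>w | ent M w i \<noteq> 0. unitm w j (ent M w i * c)) x y"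
    by (auto simp: ent_sum ent_mult_unitm)
qed

text \<open>The type bounds columns only, so finiteness of the selected row enters as a hypothesis;
  \<open>mat_alg_row_finite\<close> will supply it.\<close>

lemma unitm_mult_sum:
  fixes M :: "('i, 'c::comm_ring_1) cmat"
  assumes "finite {w. ent M j w \<noteq> 0}"
  shows "unitm i j c * M = (\<Sum>w | ent M j w \<noteq> 0. unitm i w (c * ent M j w))"
proof (rule cmat_eqI)
  fix x y
  have "(\<Sum>w | ent M j w \<noteq> 0. ent (unitm i w (c * ent M j w)) x y)
      = (\<Sum>w | ent M j w \<noteq> 0. if w = y then (if x = i then c * ent M j y else 0) else 0)"
    by (rule sum.cong) (auto simp: ent_unitm)
  thus "ent (unitm i j c * M) x y = ent (\<Sum>w | ent M j w \<noteq> 0. unitm i w (c * ent M j w)) x y"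
    using assms by (auto simp: ent_sum ent_unitm_mult)
qed


section \<open>Additive closures\<close>

text \<open>Sums suffice because the sets of generators used below are already closed under
  negation; inductions then have a single addition step.\<close>

inductive_set add_closure :: "'m::ab_group_add set \<Rightarrow> 'm set" for K where
  zero: "0 \<in> add_closure K"
| add: "k \<in> K \<Longrightarrow> x \<in> add_closure K \<Longrightarrow> k + x \<in> add_closure K"

lemma add_closure_incl: "k \<in> K \<Longrightarrow> k \<in> add_closure K"
  using add_closure.add[OF _ add_closure.zero] by fastforce

lemma add_closure_add: "x \<in> add_closure K \<Longrightarrow> y \<in> add_closure K \<Longrightarrow> x + y \<in> add_closure K"
  by (induction rule: add_closure.induct) (auto simp: add.assoc intro: add_closure.add)

lemma add_closure_sum: "(\<And>i. i \<in> I \<Longrightarrow> f i \<in> add_closure K) \<Longrightarrow> sum f I \<in> add_closure K"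
  by (induction I rule: infinite_finite_induct) (auto intro: add_closure.zero add_closure_add)

lemma add_closure_minimal:
  assumes "K \<subseteq> M" "0 \<in> M" "\<And>x y. x \<in> M \<Longrightarrow> y \<in> M \<Longrightarrow> x + y \<in> M"
  shows "add_closure K \<subseteq> M"
proof
  fix x assume "x \<in> add_closure K"
  thus "x \<in> M"
  proof induction
    case (add k x)
    show ?case by (rule assms(3)) (use add assms(1) in auto)
  qed (rule assms(2))
qed

lemma add_closure_mono: "K \<subseteq> add_closure M \<Longrightarrow> add_closure K \<subseteq> add_closure M"
  by (rule add_closure_minimal) (auto intro: add_closure.zero add_closure_add)

lemma add_closure_map:
  assumes "x \<in> add_closure K" "f 0 = 0" "\<And>x y. f (x + y) = f x + f y"
    and "\<And>k. k \<in> K \<Longrightarrow> f k \<in> add_closure M"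
  shows "f x \<in> add_closure M"
  using assms(1)
proof induction
  case zero
  show ?case by (simp add: assms(2) add_closure.zero)
next
  case (add k x)
  show ?case unfolding assms(3) by (intro add_closure_add assms(4) add)
qed

lemma add_closure_mult_left:
  fixes a :: "'m::ring"
  assumes "x \<in> add_closure K" "\<And>k. k \<in> K \<Longrightarrow> a * k \<in> add_closure M"
  shows "a * x \<in> add_closure M"
  by (rule add_closure_map[where f = "\<lambda>x. a * x", OF assms(1)]) (simp_all add: assms(2) distrib_left)

lemma add_closure_mult_right:
  fixes a :: "'m::ring"
  assumes "x \<in> add_closure K" "\<And>k. k \<in> K \<Longrightarrow> k * a \<in> add_closure M"
  shows "x * a \<in> add_closure M"
  by (rule add_closure_map[where f = "\<lambda>x. x * a", OF assms(1)]) (simp_all add: assms(2) distrib_right)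

lemma add_closure_mult:
  fixes x y :: "'m::ring"
  assumes "x \<in> add_closure K" "y \<in> add_closure L"
    and "\<And>k l. k \<in> K \<Longrightarrow> l \<in> L \<Longrightarrow> k * l \<in> add_closure M"
  shows "x * y \<in> add_closure M"
  by (rule add_closure_mult_right[OF assms(1)], rule add_closure_mult_left[OF assms(2)])
    (rule assms(3))

section \<open>The Boolean algebra of a subshift\<close>

abbreviation pref :: "nat \<Rightarrow> 'a word \<Rightarrow> 'a list" where
  "pref n x \<equiv> subsequence x 0 n"

lemma shift_funpow: "(shift ^^ n) x = suffix n x"
  by (induction n) (simp_all add: shift_def)

section \<open>Ultimately periodic sequences and tail equivalence with lag\<close>

definition ultimately_periodic :: "'a word \<Rightarrow> bool" where
  "ultimately_periodic x \<longleftrightarrow> (\<exists>i j. i \<noteq> j \<and> suffix i x = suffix j x)"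

text \<open>This turns the exclusion in \<open>Q_set\<close>, phrased with words, into a condition
  on shifts, which is easy to transport along tail equivalence.\<close>

lemma conc_periodic_iff:
  "ultimately_periodic x \<longleftrightarrow> (\<exists>\<alpha> \<beta>. \<beta> \<noteq> [] \<and> x = \<alpha> \<frown> \<beta>\<^sup>\<omega>)"
proof
  assume "ultimately_periodic x"
  then obtain i j where "i \<noteq> j" "suffix i x = suffix j x"
    unfolding ultimately_periodic_def by blast
  then obtain i j where ij: "i < j" "suffix i x = suffix j x"
    by (metis nat_neq_iff)
  have per: "x (i + n) = x (i + n mod (j - i))" for n
  proof (induction n rule: less_induct)
    case (less n)
    show ?case
    proof (cases "n < j - i")
      case False
      have "x (i + n) = x (j + (n - (j - i)))" using False ij by (auto intro: arg_cong[of _ _ x])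
      also have "\<dots> = x (i + (n - (j - i)))" using ij(2) by (metis suffix_nth)
      also have "\<dots> = x (i + (n - (j - i)) mod (j - i))" by (rule less) (use False ij in auto)
      also have "(n - (j - i)) mod (j - i) = n mod (j - i)" using False by (simp add: le_mod_geq)
      finally show ?thesis .
    qed simp
  qed
  have "x = pref i x \<frown> (subsequence x i j)\<^sup>\<omega>"
  proof
    fix n
    show "x n = (pref i x \<frown> (subsequence x i j)\<^sup>\<omega>) n"
    proof (cases "n < i")
      case False
      hence "x n = x (i + (n - i) mod (j - i))" using per[of "n - i"] by simp
      thus ?thesis using False ij by simp
    qed simp
  qed
  thus "\<exists>\<alpha> \<beta>. \<beta> \<noteq> [] \<and> x = \<alpha> \<frown> \<beta>\<^sup>\<omega>" using ij by (metis subsequence_empty not_le)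
next
  assume "\<exists>\<alpha> \<beta>. \<beta> \<noteq> [] \<and> x = \<alpha> \<frown> \<beta>\<^sup>\<omega>"
  then obtain \<alpha> \<beta> where b: "\<beta> \<noteq> []" "x = \<alpha> \<frown> \<beta>\<^sup>\<omega>" by blast
  \<comment> \<open>Unrolling one copy of \<open>\<beta>\<close> presents \<open>x\<close> with two
    prefixes of different lengths and the same remainder.\<close>
  have "x = (\<alpha> @ \<beta>) \<frown> \<beta>\<^sup>\<omega>" using b iter_unroll[of \<beta>] by (metis conc_conc length_greater_0_conv)
  hence "suffix (length (\<alpha> @ \<beta>)) x = suffix (length \<alpha>) x"
    using b(2) by (metis suffix_conc_length)
  thus "ultimately_periodic x" using b(1) unfolding ultimately_periodic_def
    by (intro exI[of _ "length (\<alpha> @ \<beta>)"] exI[of _ "length \<alpha>"]) simp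
qed

text \<open>A solution of \<open>\<alpha> \<frown> u = \<beta> \<frown> u\<close> is determined
  letter by letter: its letter \<open>n\<close> is the letter of \<open>\<beta> \<frown> u\<close>
  at position \<open>length \<alpha> + n\<close>, hence a letter of \<open>\<beta>\<close> or an
  earlier letter of \<open>u\<close>. This bounds the number of exceptional diagonal points of a
  term.\<close>

lemma conc_fixed_unique:
  assumes "\<alpha> \<frown> u = \<beta> \<frown> u" "\<alpha> \<frown> w = \<beta> \<frown> w" "length \<alpha> < length \<beta>"
  shows "u = w"
proof
  fix n
  show "u n = w n"
  proof (induction n rule: less_induct)
    case (less n)
    have "u n = (\<alpha> \<frown> u) (length \<alpha> + n)" "w n = (\<alpha> \<frown> w) (length \<alpha> + n)" by simp_all
    hence eq: "u n = (\<beta> \<frown> u) (length \<alpha> + n)" "w n = (\<beta> \<frown> w) (length \<alpha> + n)"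
      using assms(1,2) by simp_all
    show ?case
    proof (cases "length \<alpha> + n < length \<beta>")
      case True
      thus ?thesis unfolding eq by simp
    next
      case False
      thus ?thesis unfolding eq using less[of "length \<alpha> + n - length \<beta>"] assms(3) by simp
    qed
  qed
qed

text \<open>The orbit relation together with its integer cocycle, the second component of the
  Deaconu--Renault groupoid.\<close>

definition lag :: "'a word \<Rightarrow> 'a word \<Rightarrow> int \<Rightarrow> bool" where
  "lag x y k \<longleftrightarrow> (\<exists>m n. suffix m x = suffix n y \<and> k = int m - int n)"

lemma lag_refl: "lag x x 0"
  unfolding lag_def by (intro exI[of _ 0]) simp

lemma lag_sym: "lag x y k \<Longrightarrow> lag y x (- k)"
  unfolding lag_def by (metis minus_diff_eq)

lemma lag_trans:
  assumes "lag x y k" "lag y z l"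
  shows "lag x z (k + l)"
proof -
  obtain m n i j where "suffix m x = suffix n y" "k = int m - int n"
    "suffix i y = suffix j z" "l = int i - int j"
    using assms unfolding lag_def by blast
  hence "suffix (m + i) x = suffix (j + n) z" "k + l = int (m + i) - int (j + n)"
    by (metis suffix_suffix add.commute, simp)
  thus ?thesis unfolding lag_def by blast
qed

lemma lag_suffix: "lag (suffix n x) x (- int n)"
  unfolding lag_def by (intro exI[of _ 0] exI[of _ n]) simp

lemma lag_conc: "lag (\<alpha> \<frown> z) (\<beta> \<frown> z) (int (length \<alpha>) - int (length \<beta>))"
  unfolding lag_def by (metis suffix_conc_length)

lemma lagE:
  assumes "lag x y k"
  obtains \<alpha> \<beta> z where "x = \<alpha> \<frown> z" "y = \<beta> \<frown> z" "k = int (length \<alpha>) - int (length \<beta>)"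
proof -
  obtain m n where mn: "suffix m x = suffix n y" "k = int m - int n"
    using assms unfolding lag_def by blast
  have "x = pref m x \<frown> suffix m x" "y = pref n y \<frown> suffix m x"
    by (rule prefix_suffix, subst mn(1), rule prefix_suffix)
  thus thesis using that[of "pref m x" "suffix m x" "pref n y"] mn(2) by simp
qed

lemma lag_zero_periodic:
  assumes "lag x x k" "k \<noteq> 0"
  shows "ultimately_periodic x"
  using assms unfolding lag_def ultimately_periodic_def by (metis diff_self)

text \<open>Two different lags would compose to a nonzero lag from \<open>x\<close> to itself, that
  is, to ultimate periodicity. So away from ultimately periodic points a matrix position determines
  its degree.\<close>

lemma lag_unique:
  assumes "lag x y k" "lag x y l" "\<not> ultimately_periodic x"
  shows "k = l"
  using lag_zero_periodic[OF lag_trans[OF assms(1) lag_sym[OF assms(2)]]] assms(3) by auto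

lemma ultimately_periodic_lag:
  assumes "lag x y k" "ultimately_periodic y"
  shows "ultimately_periodic x"
proof -
  obtain m n where mn: "suffix m x = suffix n y" using assms(1) unfolding lag_def by blast
  obtain i j where ij: "i \<noteq> j" "suffix i y = suffix j y"
    using assms(2) unfolding ultimately_periodic_def by blast
  have "suffix (m + i) x = suffix (n + i) y" "suffix (m + j) x = suffix (n + j) y"
    by (metis suffix_suffix mn)+
  moreover have "suffix (n + i) y = suffix (n + j) y"
    by (metis suffix_suffix ij(2) add.commute)
  ultimately show ?thesis using ij(1) unfolding ultimately_periodic_def
    by (metis add_left_cancel)
qed

section \<open>Subshifts, relative ranges and extensions\<close>

locale subshift_space =
  fixes X :: "'a word set"
  assumes subshift: "subshift X" and letters: "all_letters_occur X"
begin

abbreviation \<U> :: "'a word set set" where "\<U> \<equiv> bool_alg X"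

lemma suffix_in_X:
  assumes "x \<in> X"
  shows "suffix n x \<in> X"
proof -
  obtain F where F: "X = {x. \<forall>w\<in>F. \<not> occurs_in w x}" using subshift unfolding subshift_def by blast
  have "occurs_in w x" if "occurs_in w (suffix n x)" for w
    using that unfolding occurs_in_def by (metis subsequence_shift add.assoc)
  thus ?thesis using assms F by blast
qed

lemma conc_in_X: "\<alpha> \<frown> z \<in> X \<Longrightarrow> z \<in> X"
  using suffix_in_X[of "\<alpha> \<frown> z" "length \<alpha>"] by simp

lemma build_in_X: "a ## z \<in> X \<Longrightarrow> z \<in> X"
  using conc_in_X[of "[a]" z] by simp

lemma language_conc: "\<alpha> \<frown> z \<in> X \<Longrightarrow> \<alpha> \<in> language X"
  unfolding language_def occurs_in_def
  by (auto intro!: bexI[of _ "\<alpha> \<frown> z"] exI[of _ 0])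

lemma letter_language: "[a] \<in> language X"
proof -
  obtain x n where "x \<in> X" "a = x n" using letters unfolding all_letters_occur_def by blast
  thus ?thesis unfolding language_def occurs_in_def
    by (auto intro!: bexI[of _ x] exI[of _ n])
qed

lemma Nil_language: "[] \<in> language X"
proof -
  obtain x where "x \<in> X" using letters unfolding all_letters_occur_def by blast
  thus ?thesis using language_conc[of "[]" x] by simp
qed

lemma in_C_set: "x \<in> C_set X \<alpha> \<beta> \<longleftrightarrow> x \<in> X \<and> (\<exists>z. x = \<beta> \<frown> z \<and> \<alpha> \<frown> z \<in> X)"
  unfolding C_set_def by auto

lemma C_set_Nil_left: "C_set X [] \<beta> = {x \<in> X. \<exists>z. x = \<beta> \<frown> z}"
  by (auto simp: in_C_set dest: conc_in_X)

lemma in_C_set_Nil [simp]: "x \<in> C_set X \<alpha> [] \<longleftrightarrow> \<alpha> \<frown> x \<in> X"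
  by (auto simp: in_C_set dest: conc_in_X)

lemma C_set_Nil_Nil: "C_set X [] [] = X"
  by auto

lemma bool_alg_subset: "A \<in> \<U> \<Longrightarrow> A \<subseteq> X"
  by (induction rule: bool_alg.induct) (auto simp: in_C_set)

lemma X_bool_alg: "X \<in> \<U>"
  using bool_alg.C[OF Nil_language Nil_language] by (simp add: C_set_Nil_Nil)

lemma empty_bool_alg: "{} \<in> \<U>"
  using bool_alg.compl[OF X_bool_alg] by simp

lemma diff_bool_alg:
  assumes "A \<in> \<U>" "B \<in> \<U>"
  shows "A - B \<in> \<U>"
proof -
  have "A - B = A \<inter> (X - B)" using bool_alg_subset assms by blast
  thus ?thesis using assms by (simp add: bool_alg.inter bool_alg.compl)
qed

lemma C_set_bool_alg: "C_set X \<alpha> \<beta> \<in> \<U>"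
proof (cases "\<alpha> \<in> language X \<and> \<beta> \<in> language X")
  case False
  hence "C_set X \<alpha> \<beta> = {}" using language_conc by (auto simp: in_C_set)
  thus ?thesis by (simp add: empty_bool_alg)
qed (simp add: bool_alg.C)

text \<open>The relative range of \<open>A\<close> under \<open>\<alpha>\<close>, which replaces
  \<open>A\<close> when p_A is moved past s_\<alpha>.\<close>

definition rng :: "'a word set \<Rightarrow> 'a list \<Rightarrow> 'a word set" where
  "rng A \<alpha> = {z. \<alpha> \<frown> z \<in> A}"

text \<open>The set whose indicator is the diagonal matrix of s_\<alpha> p_A s_\<alpha>^*.\<close>

definition ext :: "'a list \<Rightarrow> 'a word set \<Rightarrow> 'a word set" where
  "ext \<alpha> A = {\<alpha> \<frown> z | z. z \<in> A \<and> \<alpha> \<frown> z \<in> X}"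

lemma in_rng [simp]: "z \<in> rng A \<alpha> \<longleftrightarrow> \<alpha> \<frown> z \<in> A"
  by (simp add: rng_def)

text \<open>Prepending one letter is a partial injection, so it is compatible with the Boolean
  operations up to its domain. What remains are the generators
  \<open>C_set X \<alpha> \<beta>\<close>: if \<open>\<beta>\<close> is empty the letter is appended
  to \<open>\<alpha>\<close>, otherwise it is stripped from \<open>\<beta>\<close> or gives the
  empty set.\<close>

lemma rng_bool_alg:
  assumes "A \<in> \<U>"
  shows "rng A \<alpha> \<in> \<U>"
proof -
  have letter: "rng A [a] \<in> \<U>" if "A \<in> \<U>" for A a
    using that
  proof induction
    case (C \<alpha> \<beta>)
    show ?case
    proof (cases \<beta>)
      case Nil
      hence "rng (C_set X \<alpha> \<beta>) [a] = C_set X [a] [] \<inter> C_set X (\<alpha> @ [a]) []"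
        by (auto simp: in_C_set dest: conc_in_X build_in_X)
      thus ?thesis by (simp add: bool_alg.inter C_set_bool_alg)
    next
      case (Cons b \<beta>')
      hence "rng (C_set X \<alpha> \<beta>) [a] = (if a = b then C_set X [a] [] \<inter> C_set X \<alpha> \<beta>' else {})"
        by (auto simp: in_C_set dest: conc_in_X build_in_X)
      thus ?thesis by (simp add: bool_alg.inter C_set_bool_alg empty_bool_alg)
    qed
  next
    case (union A B)
    have "rng (A \<union> B) [a] = rng A [a] \<union> rng B [a]" by auto
    thus ?case using union by (simp add: bool_alg.union)
  next
    case (inter A B)
    have "rng (A \<inter> B) [a] = rng A [a] \<inter> rng B [a]" by auto
    thus ?case using inter by (simp add: bool_alg.inter)
  next
    case (compl A)
    have "rng (X - A) [a] = C_set X [a] [] - rng A [a]" by (auto simp: in_C_set dest: build_in_X)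
    thus ?case using compl by (simp add: diff_bool_alg C_set_bool_alg)
  qed
  show ?thesis using assms
  proof (induction \<alpha> arbitrary: A)
    case Nil
    have "rng A [] = A" by auto
    thus ?case using Nil by simp
  next
    case (Cons a \<alpha>)
    have "rng A (a # \<alpha>) = rng (rng A [a]) \<alpha>" by auto
    thus ?case using Cons letter by simp
  qed
qed

lemma ext_bool_alg:
  assumes "A \<in> \<U>"
  shows "ext \<alpha> A \<in> \<U>"
proof -
  have letter: "ext [a] A \<in> \<U>" if "A \<in> \<U>" for A a
    using that
  proof induction
    case (C \<alpha> \<beta>)
    have "ext [a] (C_set X \<alpha> \<beta>) = C_set X \<alpha> (a # \<beta>)"
      by (fastforce simp: ext_def in_C_set dest: build_in_X)
    thus ?case by (simp add: C_set_bool_alg)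
  next
    case (union A B)
    have "ext [a] (A \<union> B) = ext [a] A \<union> ext [a] B" by (auto simp: ext_def)
    thus ?case using union by (simp add: bool_alg.union)
  next
    case (inter A B)
    have "ext [a] (A \<inter> B) = ext [a] A \<inter> ext [a] B" by (auto simp: ext_def)
    thus ?case using inter by (simp add: bool_alg.inter)
  next
    case (compl A)
    have "ext [a] (X - A) = C_set X [] [a] - ext [a] A"
      by (auto simp: ext_def C_set_Nil_left dest: build_in_X)
    thus ?case using compl by (simp add: diff_bool_alg C_set_bool_alg)
  qed
  show ?thesis
  proof (induction \<alpha>)
    case Nil
    have "ext [] A = A" using bool_alg_subset[OF assms] by (auto simp: ext_def)
    thus ?case using assms by simp
  next
    case (Cons a \<alpha>)
    have "ext (a # \<alpha>) A = ext [a] (ext \<alpha> A)" by (auto simp: ext_def dest: build_in_X)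
    thus ?case using Cons letter by simp
  qed
qed

text \<open>Write \<open>x = \<alpha> \<frown> z\<close> and \<open>y = \<beta> \<frown> z\<close>.
  A relative range strips \<open>\<beta>\<close> from \<open>{y}\<close> and an extension prepends
  \<open>\<alpha>\<close>, so being isolated is invariant under tail equivalence inside
  \<open>X\<close>.\<close>

lemma singleton_bool_alg_lag:
  assumes "{y} \<in> \<U>" "x \<in> X" "lag x y k"
  shows "{x} \<in> \<U>"
proof -
  obtain \<alpha> \<beta> z where z: "x = \<alpha> \<frown> z" "y = \<beta> \<frown> z" using assms(3) by (rule lagE)
  have "rng {y} \<beta> = {z}" using z by auto
  hence "{z} \<in> \<U>" using rng_bool_alg[OF assms(1)] by metis
  moreover have "ext \<alpha> {z} = {x}" using z assms(2) by (auto simp: ext_def)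
  ultimately show ?thesis using ext_bool_alg by metis
qed

section \<open>Cylinders, separation and isolated points\<close>

definition cylinder :: "nat \<Rightarrow> 'a word \<Rightarrow> 'a word set" where
  "cylinder n x = C_set X [] (pref n x)"

lemma cylinder_bool_alg: "cylinder n x \<in> \<U>"
  by (simp add: cylinder_def C_set_bool_alg)

lemma in_cylinder: "y \<in> cylinder n x \<longleftrightarrow> y \<in> X \<and> (\<forall>i<n. y i = x i)"
proof -
  have "(\<exists>z. y = pref n x \<frown> z) \<longleftrightarrow> (\<forall>i<n. y i = x i)"
  proof
    assume *: "\<forall>i<n. y i = x i"
    hence "pref n y = pref n x" by (simp add: list_eq_iff_nth_eq)
    thus "\<exists>z. y = pref n x \<frown> z" by (metis prefix_suffix)
  qed auto
  thus ?thesis by (simp add: cylinder_def C_set_Nil_left)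
qed

lemma separation:
  assumes "x \<in> X" "y \<noteq> x"
  obtains C where "C \<in> \<U>" "x \<in> C" "y \<notin> C"
proof -
  obtain i where "y i \<noteq> x i" using assms(2) by blast
  hence "y \<notin> cylinder (Suc i) x" "x \<in> cylinder (Suc i) x"
    using assms(1) by (auto simp: in_cylinder)
  thus thesis using that cylinder_bool_alg by blast
qed

lemma INT_bool_alg:
  assumes "finite I" "\<And>i. i \<in> I \<Longrightarrow> C i \<in> \<U>" "\<And>i. i \<in> I \<Longrightarrow> x \<in> C i" "x \<in> X"
  obtains D where "D \<in> \<U>" "x \<in> D" "\<And>i. i \<in> I \<Longrightarrow> D \<subseteq> C i"
proof -
  have "\<exists>D\<in>\<U>. x \<in> D \<and> (\<forall>i\<in>I. D \<subseteq> C i)"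
    using assms(1-3)
  proof (induction I)
    case empty
    show ?case using X_bool_alg assms(4) by blast
  next
    case (insert i I)
    then obtain D where "D \<in> \<U>" "x \<in> D" "\<forall>i\<in>I. D \<subseteq> C i" by auto
    thus ?case using insert.prems by (intro bexI[of _ "C i \<inter> D"]) (auto intro: bool_alg.inter)
  qed
  thus thesis using that by blast
qed

text \<open>Finitely many separating sets suffice to cut a finite member of \<open>\<U>\<close> down
  to one of its points. Used in the contrapositive: every neighbourhood of a nonisolated point is
  infinite.\<close>

lemma finite_singleton_bool_alg:
  assumes "C \<in> \<U>" "finite C" "x \<in> C"
  shows "{x} \<in> \<U>"
proof -
  have x: "x \<in> X" using assms bool_alg_subset by blast
  have "\<exists>D. D \<in> \<U> \<and> x \<in> D \<and> y \<notin> D" if "y \<in> C - {x}" for y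
    using separation[OF x] that by (metis Diff_iff singletonI)
  then obtain D where D: "\<And>y. y \<in> C - {x} \<Longrightarrow> D y \<in> \<U> \<and> x \<in> D y \<and> y \<notin> D y"
    by metis
  obtain E where E: "E \<in> \<U>" "x \<in> E" "\<And>y. y \<in> C - {x} \<Longrightarrow> E \<subseteq> D y"
    using INT_bool_alg[of "C - {x}" D x] assms(2) D x by blast
  have "{x} = C \<inter> E"
  proof
    show "C \<inter> E \<subseteq> {x}"
    proof
      fix y assume y: "y \<in> C \<inter> E"
      show "y \<in> {x}"
      proof (rule ccontr)
        assume "y \<notin> {x}"
        hence "y \<in> C - {x}" using y by blast
        thus False using D E(3) y by blast
      qed
    qed
  qed (use assms E in blast)
  thus ?thesis using bool_alg.inter[OF assms(1) E(1)] by simp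
qed

text \<open>In any presentation \<open>\<alpha> \<frown> \<beta>\<^sup>\<omega>\<close> of a point
  of \<open>X\<close> both words lie in the language, so the excluded points are exactly the
  ultimately periodic ones.\<close>

lemma Q_set_iff: "x \<in> Q_set X \<longleftrightarrow> {x} \<in> \<U> \<and> \<not> ultimately_periodic x"
proof -
  have "(\<exists>\<alpha>\<in>language X. \<exists>\<beta>\<in>language X. \<beta> \<noteq> [] \<and> x = \<alpha> \<frown> \<beta>\<^sup>\<omega>) \<longleftrightarrow> ultimately_periodic x"
    if "{x} \<in> \<U>"
  proof -
    have x: "x \<in> X" using that bool_alg_subset by blast
    have "\<alpha> \<in> language X \<and> \<beta> \<in> language X" if "\<beta> \<noteq> []" "x = \<alpha> \<frown> \<beta>\<^sup>\<omega>" for \<alpha> \<beta>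
    proof
      show "\<alpha> \<in> language X" using language_conc that x by blast
      have "\<beta>\<^sup>\<omega> \<in> X" using conc_in_X[of \<alpha>] that x by simp
      moreover have "\<beta>\<^sup>\<omega> = \<beta> \<frown> \<beta>\<^sup>\<omega>" by (rule iter_unroll) (use that in simp)
      ultimately show "\<beta> \<in> language X" using language_conc by metis
    qed
    thus ?thesis unfolding conc_periodic_iff by blast
  qed
  thus ?thesis unfolding Q_set_def by blast
qed

lemma Q_set_subset: "x \<in> Q_set X \<Longrightarrow> x \<in> X"
  using bool_alg_subset unfolding Q_set_iff by blast

lemma Q_set_lag:
  assumes "y \<in> Q_set X" "x \<in> X" "lag x y k"
  shows "x \<in> Q_set X"
  using singleton_bool_alg_lag[OF _ assms(2,3)] ultimately_periodic_lag[OF lag_sym[OF assms(3)]] assms(1)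
  unfolding Q_set_iff by blast

lemma Q_set_lag_unique: "x \<in> Q_set X \<Longrightarrow> lag x y k \<Longrightarrow> lag x y l \<Longrightarrow> k = l"
  using lag_unique unfolding Q_set_iff by blast

end

section \<open>Evaluation of free algebras\<close>

lemma poly_mapping_sum_single:
  "(\<Sum>w\<in>keys f. monom w (coeff f w)) = f"
proof (rule poly_mapping_eqI)
  fix k
  have "(\<Sum>w\<in>keys f. coeff (monom w (coeff f w)) k)
      = (\<Sum>w\<in>keys f. if w = k then coeff f k else 0)"
    by (rule sum.cong) (auto simp: lookup_single when_def)
  thus "coeff (\<Sum>w\<in>keys f. monom w (coeff f w)) k
      = coeff f k"
    by (simp add: lookup_sum in_keys_iff)
qed

lemma lookup_single_mult:
  fixes p :: "int \<Rightarrow>\<^sub>0 'r::comm_ring_1"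
  shows "coeff (monom m c * p) n = c * coeff p (n - m)"
proof -
  have "coeff (monom m c * p) n
      = (\<Sum>k\<in>keys p. coeff (monom (m + k) (c * coeff p k)) n)"
    by (subst poly_mapping_sum_single[symmetric, of p])
      (simp only: sum_distrib_left mult_single lookup_sum)
  also have "\<dots> = (\<Sum>k\<in>keys p. if k = n - m then c * coeff p k else 0)"
    by (rule sum.cong) (auto simp: lookup_single when_def)
  finally show ?thesis by (simp add: in_keys_iff)
qed

text \<open>If \<open>(1 + t\<^sup>d) q = 1\<close>, comparing highest and lowest terms forces the degree of \<open>q\<close> to be
  both \<open>0\<close> and \<open>- d\<close>.\<close>

lemma not_unit_one_plus_monomial:
  fixes q :: "int \<Rightarrow>\<^sub>0 'r::field"
  assumes "d \<noteq> 0"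
  shows "q * (1 + monom d 1) \<noteq> 1"
proof
  assume "q * (1 + monom d 1) = 1"
  hence "q + monom d 1 * q = 1" by (simp add: distrib_left mult.commute)
  hence "coeff (q + monom d 1 * q) n = coeff 1 n" for n by simp
  hence eq: "coeff q n + coeff q (n - d) = (if n = 0 then 1 else 0)" for n
    by (simp add: lookup_add lookup_single_mult lookup_one when_def)
  have ne: "keys q \<noteq> {}"
  proof
    assume "keys q = {}"
    hence "coeff q n = 0" for n using in_keys_iff by (metis empty_iff)
    thus False using eq[of 0] by simp
  qed
  define M where "M = Max (keys q)"
  define m where "m = Min (keys q)"
  have M: "coeff q M \<noteq> 0" and m: "coeff q m \<noteq> 0"
    using ne Max_in[OF finite_keys ne] Min_in[OF finite_keys ne] by (simp_all add: M_def m_def in_keys_iff)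
  have up: "coeff q n = 0" if "n > M" for n
    using Max_ge[OF finite_keys, of n q] that by (fastforce simp: M_def in_keys_iff)
  have lo: "coeff q n = 0" if "n < m" for n
    using Min_le[OF finite_keys, of n q] that by (fastforce simp: m_def in_keys_iff)
  have le: "m \<le> M" using up m not_less by blast
  \<comment> \<open>The sign of \<open>d\<close> decides which summand carries the top term. The
    product is 1, so its highest and lowest degrees are both 0: for \<open>d > 0\<close> these are
    \<open>M + d\<close> and \<open>m\<close>, for \<open>d < 0\<close> they are \<open>M\<close>
    and \<open>m + d\<close>.\<close>
  show False
  proof (cases "d > 0")
    case True
    hence "M + d = 0" using eq[of "M + d"] up[of "M + d"] M by (auto split: if_splits)
    moreover have "m = 0" using eq[of m] lo[of "m - d"] m True by (auto split: if_splits)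
    ultimately show False using le True by simp
  next
    case False
    hence d: "d < 0" using assms by simp
    hence "m + d = 0" using eq[of "m + d"] lo[of "m + d"] m by (auto split: if_splits)
    moreover have "M = 0" using eq[of M] up[of "M - d"] M d by (auto split: if_splits)
    ultimately show False using le d by simp
  qed
qed

lemma single_eq_mult_single:
  "monom (FMon w) r =
    monom 0 r * prod_list (map (\<lambda>g. monom (FMon [g]) (1::'r::field)) w)"
proof (induction w arbitrary: r)
  case (Cons g w)
  have "monom (FMon (g # w)) r
      = monom 0 r * (monom (FMon [g]) 1 * monom (FMon w) 1)"
    by (simp add: mult_single plus_fmon_def zero_fmon_def)
  also have "monom (FMon w) 1
      = prod_list (map (\<lambda>g. monom (FMon [g]) (1::'r)) w)"
    using Cons.IH[of 1] by simp
  finally show ?case by simp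
qed (simp add: zero_fmon_def)

text \<open>The universal property of the free algebra, with scalars mapped into the centre by
  \<open>sc\<close>. It serves for two targets: the free algebra itself, for
  \<open>retraction\<close>, and the matrices, for \<open>rep\<close>.\<close>

locale evaluation =
  fixes sc :: "'r::field \<Rightarrow> 'm::ring_1" and e :: "'g \<Rightarrow> 'm"
  assumes sc_add: "sc (r + s) = sc r + sc s" and sc_mult: "sc (r * s) = sc r * sc s"
    and sc_1: "sc 1 = 1" and sc_central: "sc r * m = m * sc r"
begin

definition eval_alg :: "('g fmon \<Rightarrow>\<^sub>0 'r) \<Rightarrow> 'm" where
  "eval_alg f = (\<Sum>w\<in>keys f. sc (coeff f w) * prod_list (map e (letters w)))"

lemma sc_0: "sc 0 = 0"
  using sc_add[of 0 0] by simp

lemma eval_alg_superset: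
  assumes "finite K" "keys f \<subseteq> K"
  shows "eval_alg f = (\<Sum>w\<in>K. sc (coeff f w) * prod_list (map e (letters w)))"
  unfolding eval_alg_def
  by (rule sum.mono_neutral_left) (use assms in \<open>auto simp: in_keys_iff sc_0\<close>)

lemma eval_alg_add: "eval_alg (f + g) = eval_alg f + eval_alg g"
proof -
  let ?K = "keys f \<union> keys g"
  have "eval_alg h = (\<Sum>w\<in>?K. sc (coeff h w) * prod_list (map e (letters w)))"
    if "h \<in> {f, g, f + g}" for h
    by (rule eval_alg_superset) (use that keys_add[of f g] in auto)
  thus ?thesis by (simp add: lookup_add sc_add distrib_right sum.distrib)
qed

lemma eval_alg_single: "eval_alg (monom w r) = sc r * prod_list (map e (letters w))"
  by (subst eval_alg_superset[of "{w}"]) auto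

lemma eval_alg_0 [simp]: "eval_alg 0 = 0"
  by (simp add: eval_alg_def)

lemma eval_alg_1 [simp]: "eval_alg 1 = 1"
  unfolding single_one[symmetric] eval_alg_single by (simp add: zero_fmon_def sc_1)

lemma eval_alg_scalar: "eval_alg (monom 0 r) = sc r"
  unfolding eval_alg_single by (simp add: zero_fmon_def)

lemma eval_alg_gen: "eval_alg (monom (FMon [g]) 1) = e g"
  unfolding eval_alg_single by (simp add: sc_1)

lemma eval_alg_uminus: "eval_alg (- f) = - eval_alg f"
  using eval_alg_add[of f "- f"] by (simp add: eq_neg_iff_add_eq_0 add.commute)

lemma eval_alg_minus: "eval_alg (f - g) = eval_alg f - eval_alg g"
  using eval_alg_add[of f "- g"] by (simp add: eval_alg_uminus)

lemma eval_alg_sum: "eval_alg (sum f I) = (\<Sum>i\<in>I. eval_alg (f i))"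
  by (induction I rule: infinite_finite_induct) (auto simp: eval_alg_add)

lemma eval_alg_mult: "eval_alg (f * g) = eval_alg f * eval_alg g"
proof -
  have s: "eval_alg (monom u r * monom v s)
      = eval_alg (monom u r) * eval_alg (monom v s)" for u v r s
  proof -
    define p where "p = prod_list (map e (letters u))"
    define q where "q = prod_list (map e (letters v))"
    have "p * (sc s * q) = sc s * (p * q)"
      using sc_central[of s p] by (simp add: mult.assoc[symmetric])
    thus ?thesis unfolding mult_single eval_alg_single
      by (simp add: plus_fmon_def sc_mult mult.assoc p_def q_def)
  qed
  define ms where "ms h = (\<lambda>w. monom w (coeff h w))" for h :: "'g fmon \<Rightarrow>\<^sub>0 'r"
  have ms: "sum (ms h) (keys h) = h" for h
    unfolding ms_def by (rule poly_mapping_sum_single)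
  have "f * g = sum (ms f) (keys f) * sum (ms g) (keys g)"
    by (simp add: ms)
  hence "eval_alg (f * g) = (\<Sum>u\<in>keys f. \<Sum>v\<in>keys g. eval_alg (ms f u) * eval_alg (ms g v))"
    by (simp add: sum_product eval_alg_sum ms_def s)
  also have "\<dots> = eval_alg (sum (ms f) (keys f)) * eval_alg (sum (ms g) (keys g))"
    by (simp add: sum_product eval_alg_sum)
  finally show ?thesis by (simp add: ms)
qed

end

interpretation free: evaluation "monom 0" e
  for e :: "'g \<Rightarrow> 'g fmon \<Rightarrow>\<^sub>0 'r::field"
proof
  fix r s :: 'r and m :: "'g fmon \<Rightarrow>\<^sub>0 'r"
  show "monom 0 r * m = m * monom 0 r"
  proof -
    have "monom 0 r * monom w c = monom w c * monom 0 r"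
      for w :: "'g fmon" and c
      by (simp add: mult_single mult.commute)
    thus ?thesis
      by (subst (1 2) poly_mapping_sum_single[symmetric, of m])
        (simp add: sum_distrib_left sum_distrib_right)
  qed
qed (simp_all add: single_add mult_single)

lemma free_eval_cong:
  assumes "\<And>w g. w \<in> keys f \<Longrightarrow> g \<in> set (letters w) \<Longrightarrow> e g = monom (FMon [g]) 1"
  shows "free.eval_alg e f = f"
proof -
  have "monom 0 r * prod_list (map e (letters w)) = monom w r"
    if "w \<in> keys f" for w r
  proof -
    have m: "map e (letters w) = map (\<lambda>g. monom (FMon [g]) 1) (letters w)"
      using assms[OF that] by simp
    show ?thesis unfolding m using single_eq_mult_single[of "letters w" r] by simp
  qed
  hence "free.eval_alg e f = (\<Sum>w\<in>keys f. monom w (coeff f w))"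
    unfolding free.eval_alg_def by simp
  thus ?thesis by (simp add: poly_mapping_sum_single)
qed


section \<open>The relation ideal\<close>

lemma free_algebra_simps:
  "carrier (free_algebra G) = {f. \<forall>w\<in>keys f. set (letters w) \<subseteq> G}"
  "mult (free_algebra G) = (*)" "one (free_algebra G) = 1"
  "zero (free_algebra G) = 0" "add (free_algebra G) = (+)"
  by (simp_all add: free_algebra_def)

context
  fixes G :: "'g set"
begin

interpretation ring "free_algebra G :: ('g fmon \<Rightarrow>\<^sub>0 'r::field) ring"
  by (rule ring_free_algebra)

lemma carrier_free_algebra_mult:
  fixes f g :: "'g fmon \<Rightarrow>\<^sub>0 'r::field"
  assumes "f \<in> carrier (free_algebra G)" "g \<in> carrier (free_algebra G)"
  shows "f * g \<in> carrier (free_algebra G)" "f + g \<in> carrier (free_algebra G)"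
  using m_closed[of f g] a_closed[of f g] assms by (simp_all add: free_algebra_simps(2,5))

lemma carrier_free_algebra_uminus:
  fixes f :: "'g fmon \<Rightarrow>\<^sub>0 'r::field"
  assumes "f \<in> carrier (free_algebra G)"
  shows "- f \<in> carrier (free_algebra G)"
  using assms by (simp add: free_algebra_simps)

lemma carrier_free_algebra_minus:
  fixes f g :: "'g fmon \<Rightarrow>\<^sub>0 'r::field"
  assumes "f \<in> carrier (free_algebra G)" "g \<in> carrier (free_algebra G)"
  shows "f - g \<in> carrier (free_algebra G)"
  using carrier_free_algebra_mult(2)[OF assms(1) carrier_free_algebra_uminus[OF assms(2)]] by simp

lemma carrier_free_algebra_consts:
  "0 \<in> carrier (free_algebra G)" "1 \<in> carrier (free_algebra G)"
  "monom 0 r \<in> carrier (free_algebra G)"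
  by (auto simp: free_algebra_simps zero_fmon_def split: if_splits)

lemma carrier_free_algebra_sum:
  "(\<And>i. i \<in> I \<Longrightarrow> f i \<in> carrier (free_algebra G)) \<Longrightarrow> sum f I \<in> carrier (free_algebra G)"
  by (induction I rule: infinite_finite_induct)
    (auto simp: carrier_free_algebra_consts intro: carrier_free_algebra_mult)

lemma carrier_free_algebra_prod_list:
  "(\<And>f. f \<in> set fs \<Longrightarrow> f \<in> carrier (free_algebra G)) \<Longrightarrow> prod_list fs \<in> carrier (free_algebra G)"
  by (induction fs) (auto simp: carrier_free_algebra_consts intro: carrier_free_algebra_mult)

lemma a_inv_free_algebra:
  fixes f :: "'g fmon \<Rightarrow>\<^sub>0 'r::field"
  assumes "f \<in> carrier (free_algebra G)"
  shows "a_inv (free_algebra G) f = - f"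
  by (rule minus_equality)
    (use assms carrier_free_algebra_uminus in \<open>simp_all add: free_algebra_simps(4,5)\<close>)

end

lemmas carrier_free_algebra =
  carrier_free_algebra_mult carrier_free_algebra_uminus carrier_free_algebra_minus
  carrier_free_algebra_consts carrier_free_algebra_sum carrier_free_algebra_prod_list

lemma word_s_Nil [simp]: "word_s [] = 1" and word_s_star_Nil [simp]: "word_s_star [] = 1"
  by (simp_all add: word_s_def word_s_star_def)

lemma word_s_Cons: "word_s (a # \<alpha>) = gen_s a * word_s \<alpha>"
  by (simp add: word_s_def)

lemma word_s_star_Cons: "word_s_star (a # \<alpha>) = word_s_star \<alpha> * gen_s_star a"
  by (simp add: word_s_star_def)

lemma word_s_star_append: "word_s_star (\<alpha> @ \<beta>) = word_s_star \<beta> * word_s_star \<alpha>"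
  by (simp add: word_s_star_def)

lemma gen_s_gens: "gen_s a \<in> carrier (free_algebra (gens X))"
  and gen_s_star_gens: "gen_s_star a \<in> carrier (free_algebra (gens X))"
  by (auto simp: gen_s_def gen_s_star_def gens_def free_algebra_simps)

lemma gen_p_gens: "A \<in> bool_alg X \<Longrightarrow> gen_p A \<in> carrier (free_algebra (gens X))"
  by (auto simp: gen_p_def gens_def free_algebra_simps)

lemma word_s_gens: "word_s \<alpha> \<in> carrier (free_algebra (gens X))"
  and word_s_star_gens: "word_s_star \<alpha> \<in> carrier (free_algebra (gens X))"
  unfolding word_s_def word_s_star_def
  by (rule carrier_free_algebra_prod_list; auto simp: gen_s_gens gen_s_star_gens)+

context subshift_space
begin

section \<open>Congruence modulo the defining relations\<close>

abbreviation \<F> :: "('a gen fmon \<Rightarrow>\<^sub>0 'r::field) set" where "\<F> \<equiv> carrier (free_algebra (gens X))"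

lemma relators_carrier: "(relators X :: ('a gen fmon \<Rightarrow>\<^sub>0 'r::field) set) \<subseteq> \<F>"
  unfolding relators_def
  by (auto intro!: carrier_free_algebra_mult carrier_free_algebra_minus gen_p_gens gen_s_gens
      gen_s_star_gens word_s_gens word_s_star_gens X_bool_alg empty_bool_alg
      C_set_bool_alg bool_alg.inter bool_alg.union carrier_free_algebra_consts)

lemma relation_ideal: "ideal (relation_ideal X) (free_algebra (gens X) :: ('a gen fmon \<Rightarrow>\<^sub>0 'r::field) ring)"
  unfolding relation_ideal_def by (rule ring.genideal_ideal[OF ring_free_algebra relators_carrier])

lemma relators_relation_ideal: "relators X \<subseteq> relation_ideal X"
  unfolding relation_ideal_def by (rule ring.genideal_self[OF ring_free_algebra relators_carrier])

lemma relation_ideal_zero: "0 \<in> relation_ideal X"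
  using additive_subgroup.zero_closed[OF ideal.axioms(1)[OF relation_ideal]]
  by (simp add: free_algebra_simps)

lemma relation_ideal_add: "f \<in> relation_ideal X \<Longrightarrow> g \<in> relation_ideal X \<Longrightarrow> f + g \<in> relation_ideal X"
  using additive_subgroup.a_closed[OF ideal.axioms(1)[OF relation_ideal]]
  by (simp add: free_algebra_simps)

lemma relation_ideal_mult:
  assumes "f \<in> relation_ideal X" "g \<in> \<F>"
  shows "f * g \<in> relation_ideal X" "g * f \<in> relation_ideal X"
  using ideal.I_r_closed[OF relation_ideal assms] ideal.I_l_closed[OF relation_ideal assms]
  by (simp_all add: free_algebra_simps)

lemma relation_ideal_uminus: "f \<in> relation_ideal X \<Longrightarrow> - f \<in> relation_ideal X"
  using relation_ideal_mult(1)[of f "- 1"] by (simp add: carrier_free_algebra)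

text \<open>Killing the generators \<open>gen_p A\<close> with \<open>A \<notin> \<U>\<close> retracts the free algebra on all
  generators onto the one on \<open>gens X\<close>. Pulling the relation ideal back along this retraction gives a
  congruence of the whole type, free of carrier conditions.\<close>

definition retraction :: "('a gen fmon \<Rightarrow>\<^sub>0 'r::field) \<Rightarrow> 'a gen fmon \<Rightarrow>\<^sub>0 'r" where
  "retraction = free.eval_alg (\<lambda>g. if g \<in> gens X then monom (FMon [g]) 1 else 0)"

lemmas retraction_hom =
  free.eval_alg_add[of "\<lambda>g. if g \<in> gens X then monom (FMon [g]) 1 else 0", folded retraction_def]
  free.eval_alg_mult[of "\<lambda>g. if g \<in> gens X then monom (FMon [g]) 1 else 0", folded retraction_def]
  free.eval_alg_minus[of "\<lambda>g. if g \<in> gens X then monom (FMon [g]) 1 else 0", folded retraction_def]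
  free.eval_alg_0[of "\<lambda>g. if g \<in> gens X then monom (FMon [g]) 1 else 0", folded retraction_def]

lemma retraction_carrier: "retraction f \<in> \<F>"
  unfolding retraction_def free.eval_alg_def
  by (intro carrier_free_algebra_sum carrier_free_algebra_mult(1) carrier_free_algebra_prod_list)
    (auto simp: carrier_free_algebra_consts, auto simp: free_algebra_simps)

lemma retraction_id:
  assumes "f \<in> \<F>"
  shows "retraction f = f"
  unfolding retraction_def
  by (rule free_eval_cong) (use assms in \<open>auto simp: free_algebra_simps\<close>)

definition rel_cong :: "('a gen fmon \<Rightarrow>\<^sub>0 'r::field) \<Rightarrow> ('a gen fmon \<Rightarrow>\<^sub>0 'r) \<Rightarrow> bool" (infix \<open>\<approx>\<close> 50)
  where "f \<approx> g \<longleftrightarrow> retraction (f - g) \<in> relation_ideal X"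

lemma rel_cong_iff:
  assumes "f \<in> \<F>" "g \<in> \<F>"
  shows "f \<approx> g \<longleftrightarrow> f - g \<in> relation_ideal X"
  using assms by (simp add: rel_cong_def retraction_id carrier_free_algebra)

lemma rel_refl [simp, intro]: "f \<approx> f"
  by (simp add: rel_cong_def retraction_hom relation_ideal_zero)

lemma rel_sym: "f \<approx> g \<Longrightarrow> g \<approx> f"
  using relation_ideal_uminus[of "retraction (f - g)"] by (simp add: rel_cong_def retraction_hom)

lemma rel_trans [trans]: "f \<approx> g \<Longrightarrow> g \<approx> h \<Longrightarrow> f \<approx> h"
  using relation_ideal_add[of "retraction (f - g)" "retraction (g - h)"]
  by (simp add: rel_cong_def retraction_hom)

lemma rel_add: "f \<approx> g \<Longrightarrow> f' \<approx> g' \<Longrightarrow> f + f' \<approx> g + g'"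
  using relation_ideal_add[of "retraction f - retraction g" "retraction f' - retraction g'"]
  by (simp add: rel_cong_def retraction_hom algebra_simps)

lemma rel_uminus: "f \<approx> g \<Longrightarrow> - f \<approx> - g"
  using rel_sym[of f g] by (simp add: rel_cong_def)

lemma rel_minus: "f \<approx> g \<Longrightarrow> f' \<approx> g' \<Longrightarrow> f - f' \<approx> g - g'"
  using rel_add[OF _ rel_uminus, of f g f' g'] by simp

lemma rel_mult: "f \<approx> g \<Longrightarrow> f' \<approx> g' \<Longrightarrow> f * f' \<approx> g * g'"
proof -
  assume "f \<approx> g" "f' \<approx> g'"
  hence "(retraction f - retraction g) * retraction f' + retraction g * (retraction f' - retraction g')
      \<in> relation_ideal X"
    by (intro relation_ideal_add relation_ideal_mult retraction_carrier)
      (simp_all add: rel_cong_def retraction_hom)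
  thus ?thesis by (simp add: rel_cong_def retraction_hom algebra_simps)
qed

lemma rel_sum: "(\<And>i. i \<in> I \<Longrightarrow> f i \<approx> g i) \<Longrightarrow> sum f I \<approx> sum g I"
  by (induction I rule: infinite_finite_induct) (auto intro: rel_add)

lemma rel_left: "f \<approx> g \<Longrightarrow> f * h \<approx> g * h" and rel_right: "f \<approx> g \<Longrightarrow> h * f \<approx> h * g"
  by (auto intro: rel_mult)

lemma rel_relator: "f - g \<in> relators X \<Longrightarrow> f \<approx> g"
  using relators_relation_ideal relators_carrier retraction_id[of "f - g"]
  unfolding rel_cong_def by (metis subsetD)

lemma rel_gen_p_X: "gen_p X \<approx> 1" and rel_gen_p_empty: "gen_p {} \<approx> 0"
  by (rule rel_relator; simp add: relators_def)+

lemma rel_gen_p_inter: "A \<in> \<U> \<Longrightarrow> B \<in> \<U> \<Longrightarrow> gen_p (A \<inter> B) \<approx> gen_p A * gen_p B"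
  by (rule rel_relator) (unfold relators_def, blast)

lemma rel_gen_p_union:
  "A \<in> \<U> \<Longrightarrow> B \<in> \<U> \<Longrightarrow> gen_p (A \<union> B) \<approx> gen_p A + gen_p B - gen_p (A \<inter> B)"
  by (rule rel_relator) (unfold relators_def, blast)

lemma rel_gen_s: "gen_s a * gen_s_star a * gen_s a \<approx> gen_s a"
  and rel_gen_s_star: "gen_s_star a * gen_s a * gen_s_star a \<approx> gen_s_star a"
  by (rule rel_relator; unfold relators_def; blast)+

lemma rel_word: "\<alpha> \<in> language X \<Longrightarrow> \<beta> \<in> language X \<Longrightarrow>
    word_s \<beta> * word_s_star \<alpha> * word_s \<alpha> * word_s_star \<beta> \<approx> gen_p (C_set X \<alpha> \<beta>)"
  by (rule rel_relator) (unfold relators_def, blast)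

end

section \<open>The matrix representation\<close>

type_synonym ('a, 'r) orbit_matrix = "('a word, int \<Rightarrow>\<^sub>0 'r) cmat"

abbreviation deg :: "'a list \<Rightarrow> 'a list \<Rightarrow> int" where
  "deg \<alpha> \<beta> \<equiv> int (length \<alpha>) - int (length \<beta>)"

text \<open>The matrix of r s_\<alpha> p_A s_\<beta>^*: the partial injection from
  \<open>\<beta> \<frown> z\<close> to \<open>\<alpha> \<frown> z\<close>, weighted by t to the
  power of its degree. Membership in \<open>X\<close> is tested on the sequences, so words outside
  the language give 0.\<close>

lift_definition term_mat ::
  "'a word set \<Rightarrow> 'r \<Rightarrow> 'a list \<Rightarrow> 'a word set \<Rightarrow> 'a list \<Rightarrow> ('a, 'r::field) orbit_matrix"
  is "\<lambda>X r \<alpha> A \<beta> x y. if x \<in> X \<and> y \<in> X \<and> (\<exists>z\<in>A. x = \<alpha> \<frown> z \<and> y = \<beta> \<frown> z)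
    then monom (deg \<alpha> \<beta>) r else 0"
proof -
  fix X A :: "'a word set" and r :: 'r and \<alpha> \<beta> :: "'a list" and y :: "'a word"
  have "{x. (if x \<in> X \<and> y \<in> X \<and> (\<exists>z\<in>A. x = \<alpha> \<frown> z \<and> y = \<beta> \<frown> z)
    then monom (deg \<alpha> \<beta>) r else 0) \<noteq> 0} \<subseteq> {\<alpha> \<frown> suffix (length \<beta>) y}"
    by auto
  thus "finite {x. (if x \<in> X \<and> y \<in> X \<and> (\<exists>z\<in>A. x = \<alpha> \<frown> z \<and> y = \<beta> \<frown> z)
    then monom (deg \<alpha> \<beta>) r else 0) \<noteq> 0}"
    using finite_subset by blast
qed

lemma ent_term_mat: "ent (term_mat X r \<alpha> A \<beta>) x y =
    (if x \<in> X \<and> y \<in> X \<and> (\<exists>z\<in>A. x = \<alpha> \<frown> z \<and> y = \<beta> \<frown> z)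
     then monom (deg \<alpha> \<beta>) r else 0)"
  by (simp add: term_mat.rep_eq)

lemma ent_term_mat_mult:
  "ent (term_mat X r \<alpha> A \<beta> * M) x y =
    (let z = suffix (length \<alpha>) x in
     if x \<in> X \<and> z \<in> A \<and> x = \<alpha> \<frown> z \<and> \<beta> \<frown> z \<in> X
     then monom (deg \<alpha> \<beta>) r * ent M (\<beta> \<frown> z) y else 0)"
proof -
  define z where "z = suffix (length \<alpha>) x"
  let ?K = "insert (\<beta> \<frown> z) {k. ent M k y \<noteq> 0}"
  have "ent (term_mat X r \<alpha> A \<beta> * M) x y = (\<Sum>k\<in>?K. ent (term_mat X r \<alpha> A \<beta>) x k * ent M k y)"
    by (rule ent_mult_superset) auto
  also have "\<dots> = (\<Sum>k\<in>?K. if k = \<beta> \<frown> z then ent (term_mat X r \<alpha> A \<beta>) x (\<beta> \<frown> z) * ent M (\<beta> \<frown> z) y else 0)"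
    by (rule sum.cong) (auto simp: ent_term_mat z_def)
  also have "\<dots> = ent (term_mat X r \<alpha> A \<beta>) x (\<beta> \<frown> z) * ent M (\<beta> \<frown> z) y"
    by (simp add: sum.delta')
  finally show ?thesis by (auto simp: ent_term_mat z_def Let_def)
qed

lemma ent_mult_term_mat:
  "ent (M * term_mat X r \<alpha> A \<beta>) x y =
    (let z = suffix (length \<beta>) y in
     if y \<in> X \<and> z \<in> A \<and> y = \<beta> \<frown> z \<and> \<alpha> \<frown> z \<in> X
     then monom (deg \<alpha> \<beta>) r * ent M x (\<alpha> \<frown> z) else 0)"
proof -
  define z where "z = suffix (length \<beta>) y"
  have "ent (M * term_mat X r \<alpha> A \<beta>) x y = (\<Sum>k\<in>{\<alpha> \<frown> z}. ent M x k * ent (term_mat X r \<alpha> A \<beta>) k y)"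
    by (rule ent_mult_superset) (auto simp: ent_term_mat z_def split: if_splits)
  thus ?thesis by (auto simp: ent_term_mat z_def Let_def mult.commute)
qed

lemma term_mat_mult:
  "term_mat X r \<alpha> A \<gamma> * term_mat X s \<gamma> B \<beta> = term_mat X (r * s) \<alpha> {z \<in> A \<inter> B. \<gamma> \<frown> z \<in> X} \<beta>"
  by (rule cmat_eqI) (auto simp: ent_term_mat_mult ent_term_mat Let_def mult_single)

lemma term_mat_0 [simp]: "term_mat X 0 \<alpha> A \<beta> = 0"
  by (rule cmat_eqI) (simp add: ent_term_mat)

lemma term_mat_uminus: "- term_mat X r \<alpha> A \<beta> = term_mat X (- r) \<alpha> A \<beta>"
  by (rule cmat_eqI) (auto simp: ent_term_mat single_uminus)

lemma smat_mult_term_mat: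
  "smat (monom 0 c) * term_mat X r \<alpha> A \<beta> = term_mat X (c * r) \<alpha> A \<beta>"
  by (rule cmat_eqI) (auto simp: ent_term_mat mult_single)

text \<open>Keeps the power t^n in all entries at once. This is the projection that makes
  homogeneous decompositions of matrices unique.\<close>

lift_definition degree_part :: "int \<Rightarrow> ('i, int \<Rightarrow>\<^sub>0 'r::field) cmat \<Rightarrow> ('i, int \<Rightarrow>\<^sub>0 'r) cmat"
  is "\<lambda>n M x y. monom n (coeff (M x y) n)"
proof -
  fix n and M :: "'i \<Rightarrow> 'i \<Rightarrow> int \<Rightarrow>\<^sub>0 'r" and y
  assume "\<And>y. finite {x. M x y \<noteq> 0}"
  moreover have "{x. monom n (coeff (M x y) n) \<noteq> 0} \<subseteq> {x. M x y \<noteq> 0}" by auto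
  ultimately show "finite {x. monom n (coeff (M x y) n) \<noteq> 0}"
    using finite_subset by blast
qed

lemma ent_degree_part:
  "ent (degree_part n M) x y = monom n (coeff (ent M x y) n)"
  by (simp add: degree_part.rep_eq)

lemma degree_part_add: "degree_part n (M + N) = degree_part n M + degree_part n N"
  by (rule cmat_eqI) (simp add: ent_degree_part lookup_add single_add)

lemma degree_part_0 [simp]: "degree_part n 0 = 0"
  by (rule cmat_eqI) (simp add: ent_degree_part)

lemma degree_part_sum: "degree_part n (sum f I) = (\<Sum>i\<in>I. degree_part n (f i))"
  by (induction I rule: infinite_finite_induct) (auto simp: degree_part_add)

lemma degree_part_unitm:
  "degree_part n (unitm x y (monom k r)) =
    (if k = n then unitm x y (monom k r) else 0)"
  by (rule cmat_eqI) (auto simp: ent_degree_part ent_unitm lookup_single)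

lemma degree_part_term_mat:
  "degree_part (deg \<alpha> \<beta>) (term_mat X c \<alpha> A \<beta>) = term_mat X c \<alpha> A \<beta>"
  by (rule cmat_eqI) (auto simp: ent_degree_part ent_term_mat)

interpretation mat: evaluation "\<lambda>r. smat (monom 0 r)" e
  for e :: "'g \<Rightarrow> ('i, int \<Rightarrow>\<^sub>0 'r::field) cmat"
proof
  show "smat (monom 0 r) * m = m * smat (monom 0 r)"
    for r and m :: "('i, int \<Rightarrow>\<^sub>0 'r) cmat"
    by (rule smat_commute)
qed (simp_all add: single_add smat_add smat_mult[symmetric] mult_single)

context subshift_space
begin

abbreviation proj :: "'a word set \<Rightarrow> ('a, 'r::field) orbit_matrix" where
  "proj A \<equiv> term_mat X 1 [] A []"

fun gen_mat :: "'a gen \<Rightarrow> ('a, 'r::field) orbit_matrix" where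
  "gen_mat (Gen_p A) = proj A"
| "gen_mat (Gen_s a) = term_mat X 1 [a] X []"
| "gen_mat (Gen_s_star a) = term_mat X 1 [] X [a]"

lemma ent_proj_mult [simp]: "ent (proj A * M) x y = (if x \<in> X \<and> x \<in> A then ent M x y else 0)"
  by (simp add: ent_term_mat_mult Let_def)

lemma ent_mult_proj [simp]: "ent (M * proj A) x y = (if y \<in> X \<and> y \<in> A then ent M x y else 0)"
  by (auto simp: ent_mult_term_mat Let_def)

lemma ent_proj: "ent (proj A) x y = (if x = y \<and> x \<in> X \<and> x \<in> A then 1 else 0)"
  by (auto simp: ent_term_mat)

lemma gen_mat_proj_X: "gen_mat g * proj X = gen_mat g" "proj X * gen_mat g = gen_mat g"
  by (rule cmat_eqI; cases g; auto simp: ent_term_mat)+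

text \<open>All of \<open>'a word\<close> indexes the matrices, so the unit acts as \<open>proj X\<close> rather than as the
  identity matrix.\<close>

definition rep :: "('a gen fmon \<Rightarrow>\<^sub>0 'r::field) \<Rightarrow> ('a, 'r) orbit_matrix" where
  "rep f = proj X * mat.eval_alg gen_mat f"

lemma proj_X_idem: "proj X * proj X = proj X"
  by (rule cmat_eqI) (simp add: ent_proj)

text \<open>The matrices of the generators are supported on \<open>X\<close> in both indices, so
  \<open>proj X\<close> is a two-sided unit for them and commutes with their products. Cutting down
  by it is therefore multiplicative.\<close>

lemma proj_X_eval:
  fixes f :: "'a gen fmon \<Rightarrow>\<^sub>0 'r::field"
  shows "proj X * mat.eval_alg gen_mat f = mat.eval_alg gen_mat f * proj X"
proof -
  let ?P = "proj X :: ('a, 'r) orbit_matrix"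
  have *: "?P * prod_list (map gen_mat gs) = prod_list (map gen_mat gs) * ?P" for gs
  proof (induction gs)
    case (Cons g gs)
    have "?P * (gen_mat g * prod_list (map gen_mat gs)) = (gen_mat g * ?P) * prod_list (map gen_mat gs)"
      by (simp add: mult.assoc[symmetric] gen_mat_proj_X)
    also have "\<dots> = (gen_mat g * prod_list (map gen_mat gs)) * ?P"
      by (simp only: mult.assoc Cons)
    finally show ?case by simp
  qed simp
  have "?P * (smat c * prod_list (map gen_mat gs)) = (smat c * prod_list (map gen_mat gs)) * ?P"
    for c gs
  proof -
    have "?P * (smat c * prod_list (map gen_mat gs)) = (?P * smat c) * prod_list (map gen_mat gs)"
      by (rule mult.assoc[symmetric])
    also have "?P * smat c = smat c * ?P" by (rule smat_commute[symmetric])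
    also have "smat c * ?P * prod_list (map gen_mat gs) = smat c * (?P * prod_list (map gen_mat gs))"
      by (rule mult.assoc)
    also have "?P * prod_list (map gen_mat gs) = prod_list (map gen_mat gs) * ?P"
      by (rule *)
    also have "smat c * (prod_list (map gen_mat gs) * ?P) = smat c * prod_list (map gen_mat gs) * ?P"
      by (rule mult.assoc[symmetric])
    finally show ?thesis .
  qed
  thus ?thesis unfolding mat.eval_alg_def by (simp add: sum_distrib_left sum_distrib_right)
qed

lemma rep_add: "rep (f + g) = rep f + rep g"
  and rep_minus: "rep (f - g) = rep f - rep g"
  and rep_uminus: "rep (- f) = - rep f"
  and rep_sum: "rep (sum h I) = (\<Sum>i\<in>I. rep (h i))"
  and rep_0 [simp]: "rep 0 = 0"
  by (simp_all add: rep_def mat.eval_alg_add mat.eval_alg_minus mat.eval_alg_uminus mat.eval_alg_sum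
      distrib_left right_diff_distrib sum_distrib_left)

lemma rep_mult: "rep (f * g) = rep f * rep g"
proof -
  have "rep f * rep g = proj X * (mat.eval_alg gen_mat f * proj X) * mat.eval_alg gen_mat g"
    by (simp only: rep_def mult.assoc)
  also have "\<dots> = (proj X * proj X) * (mat.eval_alg gen_mat f * mat.eval_alg gen_mat g)"
    by (simp only: proj_X_eval[of f, symmetric]) (simp only: mult.assoc)
  finally show ?thesis by (simp only: rep_def mat.eval_alg_mult proj_X_idem)
qed

lemma rep_1: "rep 1 = proj X"
  by (simp add: rep_def)

lemma rep_scale: "rep (monom 0 c * f) = smat (monom 0 c) * rep f"
  unfolding rep_def mat.eval_alg_mult mat.eval_alg_scalar mult.assoc[symmetric]
  by (subst smat_commute) (rule refl)

lemma rep_gen: "rep (gen_p A) = proj A" "rep (gen_s a) = term_mat X 1 [a] X []"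
  "rep (gen_s_star a) = term_mat X 1 [] X [a]"
  unfolding rep_def gen_p_def gen_s_def gen_s_star_def mat.eval_alg_gen gen_mat_proj_X by simp_all

lemma rep_word_s: "rep (word_s \<alpha>) = term_mat X 1 \<alpha> X []"
proof (induction \<alpha>)
  case (Cons a \<alpha>)
  have "term_mat X 1 [a] X [] * term_mat X 1 \<alpha> X [] = term_mat X 1 (a # \<alpha>) X []"
    by (rule cmat_eqI) (auto simp: ent_term_mat_mult ent_term_mat Let_def mult_single dest: build_in_X)
  thus ?case using Cons by (simp add: word_s_Cons rep_mult rep_gen)
qed (simp add: rep_1)

lemma rep_word_s_star: "rep (word_s_star \<alpha>) = term_mat X 1 [] X \<alpha>"
proof (induction \<alpha>)
  case (Cons a \<alpha>)
  have "term_mat X 1 [] X \<alpha> * term_mat X 1 [] X [a] = term_mat X 1 [] X (a # \<alpha>)"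
    by (rule cmat_eqI) (auto simp: ent_mult_term_mat ent_term_mat Let_def mult_single dest: build_in_X)
  thus ?case using Cons by (simp add: word_s_star_Cons rep_mult rep_gen)
qed (simp add: rep_1)

lemma term_mat_cong:
  "(\<And>z. \<alpha> \<frown> z \<in> X \<Longrightarrow> \<beta> \<frown> z \<in> X \<Longrightarrow> z \<in> A \<longleftrightarrow> z \<in> B) \<Longrightarrow> term_mat X r \<alpha> A \<beta> = term_mat X r \<alpha> B \<beta>"
  by (rule cmat_eqI) (auto simp: ent_term_mat)

lemma rep_monomial: "rep (word_s \<alpha> * gen_p A * word_s_star \<beta>) = term_mat X 1 \<alpha> A \<beta>"
  unfolding rep_mult rep_word_s rep_word_s_star rep_gen term_mat_mult
  by (simp, rule term_mat_cong) (auto dest: conc_in_X)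

lemma rep_relator:
  assumes "f \<in> relators X"
  shows "rep f = 0"
proof -
  have u: "proj (A \<union> B) = proj A + proj B - proj (A \<inter> B)" for A B
    by (rule cmat_eqI) (auto simp: ent_proj)
  \<comment> \<open>Passing through the two inner words leaves the diagonal at the points
    \<open>\<beta> \<frown> z\<close> of \<open>X\<close> for which
    \<open>\<alpha> \<frown> z\<close> also lies in \<open>X\<close>.\<close>
  have w: "term_mat X 1 \<beta> X [] * term_mat X 1 [] X \<alpha> * term_mat X 1 \<alpha> X [] * term_mat X 1 [] X \<beta>
      = proj (C_set X \<alpha> \<beta>)" for \<alpha> \<beta>
    unfolding term_mat_mult
    by (rule cmat_eqI) (auto simp: ent_term_mat in_C_set dest: conc_in_X)
  have e: "proj {} = 0"
    by (rule cmat_eqI) (simp add: ent_proj)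
  have i: "proj A * proj B = proj (A \<inter> B)" for A B
    by (rule cmat_eqI) (auto simp: ent_proj)
  have s: "term_mat X 1 [a] X [] * term_mat X 1 [] X [a] * term_mat X 1 [a] X [] = term_mat X 1 [a] X []"
    "term_mat X 1 [] X [a] * term_mat X 1 [a] X [] * term_mat X 1 [] X [a] = term_mat X 1 [] X [a]" for a
    unfolding term_mat_mult by (rule cmat_eqI; auto simp: ent_term_mat dest: build_in_X)+
  consider "f = gen_p X - 1" | "f = gen_p {}"
    | A B where "f = gen_p (A \<inter> B) - gen_p A * gen_p B"
    | A B where "f = gen_p (A \<union> B) - (gen_p A + gen_p B - gen_p (A \<inter> B))"
    | a where "f = gen_s a * gen_s_star a * gen_s a - gen_s a"
    | a where "f = gen_s_star a * gen_s a * gen_s_star a - gen_s_star a"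
    | \<alpha> \<beta> where "f = word_s \<beta> * word_s_star \<alpha> * word_s \<alpha> * word_s_star \<beta> - gen_p (C_set X \<alpha> \<beta>)"
    using assms unfolding relators_def by blast
  thus ?thesis
    by cases (simp_all only: rep_minus rep_add rep_mult rep_gen rep_1 rep_word_s rep_word_s_star
        u w e i s diff_self)
qed

lemma rep_relation_ideal:
  assumes "f \<in> relation_ideal X"
  shows "rep f = 0"
proof -
  let ?F = "free_algebra (gens X) :: ('a gen fmon \<Rightarrow>\<^sub>0 'b) ring"
  let ?K = "{f \<in> carrier ?F. rep f = 0}"
  have inv: "inv\<^bsub>add_monoid ?F\<^esub> f = - f" if "f \<in> carrier ?F" for f
    using a_inv_free_algebra[OF that] by (simp only: a_inv_def)
  have "ideal ?K ?F"
  proof (rule idealI[OF ring_free_algebra])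
    show "subgroup ?K (add_monoid ?F)"
    proof (rule subgroup.intro)
      fix f assume f: "f \<in> ?K"
      hence "inv\<^bsub>add_monoid ?F\<^esub> f = - f" by (intro inv) simp
      thus "inv\<^bsub>add_monoid ?F\<^esub> f \<in> ?K" using f by (simp add: rep_uminus carrier_free_algebra)
    qed (auto simp: free_algebra_simps(4,5) carrier_free_algebra rep_add)
  qed (auto simp: free_algebra_simps(2) carrier_free_algebra rep_mult)
  moreover have "relators X \<subseteq> ?K" using relators_carrier rep_relator by blast
  ultimately have "relation_ideal X \<subseteq> ?K"
    unfolding relation_ideal_def by (rule ring.genideal_minimal[OF ring_free_algebra])
  thus ?thesis using assms by blast
qed

end

section \<open>Normal forms\<close>

context subshift_space
begin

text \<open>The parameter \<open>K\<close> only fixes the type of scalars.\<close>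

context
  fixes K :: "'r::field itself"
begin

abbreviation gp :: "'a word set \<Rightarrow> 'a gen fmon \<Rightarrow>\<^sub>0 'r" where "gp \<equiv> gen_p"
abbreviation gs :: "'a \<Rightarrow> 'a gen fmon \<Rightarrow>\<^sub>0 'r" where "gs \<equiv> gen_s"
abbreviation gt :: "'a \<Rightarrow> 'a gen fmon \<Rightarrow>\<^sub>0 'r" where "gt \<equiv> gen_s_star"
abbreviation ws :: "'a list \<Rightarrow> 'a gen fmon \<Rightarrow>\<^sub>0 'r" where "ws \<equiv> word_s"
abbreviation wt :: "'a list \<Rightarrow> 'a gen fmon \<Rightarrow>\<^sub>0 'r" where "wt \<equiv> word_s_star"
abbreviation scal :: "'r \<Rightarrow> 'a gen fmon \<Rightarrow>\<^sub>0 'r" where "scal \<equiv> monom 0"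

lemma scal_commute: "scal c * f = f * scal c"
  by (rule free.sc_central)

lemma scal_add: "scal (c + d) = scal c + scal d" and scal_mult: "scal (c * d) = scal c * scal d"
  by (simp_all add: single_add mult_single)

section \<open>Commutation rules for projections and partial isometries\<close>

lemma gp_le:
  assumes "A \<in> \<U>" "B \<in> \<U>" "A \<subseteq> B"
  shows "gp A * gp B \<approx> gp A" "gp B * gp A \<approx> gp A"
  using rel_sym[OF rel_gen_p_inter[OF assms(1,2)]] rel_sym[OF rel_gen_p_inter[OF assms(2,1)]] assms(3)
  by (simp_all add: inf.absorb1 inf.absorb2)

lemma gp_disjoint:
  assumes "A \<in> \<U>" "B \<in> \<U>" "A \<inter> B = {}"
  shows "gp A * gp B \<approx> 0"
  using rel_trans[OF rel_sym[OF rel_gen_p_inter[OF assms(1,2)]]] rel_gen_p_empty assms(3) by metis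

lemma gp_union_disjoint:
  assumes "A \<in> \<U>" "B \<in> \<U>" "A \<inter> B = {}"
  shows "gp (A \<union> B) \<approx> gp A + gp B"
proof -
  have "gp (A \<union> B) \<approx> gp A + gp B - gp {}" using rel_gen_p_union[OF assms(1,2)] assms(3) by simp
  also have "\<dots> \<approx> gp A + gp B - 0" by (intro rel_minus rel_refl rel_gen_p_empty)
  finally show ?thesis by simp
qed

lemma gp_compl:
  assumes "A \<in> \<U>"
  shows "gp (X - A) \<approx> 1 - gp A"
proof -
  have "gp (A \<union> (X - A)) \<approx> gp A + gp (X - A)"
    by (rule gp_union_disjoint) (use assms bool_alg.compl in auto)
  hence "gp X \<approx> gp A + gp (X - A)" using bool_alg_subset[OF assms] by (simp add: Un_absorb1)
  hence "1 \<approx> gp A + gp (X - A)" using rel_trans[OF rel_sym[OF rel_gen_p_X]] by blast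
  from rel_minus[OF rel_sym[OF this] rel_refl[of "gp A"]] show ?thesis by simp
qed

lemma gt_gs: "gt a * gs a \<approx> gp (C_set X [a] [])"
  using rel_word[OF letter_language[of a] Nil_language] by (simp add: word_s_Cons word_s_star_Cons)

lemma gs_gt: "gs a * gt a \<approx> gp (C_set X [] [a])"
  using rel_word[OF Nil_language letter_language[of a]] by (simp add: word_s_Cons word_s_star_Cons)

lemma gp_gs: "gp (C_set X [] [a]) * gs a \<approx> gs a"
  by (rule rel_trans[OF rel_left[OF rel_sym[OF gs_gt]] rel_gen_s])

lemma gs_gp: "gs a * gp (C_set X [a] []) \<approx> gs a"
proof -
  have "gs a * gp (C_set X [a] []) \<approx> gs a * (gt a * gs a)" by (rule rel_right[OF rel_sym[OF gt_gs]])
  also have "\<dots> \<approx> gs a" using rel_gen_s by (simp add: mult.assoc)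
  finally show ?thesis .
qed

lemma gt_gp: "gt a * gp (C_set X [] [a]) \<approx> gt a"
proof -
  have "gt a * gp (C_set X [] [a]) \<approx> gt a * (gs a * gt a)" by (rule rel_right[OF rel_sym[OF gs_gt]])
  also have "\<dots> \<approx> gt a" using rel_gen_s_star by (simp add: mult.assoc)
  finally show ?thesis .
qed

text \<open>Orthogonality of distinct letters is not among the relations; it follows because s_a^*
  and s_b absorb the projections onto their cylinders, which are disjoint.\<close>

lemma gt_gs_neq:
  assumes "a \<noteq> b"
  shows "gt a * gs b \<approx> 0"
proof -
  have "gt a * gs b \<approx> (gt a * gp (C_set X [] [a])) * (gp (C_set X [] [b]) * gs b)"
    by (rule rel_mult[OF rel_sym[OF gt_gp] rel_sym[OF gp_gs]])
  also have "\<dots> = gt a * (gp (C_set X [] [a]) * gp (C_set X [] [b])) * gs b" by (simp add: mult.assoc)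
  also have "\<dots> \<approx> gt a * 0 * gs b"
    by (intro rel_left rel_right gp_disjoint C_set_bool_alg) (use assms in \<open>auto simp: in_C_set\<close>)
  finally show ?thesis by simp
qed

text \<open>Stated separately because the induction in \<open>gp_gs_commute\<close> needs it twice:
  for intersections and, through inclusion-exclusion, for unions.\<close>

lemma gp_inter_gs:
  assumes "A \<in> \<U>" "B \<in> \<U>"
    and "gp A * gs a \<approx> gs a * gp (rng A [a])" "gp B * gs a \<approx> gs a * gp (rng B [a])"
  shows "gp (A \<inter> B) * gs a \<approx> gs a * gp (rng A [a] \<inter> rng B [a])"
proof -
  have "gp (A \<inter> B) * gs a \<approx> gp A * gp B * gs a" by (rule rel_left[OF rel_gen_p_inter[OF assms(1,2)]])
  also have "\<dots> = gp A * (gp B * gs a)" by (simp add: mult.assoc)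
  also have "\<dots> \<approx> gp A * (gs a * gp (rng B [a]))" by (rule rel_right[OF assms(4)])
  also have "\<dots> = gp A * gs a * gp (rng B [a])" by (simp add: mult.assoc)
  also have "\<dots> \<approx> gs a * gp (rng A [a]) * gp (rng B [a])" by (rule rel_left[OF assms(3)])
  also have "\<dots> = gs a * (gp (rng A [a]) * gp (rng B [a]))" by (simp add: mult.assoc)
  also have "\<dots> \<approx> gs a * gp (rng A [a] \<inter> rng B [a])"
    by (intro rel_right rel_sym[OF rel_gen_p_inter] rng_bool_alg assms(1,2))
  finally show ?thesis .
qed

text \<open>The commutation rule between projections and isometries follows from the relations
  for the generators \<open>C_set X \<alpha> \<beta>\<close> of the Boolean algebra and is stable under Boolean operations.\<close>

lemma gp_gs_commute:
  assumes "A \<in> \<U>"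
  shows "gp A * gs a \<approx> gs a * gp (rng A [a])"
  using assms
proof induction
  case (C \<alpha> \<beta>)
  have gs0: "gp {} * gs a \<approx> 0" "0 \<approx> gs a * gp {}"
    using rel_left[OF rel_gen_p_empty, of "gs a"] rel_right[OF rel_gen_p_empty, of "gs a"]
    by (simp_all add: rel_sym)
  have Z: "gp B * gs a \<approx> gp (B \<inter> C_set X [] [a]) * gs a" if "B \<in> \<U>" for B
  proof -
    have "gp B * gs a \<approx> gp B * (gp (C_set X [] [a]) * gs a)" by (rule rel_right[OF rel_sym[OF gp_gs]])
    also have "\<dots> = gp B * gp (C_set X [] [a]) * gs a" by (simp add: mult.assoc)
    also have "\<dots> \<approx> gp (B \<inter> C_set X [] [a]) * gs a"
      by (intro rel_left rel_sym[OF rel_gen_p_inter] that C_set_bool_alg)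
    finally show ?thesis .
  qed
  have prod: "gs a * (gp B * (gt a * gs a)) \<approx> gs a * gp (B \<inter> C_set X [a] [])" if "B \<in> \<U>" for B
    by (intro rel_right rel_trans[OF rel_right[OF gt_gs]] rel_sym[OF rel_gen_p_inter] that C_set_bool_alg)
  show ?case
  proof (cases \<beta>)
    case Nil
    \<comment> \<open>The relation for the pair \<open>\<alpha> @ [a]\<close>, \<open>[a]\<close> is
      available only if \<open>\<alpha> @ [a]\<close> lies in the language. Otherwise the relative
      range and the part of the set inside the cylinder of \<open>a\<close> are both empty.\<close>
    show ?thesis
    proof (cases "\<alpha> @ [a] \<in> language X")
      case True
      have eq: "C_set X \<alpha> [] \<inter> C_set X [] [a] = C_set X (\<alpha> @ [a]) [a]"
        by (fastforce simp: in_C_set dest: build_in_X)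
      have "gp (C_set X \<alpha> \<beta>) * gs a \<approx> gp (C_set X (\<alpha> @ [a]) [a]) * gs a"
        using Z[OF C_set_bool_alg, of \<alpha> "[]"] by (simp add: Nil eq)
      also have "\<dots> \<approx> ws [a] * wt (\<alpha> @ [a]) * ws (\<alpha> @ [a]) * wt [a] * gs a"
        by (rule rel_left[OF rel_sym[OF rel_word[OF True letter_language]]])
      also have "\<dots> = gs a * (wt (\<alpha> @ [a]) * ws (\<alpha> @ [a])) * (gt a * gs a)"
        by (simp add: word_s_Cons word_s_star_Cons mult.assoc)
      also have "\<dots> \<approx> gs a * gp (C_set X (\<alpha> @ [a]) []) * (gt a * gs a)"
        using rel_word[OF True Nil_language] by (intro rel_left rel_right) simp
      also have "\<dots> = gs a * (gp (C_set X (\<alpha> @ [a]) []) * (gt a * gs a))" by (simp add: mult.assoc)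
      also have "\<dots> \<approx> gs a * gp (C_set X (\<alpha> @ [a]) [] \<inter> C_set X [a] [])"
        by (rule prod[OF C_set_bool_alg])
      also have "C_set X (\<alpha> @ [a]) [] \<inter> C_set X [a] [] = rng (C_set X \<alpha> \<beta>) [a]"
        by (auto simp: Nil dest: conc_in_X)
      finally show ?thesis .
    next
      case False
      hence e: "rng (C_set X \<alpha> \<beta>) [a] = {}" "C_set X \<alpha> \<beta> \<inter> C_set X [] [a] = {}"
        using language_conc[of "\<alpha> @ [a]"] by (auto simp: Nil in_C_set)
      show ?thesis
        using Z[OF C_set_bool_alg, of \<alpha> \<beta>] gs0 unfolding e by (blast intro: rel_trans)
    qed
  next
    case (Cons b \<beta>')
    show ?thesis
    proof (cases "a = b")
      case True
      have \<beta>': "\<beta>' \<in> language X"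
      proof -
        obtain x i where xi: "x \<in> X" "subsequence x i (i + length \<beta>) = \<beta>"
          using C(2) unfolding language_def occurs_in_def by blast
        have "subsequence x (Suc i) (Suc i + length \<beta>') = \<beta>'"
          using arg_cong[OF xi(2), of tl] Cons by (simp add: subsequence_def upt_rec map_tl[symmetric])
        thus ?thesis using xi(1) unfolding language_def occurs_in_def by blast
      qed
      have "gp (C_set X \<alpha> \<beta>) * gs a \<approx> ws \<beta> * wt \<alpha> * ws \<alpha> * wt \<beta> * gs a"
        by (rule rel_left[OF rel_sym[OF rel_word[OF C]]])
      also have "\<dots> = gs a * ((ws \<beta>' * wt \<alpha> * ws \<alpha> * wt \<beta>') * (gt a * gs a))"
        by (simp add: Cons True word_s_Cons word_s_star_Cons mult.assoc)
      also have "\<dots> \<approx> gs a * (gp (C_set X \<alpha> \<beta>') * (gt a * gs a))"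
        by (intro rel_left rel_right rel_word C \<beta>')
      also have "\<dots> \<approx> gs a * gp (C_set X \<alpha> \<beta>' \<inter> C_set X [a] [])"
        by (rule prod[OF C_set_bool_alg])
      also have "C_set X \<alpha> \<beta>' \<inter> C_set X [a] [] = rng (C_set X \<alpha> \<beta>) [a]"
        by (auto simp: Cons True in_C_set dest: conc_in_X build_in_X)
      finally show ?thesis .
    next
      case False
      hence e: "rng (C_set X \<alpha> \<beta>) [a] = {}" "C_set X \<alpha> \<beta> \<inter> C_set X [] [a] = {}"
        by (auto simp: Cons in_C_set)
      show ?thesis
        using Z[OF C_set_bool_alg, of \<alpha> \<beta>] gs0 unfolding e by (blast intro: rel_trans)
    qed
  qed
next
  case (compl A)
  have "gp (X - A) * gs a \<approx> (1 - gp A) * gs a" by (rule rel_left[OF gp_compl[OF compl(1)]])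
  also have "\<dots> = gs a - gp A * gs a" by (simp add: left_diff_distrib)
  also have "\<dots> \<approx> gs a * gp (C_set X [a] []) - gs a * gp (rng A [a])"
    by (intro rel_minus rel_sym[OF gs_gp] compl(2))
  \<comment> \<open>The complement of \<open>rng A [a]\<close> in \<open>X\<close> is too large, as
    it contains sequences that \<open>a\<close> cannot precede. Keeping the domain projection of s_a
    as a factor yields the relative complement.\<close>
  also have "\<dots> \<approx> gs a * gp (C_set X [a] []) - gs a * (gp (C_set X [a] []) * gp (rng A [a]))"
    by (intro rel_minus rel_refl rel_right rel_sym[OF gp_le(2)] C_set_bool_alg rng_bool_alg compl(1))
      (use bool_alg_subset[OF compl(1)] in auto)
  also have "\<dots> = gs a * gp (C_set X [a] []) * (1 - gp (rng A [a]))"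
    by (simp add: right_diff_distrib mult.assoc)
  also have "\<dots> \<approx> gs a * gp (C_set X [a] []) * gp (X - rng A [a])"
    by (intro rel_right rel_sym[OF gp_compl] rng_bool_alg compl(1))
  also have "\<dots> = gs a * (gp (C_set X [a] []) * gp (X - rng A [a]))" by (simp add: mult.assoc)
  also have "\<dots> \<approx> gs a * gp (C_set X [a] [] \<inter> (X - rng A [a]))"
    by (intro rel_right rel_sym[OF rel_gen_p_inter] C_set_bool_alg bool_alg.compl rng_bool_alg compl(1))
  also have "C_set X [a] [] \<inter> (X - rng A [a]) = rng (X - A) [a]"
    by (auto dest: build_in_X)
  finally show ?case .
next
  case (inter A B)
  have "rng A [a] \<inter> rng B [a] = rng (A \<inter> B) [a]" by auto
  thus ?case using gp_inter_gs[OF inter] by simp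
next
  case (union A B)
  have "gp (A \<union> B) * gs a \<approx> (gp A + gp B - gp (A \<inter> B)) * gs a"
    by (rule rel_left[OF rel_gen_p_union[OF union(1,2)]])
  also have "\<dots> = gp A * gs a + gp B * gs a - gp (A \<inter> B) * gs a"
    by (simp add: distrib_right left_diff_distrib)
  also have "\<dots> \<approx> gs a * gp (rng A [a]) + gs a * gp (rng B [a]) - gs a * gp (rng A [a] \<inter> rng B [a])"
    by (intro rel_minus rel_add union gp_inter_gs)
  also have "\<dots> = gs a * (gp (rng A [a]) + gp (rng B [a]) - gp (rng A [a] \<inter> rng B [a]))"
    by (simp add: distrib_left right_diff_distrib)
  also have "\<dots> \<approx> gs a * gp (rng A [a] \<union> rng B [a])"
    by (intro rel_right rel_sym[OF rel_gen_p_union] rng_bool_alg union(1,2))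
  also have "rng A [a] \<union> rng B [a] = rng (A \<union> B) [a]" by auto
  finally show ?case .
qed

text \<open>Derived from the rule for s_a: since s_a^* absorbs s_a s_a^* and projections commute,
  s_a^* p_A equals s_a^* p_A s_a s_a^*, where p_A can be moved past s_a.\<close>

lemma gt_gp_commute:
  assumes "A \<in> \<U>"
  shows "gt a * gp A \<approx> gp (rng A [a]) * gt a"
proof -
  let ?Z = "C_set X [] [a]" and ?R = "C_set X [a] []"
  note b = assms C_set_bool_alg rng_bool_alg[OF assms]
  have "gt a * gp A \<approx> gt a * gp ?Z * gp A" by (rule rel_left[OF rel_sym[OF gt_gp]])
  also have "\<dots> = gt a * (gp ?Z * gp A)" by (simp add: mult.assoc)
  also have "\<dots> \<approx> gt a * gp (?Z \<inter> A)" by (intro rel_right rel_sym[OF rel_gen_p_inter] b)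
  also have "?Z \<inter> A = A \<inter> ?Z" by blast
  also have "gt a * gp (A \<inter> ?Z) \<approx> gt a * (gp A * gp ?Z)" by (intro rel_right rel_gen_p_inter b)
  also have "\<dots> \<approx> gt a * (gp A * (gs a * gt a))" by (intro rel_right rel_sym[OF gs_gt])
  also have "\<dots> = gt a * (gp A * gs a) * gt a" by (simp add: mult.assoc)
  also have "\<dots> \<approx> gt a * (gs a * gp (rng A [a])) * gt a"
    by (intro rel_left rel_right gp_gs_commute assms)
  also have "\<dots> = (gt a * gs a) * gp (rng A [a]) * gt a" by (simp add: mult.assoc)
  also have "\<dots> \<approx> gp ?R * gp (rng A [a]) * gt a" by (intro rel_left gt_gs)
  also have "\<dots> \<approx> gp (rng A [a]) * gt a"
    by (intro rel_left gp_le(2) b) (use bool_alg_subset[OF assms] in auto)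
  finally show ?thesis .
qed

lemma gp_ws:
  assumes "A \<in> \<U>"
  shows "gp A * ws \<alpha> \<approx> ws \<alpha> * gp (rng A \<alpha>)"
  using assms
proof (induction \<alpha> arbitrary: A)
  case (Cons a \<alpha>)
  have "gp A * ws (a # \<alpha>) = (gp A * gs a) * ws \<alpha>" by (simp add: word_s_Cons mult.assoc)
  also have "\<dots> \<approx> gs a * gp (rng A [a]) * ws \<alpha>" by (intro rel_left gp_gs_commute Cons.prems)
  also have "\<dots> = gs a * (gp (rng A [a]) * ws \<alpha>)" by (simp add: mult.assoc)
  also have "\<dots> \<approx> gs a * (ws \<alpha> * gp (rng (rng A [a]) \<alpha>))"
    by (intro rel_right Cons.IH rng_bool_alg Cons.prems)
  also have "rng (rng A [a]) \<alpha> = rng A (a # \<alpha>)" by auto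
  finally show ?case by (simp add: word_s_Cons mult.assoc)
qed (simp add: rng_def)

lemma wt_gp:
  assumes "A \<in> \<U>"
  shows "wt \<alpha> * gp A \<approx> gp (rng A \<alpha>) * wt \<alpha>"
  using assms
proof (induction \<alpha> arbitrary: A)
  case (Cons a \<alpha>)
  have "wt (a # \<alpha>) * gp A = wt \<alpha> * (gt a * gp A)" by (simp add: word_s_star_Cons mult.assoc)
  also have "\<dots> \<approx> wt \<alpha> * (gp (rng A [a]) * gt a)" by (intro rel_right gt_gp_commute Cons.prems)
  also have "\<dots> = (wt \<alpha> * gp (rng A [a])) * gt a" by (simp add: mult.assoc)
  also have "\<dots> \<approx> gp (rng (rng A [a]) \<alpha>) * wt \<alpha> * gt a"
    by (intro rel_left Cons.IH rng_bool_alg Cons.prems)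
  also have "rng (rng A [a]) \<alpha> = rng A (a # \<alpha>)" by auto
  finally show ?case by (simp add: word_s_star_Cons mult.assoc)
qed (simp add: rng_def)

lemma gp_wt: "gp (C_set X \<beta> []) * wt \<beta> \<approx> wt \<beta>"
proof -
  have "gp (rng X \<beta>) * wt \<beta> \<approx> wt \<beta> * gp X" by (rule rel_sym[OF wt_gp[OF X_bool_alg]])
  also have "\<dots> \<approx> wt \<beta> * 1" by (rule rel_right[OF rel_gen_p_X])
  also have "rng X \<beta> = C_set X \<beta> []" by auto
  finally show ?thesis by simp
qed

section \<open>Reduction to the normal form\<close>

definition monomials :: "nat \<Rightarrow> ('a gen fmon \<Rightarrow>\<^sub>0 'r) set" where
  "monomials n = {scal c * (ws \<alpha> * gp A * wt \<beta>) | c \<alpha> A \<beta>. A \<in> \<U> \<and> length \<alpha> \<le> n}"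

text \<open>The bound concerns the left word only: faithfulness is proved by removing its letters
  one at a time, whereas all right words are separated at once.\<close>

definition normal :: "nat \<Rightarrow> ('a gen fmon \<Rightarrow>\<^sub>0 'r) set" where
  "normal n = {f. \<exists>g\<in>add_closure (monomials n). f \<approx> g}"

lemma normal_cong: "f \<approx> g \<Longrightarrow> g \<in> normal n \<Longrightarrow> f \<in> normal n"
  unfolding normal_def using rel_trans by blast

lemma normal_add: "f \<in> normal n \<Longrightarrow> g \<in> normal n \<Longrightarrow> f + g \<in> normal n"
  unfolding normal_def using rel_add add_closure_add by blast

lemma normal_0: "0 \<in> normal n"
  unfolding normal_def using add_closure.zero by blast

lemma normal_monomial:
  "A \<in> \<U> \<Longrightarrow> length \<alpha> \<le> n \<Longrightarrow> scal c * (ws \<alpha> * gp A * wt \<beta>) \<in> normal n"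
  unfolding normal_def using add_closure_incl[of _ "monomials n"] unfolding monomials_def by blast

lemma normal_mono:
  assumes "m \<le> n"
  shows "normal m \<subseteq> normal n"
proof -
  have "monomials m \<subseteq> monomials n" using assms unfolding monomials_def by fastforce
  hence "add_closure (monomials m) \<subseteq> add_closure (monomials n)"
    by (intro add_closure_mono) (auto intro: add_closure_incl)
  thus ?thesis unfolding normal_def by blast
qed

lemma normal_mult_left:
  assumes "f \<in> normal m"
    and "\<And>c \<alpha> A \<beta>. A \<in> \<U> \<Longrightarrow> length \<alpha> \<le> m \<Longrightarrow> h * (ws \<alpha> * gp A * wt \<beta>) \<in> normal n"
    and scal: "\<And>c f. f \<in> normal n \<Longrightarrow> scal c * f \<in> normal n"
  shows "h * f \<in> normal n"
proof -
  obtain g where g: "g \<in> add_closure (monomials m)" "f \<approx> g" using assms(1) unfolding normal_def by blast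
  from g(1) have "h * g \<in> normal n"
  proof induction
    case (add k x)
    obtain c \<alpha> A \<beta> where k: "k = scal c * (ws \<alpha> * gp A * wt \<beta>)" "A \<in> \<U>" "length \<alpha> \<le> m"
      using add.hyps(1) unfolding monomials_def by blast
    have "h * k = scal c * (h * (ws \<alpha> * gp A * wt \<beta>))"
      unfolding k(1) by (simp only: mult.assoc[symmetric] scal_commute[of c h])
    hence "h * k \<in> normal n" using assms(2)[OF k(2,3)] scal by simp
    thus ?case using add.IH by (simp add: distrib_left normal_add)
  qed (simp add: normal_0)
  thus ?thesis using normal_cong[OF rel_right[OF g(2)]] by blast
qed

lemma normal_scal:
  assumes "f \<in> normal n"
  shows "scal c * f \<in> normal n"
proof -
  obtain g where g: "g \<in> add_closure (monomials n)" "f \<approx> g" using assms unfolding normal_def by blast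
  have "scal c * g \<in> add_closure (monomials n)"
  proof (rule add_closure_mult_left[OF g(1)])
    fix k assume "k \<in> monomials n"
    then obtain d \<alpha> A \<beta> where "k = scal d * (ws \<alpha> * gp A * wt \<beta>)" "A \<in> \<U>" "length \<alpha> \<le> n"
      unfolding monomials_def by blast
    hence "scal c * k = scal (c * d) * (ws \<alpha> * gp A * wt \<beta>)" "A \<in> \<U>" "length \<alpha> \<le> n"
      by (simp_all add: scal_mult mult.assoc)
    hence "scal c * k \<in> monomials n" unfolding monomials_def by blast
    thus "scal c * k \<in> add_closure (monomials n)" by (rule add_closure_incl)
  qed
  thus ?thesis using normal_cong[OF rel_right[OF g(2)]] unfolding normal_def by blast
qed

lemma monomial_normal: "A \<in> \<U> \<Longrightarrow> length \<alpha> \<le> n \<Longrightarrow> ws \<alpha> * gp A * wt \<beta> \<in> normal n"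
  using normal_monomial[of A \<alpha> n 1 \<beta>] by simp

lemma gp_monomial:
  assumes "A \<in> \<U>" "B \<in> \<U>"
  shows "gp B * (ws \<alpha> * gp A * wt \<beta>) \<approx> ws \<alpha> * gp (rng B \<alpha> \<inter> A) * wt \<beta>"
proof -
  have "gp B * (ws \<alpha> * gp A * wt \<beta>) = gp B * ws \<alpha> * (gp A * wt \<beta>)" by (simp add: mult.assoc)
  also have "\<dots> \<approx> ws \<alpha> * gp (rng B \<alpha>) * (gp A * wt \<beta>)" by (intro rel_left gp_ws assms)
  also have "\<dots> = ws \<alpha> * (gp (rng B \<alpha>) * gp A) * wt \<beta>" by (simp add: mult.assoc)
  also have "\<dots> \<approx> ws \<alpha> * gp (rng B \<alpha> \<inter> A) * wt \<beta>"
    by (intro rel_left rel_right rel_sym[OF rel_gen_p_inter] rng_bool_alg assms)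
  finally show ?thesis .
qed

lemma normal_gp: "f \<in> normal n \<Longrightarrow> B \<in> \<U> \<Longrightarrow> gp B * f \<in> normal n"
  by (erule normal_mult_left[OF _ _ normal_scal])
    (auto intro!: normal_cong[OF gp_monomial] monomial_normal bool_alg.inter rng_bool_alg)

lemma normal_gs:
  assumes "f \<in> normal n"
  shows "gs a * f \<in> normal (Suc n)"
proof (rule normal_mult_left[OF assms _ normal_scal])
  fix \<alpha> \<beta> :: "'a list" and A assume a: "A \<in> \<U>" "length \<alpha> \<le> n"
  have "ws (a # \<alpha>) * gp A * wt \<beta> \<in> normal (Suc n)"
    by (rule monomial_normal) (use a in auto)
  thus "gs a * (ws \<alpha> * gp A * wt \<beta>) \<in> normal (Suc n)" by (simp add: word_s_Cons mult.assoc)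
qed

text \<open>Either s_a^* meets the first letter of the left word and cancels it or annihilates the
  monomial, or the left word is empty and s_a^* passes through the projection into the right word.
  The resulting drop of the bound drives the induction in \<open>faithful_normal\<close>.\<close>

lemma normal_gt:
  assumes "f \<in> normal (Suc n)"
  shows "gt a * f \<in> normal n"
proof (rule normal_mult_left[OF assms _ normal_scal])
  fix \<alpha> \<beta> :: "'a list" and A assume a: "A \<in> \<U>" "length \<alpha> \<le> Suc n"
  show "gt a * (ws \<alpha> * gp A * wt \<beta>) \<in> normal n"
  proof (cases \<alpha>)
    case Nil
    have "gt a * (ws \<alpha> * gp A * wt \<beta>) = (gt a * gp A) * wt \<beta>" by (simp add: Nil mult.assoc)
    also have "\<dots> \<approx> (gp (rng A [a]) * gt a) * wt \<beta>" by (intro rel_left gt_gp_commute a)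
    also have "\<dots> = ws [] * gp (rng A [a]) * wt (\<beta> @ [a])"
      by (simp add: mult.assoc word_s_star_append word_s_star_Cons)
    finally show ?thesis
      by (rule normal_cong) (intro monomial_normal rng_bool_alg a, simp)
  next
    case (Cons b \<alpha>')
    have eq: "gt a * (ws \<alpha> * gp A * wt \<beta>) = (gt a * gs b) * (ws \<alpha>' * gp A * wt \<beta>)"
      by (simp add: Cons word_s_Cons mult.assoc)
    have n: "ws \<alpha>' * gp A * wt \<beta> \<in> normal n" by (rule monomial_normal) (use a Cons in auto)
    show ?thesis
    proof (cases "a = b")
      case True
      show ?thesis unfolding eq unfolding True
        by (rule normal_cong[OF rel_left[OF gt_gs]]) (intro normal_gp n C_set_bool_alg)
    next
      case False
      show ?thesis unfolding eq
        by (rule normal_cong[OF rel_left[OF gt_gs_neq[OF False]]]) (simp add: normal_0)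
    qed
  qed
qed

lemma normal_exists: "\<exists>n. f \<in> normal n"
proof -
  have gen: "\<exists>n. monom (FMon gl) 1 \<in> normal n" for gl
  proof (induction gl)
    case Nil
    have "1 \<approx> ws [] * gp X * wt []" using rel_sym[OF rel_gen_p_X] by simp
    moreover have "ws [] * gp X * wt [] \<in> normal 0" by (intro monomial_normal X_bool_alg) simp
    ultimately have "1 \<in> normal 0" by (rule normal_cong)
    thus ?case by (metis single_one zero_fmon_def)
  next
    case (Cons g gl)
    then obtain n where n: "monom (FMon gl) 1 \<in> normal n" by blast
    have eq: "monom (FMon (g # gl)) (1::'r)
        = monom (FMon [g]) 1 * monom (FMon gl) 1"
      by (simp add: mult_single plus_fmon_def)
    show ?case
    proof (cases g)
      case (Gen_p A)
      show ?thesis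
      proof (cases "A \<in> \<U>")
        case True
        thus ?thesis using normal_gp[OF n] unfolding eq unfolding Gen_p gen_p_def by blast
      next
        case False
        \<comment> \<open>Here the generator lies outside \<open>gens X\<close>, so
          \<open>retraction\<close> sends it to 0.\<close>
        have "gp A \<approx> 0"
          unfolding rel_cong_def gen_p_def retraction_def diff_zero free.eval_alg_gen
          using False relation_ideal_zero by (auto simp: gens_def)
        from rel_left[OF this] have "monom (FMon (g # gl)) 1 \<approx> (0 :: 'a gen fmon \<Rightarrow>\<^sub>0 'r)"
          unfolding eq unfolding Gen_p gen_p_def by simp
        thus ?thesis using normal_cong normal_0 by blast
      qed
    next
      case (Gen_s a)
      thus ?thesis using normal_gs[OF n, of a] unfolding eq unfolding Gen_s gen_s_def by blast
    next
      case (Gen_s_star a)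
      have "monom (FMon gl) 1 \<in> normal (Suc n)" using n normal_mono[of n "Suc n"] by auto
      thus ?thesis using normal_gt[of _ n a] unfolding eq unfolding Gen_s_star gen_s_star_def by blast
    qed
  qed
  have trm: "\<exists>n. monom w c \<in> normal n" for w and c :: 'r
  proof -
    obtain n where n: "monom (FMon (letters w)) 1 \<in> normal n" using gen by blast
    have "scal c * monom (FMon (letters w)) 1 = monom w c"
      by (simp add: mult_single)
    thus ?thesis using normal_scal[OF n, of c] by metis
  qed
  have "\<exists>n. (\<Sum>w\<in>W. monom w (coeff f w)) \<in> normal n" if "finite W" for W
    using that
  proof (induction W)
    case (insert w W)
    then obtain m n where m: "(\<Sum>w\<in>W. monom w (coeff f w)) \<in> normal m"
      and n: "monom w (coeff f w) \<in> normal n" using trm by blast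
    have "normal m \<subseteq> normal (max m n)" "normal n \<subseteq> normal (max m n)" by (auto intro!: normal_mono)
    hence "(\<Sum>w\<in>insert w W. monom w (coeff f w)) \<in> normal (max m n)"
      using insert m n by (auto intro!: normal_add)
    thus ?case by blast
  qed (auto intro: normal_0)
  from this[of "keys f"] show ?thesis by (simp add: poly_mapping_sum_single)
qed

section \<open>Faithfulness of the matrix representation\<close>

lemma rep_cong:
  assumes "f \<approx> g" "f \<in> \<F>" "g \<in> \<F>"
  shows "rep f = rep (g :: 'a gen fmon \<Rightarrow>\<^sub>0 'r)"
  using assms rep_relation_ideal[of "f - g"] by (simp add: rel_cong_iff rep_minus)

lemma monomials_carrier: "add_closure (monomials n) \<subseteq> \<F>"
  by (rule add_closure_minimal)
    (auto simp: monomials_def intro!: carrier_free_algebra_mult gen_p_gens word_s_gens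
      word_s_star_gens carrier_free_algebra_consts)

section \<open>Elements with empty left words\<close>

definition diagonal :: "('a gen fmon \<Rightarrow>\<^sub>0 'r) set" where
  "diagonal = add_closure {scal c * gp A | c A. A \<in> \<U>}"

lemma ent_rep_diagonal:
  assumes "h \<in> diagonal"
  shows "\<exists>v. \<forall>x y. ent (rep h) x y = (if x = y \<and> x \<in> X then monom 0 (v x) else 0)"
  using assms unfolding diagonal_def
proof induction
  case zero
  show ?case by (rule exI[of _ "\<lambda>_. 0"]) simp
next
  case (add k h)
  then obtain c A v where k: "k = scal c * gp A"
    and v: "\<And>x y. ent (rep h) x y = (if x = y \<and> x \<in> X then monom 0 (v x) else 0)" by blast
  show ?case
    by (rule exI[of _ "\<lambda>x. (if x \<in> A then c else 0) + v x"])
      (auto simp: k rep_add rep_scale rep_gen v ent_proj single_add ent_smat)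
qed

text \<open>Combinations of projections are determined by the corresponding combinations of indicator
  functions: split \<open>B\<close> along each projection in turn.\<close>

lemma diagonal_constant:
  assumes "h \<in> diagonal" "B \<in> \<U>"
    and "\<And>x. x \<in> B \<Longrightarrow> ent (rep h) x x = monom 0 d"
  shows "h * gp B \<approx> scal d * gp B"
  using assms unfolding diagonal_def
proof (induction arbitrary: B d)
  case zero
  show ?case
  proof (cases "B = {}")
    case True
    show ?thesis using rel_right[OF rel_sym[OF rel_gen_p_empty], of "scal d"] by (simp add: True)
  next
    case False
    then obtain x where "x \<in> B" by blast
    hence "monom (0::int) d = 0" using zero(2) by fastforce
    hence "d = 0" by (metis lookup_single_eq lookup_zero)
    thus ?thesis by simp
  qed
next
  case (add k h)
  then obtain c A where k: "k = scal c * gp A" and A: "A \<in> \<U>" by blast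
  note b = A add.prems(1) bool_alg.inter diff_bool_alg
  have x: "x \<in> X" if "x \<in> B" for x using bool_alg_subset[OF add.prems(1)] that by blast
  have e: "ent (rep k) x x + ent (rep h) x x = monom 0 d" if "x \<in> B" for x
    using add.prems(2)[OF that] by (simp add: rep_add)
  have ek: "ent (rep k) x x = (if x \<in> A then monom 0 c else 0)" if "x \<in> B" for x
    using x[OF that] by (simp add: k rep_scale rep_gen ent_proj ent_smat)
  have 1: "h * gp (B \<inter> A) \<approx> scal (d - c) * gp (B \<inter> A)"
  proof (rule add.IH)
    fix x assume "x \<in> B \<inter> A"
    hence "ent (rep h) x x = monom 0 d - monom 0 c"
      using e[of x] ek[of x] by (simp add: algebra_simps)
    thus "ent (rep h) x x = monom 0 (d - c)" by (simp add: single_diff)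
  qed (intro b)
  have 2: "h * gp (B - A) \<approx> scal d * gp (B - A)"
  proof (rule add.IH)
    fix x assume "x \<in> B - A"
    thus "ent (rep h) x x = monom 0 d" using e[of x] ek[of x] by simp
  qed (intro b)
  have 3: "k * gp (B \<inter> A) \<approx> scal c * gp (B \<inter> A)"
    unfolding k mult.assoc by (intro rel_right gp_le(2) b) auto
  have 4: "k * gp (B - A) \<approx> scal c * 0"
    unfolding k mult.assoc by (intro rel_right gp_disjoint b) auto
  have B: "gp B \<approx> gp (B \<inter> A) + gp (B - A)"
    using gp_union_disjoint[of "B \<inter> A" "B - A"] b by (simp add: Int_Diff_Un) blast
  have "(k + h) * gp B \<approx> (k + h) * (gp (B \<inter> A) + gp (B - A))" by (rule rel_right[OF B])
  also have "\<dots> = (k * gp (B \<inter> A) + h * gp (B \<inter> A)) + (k * gp (B - A) + h * gp (B - A))"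
    by (simp add: algebra_simps)
  also have "\<dots> \<approx> (scal c * gp (B \<inter> A) + scal (d - c) * gp (B \<inter> A)) + (scal c * 0 + scal d * gp (B - A))"
    by (intro rel_add 1 2 3 4)
  also have "\<dots> = scal d * (gp (B \<inter> A) + gp (B - A))"
    by (simp add: distrib_right[symmetric] distrib_left scal_add[symmetric])
  also have "\<dots> \<approx> scal d * gp B" by (rule rel_right[OF rel_sym[OF B]])
  finally show ?case .
qed

text \<open>Terms with the same right word are collected. Vanishing of \<open>h\<close> off
  \<open>B\<close> lets the induction insert a word whether or not \<open>B\<close> already contains
  it.\<close>

lemma monomials_0_group:
  assumes "g \<in> add_closure (monomials 0)"
  shows "\<exists>B h. finite B \<and> (\<forall>\<beta>. h \<beta> \<in> diagonal) \<and> (\<forall>\<beta>. \<beta> \<notin> B \<longrightarrow> h \<beta> = 0) \<and>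
    g = (\<Sum>\<beta>\<in>B. h \<beta> * wt \<beta>)"
  using assms
proof induction
  case zero
  have "\<forall>\<beta>. 0 \<in> diagonal" by (simp add: diagonal_def add_closure.zero)
  thus ?case by (intro exI[of _ "{}"] exI[of _ "\<lambda>_. 0"]) simp
next
  case (add k g)
  then obtain B h where h: "finite B" "\<And>\<beta>. h \<beta> \<in> diagonal" "\<And>\<beta>. \<beta> \<notin> B \<Longrightarrow> h \<beta> = 0"
    "g = (\<Sum>\<beta>\<in>B. h \<beta> * wt \<beta>)" by blast
  obtain c A \<gamma> where k: "k = scal c * gp A * wt \<gamma>" "A \<in> \<U>"
    using add.hyps(1) unfolding monomials_def by (auto simp: mult.assoc)
  define h' where "h' = h(\<gamma> := scal c * gp A + h \<gamma>)"
  have "scal c * gp A + h \<gamma> \<in> diagonal"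
    using h(2)[of \<gamma>] k(2) unfolding diagonal_def by (blast intro: add_closure.add)
  hence "h' \<beta> \<in> diagonal" for \<beta> using h(2) by (simp add: h'_def)
  moreover have "h' \<beta> = 0" if "\<beta> \<notin> insert \<gamma> B" for \<beta> using that h(3) by (simp add: h'_def)
  moreover have "k + g = (\<Sum>\<beta>\<in>insert \<gamma> B. h' \<beta> * wt \<beta>)"
  proof -
    have "(\<Sum>\<beta>\<in>insert \<gamma> B. h' \<beta> * wt \<beta>)
        = (\<Sum>\<beta>\<in>insert \<gamma> B. (if \<beta> = \<gamma> then k else 0) + h \<beta> * wt \<beta>)"
      by (rule sum.cong) (auto simp: h'_def k(1) distrib_right)
    also have "\<dots> = k + (\<Sum>\<beta>\<in>insert \<gamma> B. h \<beta> * wt \<beta>)"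
      using h(1) by (simp add: sum.distrib)
    also have "(\<Sum>\<beta>\<in>insert \<gamma> B. h \<beta> * wt \<beta>) = g"
      unfolding h(4) by (rule sum.mono_neutral_right) (use h in auto)
    finally show ?thesis ..
  qed
  ultimately show ?case using h(1) by (intro exI[of _ "insert \<gamma> B"] exI[of _ h']) simp
qed

text \<open>The entry at \<open>(x, \<beta> \<frown> x)\<close> in degree
  \<open>- int (length \<beta>)\<close> sees only \<open>h \<beta>\<close> at \<open>x\<close>:
  another word of the same length leads to another sequence, and a word of another length has
  another degree. So \<open>h \<beta>\<close> vanishes on \<open>C_set X \<beta> []\<close>, whose
  projection s_\<beta>^* absorbs.\<close>

lemma faithful_0:
  assumes "g \<in> add_closure (monomials 0)" "rep g = 0"
  shows "g \<approx> 0"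
proof -
  obtain B h where h: "finite B" "\<And>\<beta>. h \<beta> \<in> diagonal" "g = (\<Sum>\<beta>\<in>B. h \<beta> * wt \<beta>)"
    using monomials_0_group[OF assms(1)] by blast
  have "\<forall>\<beta>. \<exists>v. \<forall>x y. ent (rep (h \<beta>)) x y = (if x = y \<and> x \<in> X then monom 0 (v x) else 0)"
    using ent_rep_diagonal h(2) by blast
  then obtain v where v: "\<And>\<beta> x y. ent (rep (h \<beta>)) x y
      = (if x = y \<and> x \<in> X then monom 0 (v \<beta> x) else 0)"
    unfolding choice_iff by blast
  have zero: "v \<beta> x = 0" if "\<beta> \<in> B" "\<beta> \<frown> x \<in> X" for \<beta> x
  proof -
    have x: "x \<in> X" using that(2) by (rule conc_in_X)
    have e: "coeff (ent (rep (h \<gamma> * wt \<gamma>)) x (\<beta> \<frown> x)) (- int (length \<beta>))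
        = (if \<gamma> = \<beta> then v \<beta> x else 0)" for \<gamma>
    proof (cases "length \<gamma> = length \<beta>")
      case True
      have z: "suffix (length \<gamma>) (\<beta> \<frown> x) = x" using True by simp
      have eq: "\<beta> \<frown> x = \<gamma> \<frown> x \<longleftrightarrow> \<beta> = \<gamma>" using True by simp
      have "ent (rep (h \<gamma> * wt \<gamma>)) x (\<beta> \<frown> x) =
          (if \<beta> = \<gamma> then monom (- int (length \<gamma>)) (v \<gamma> x) else 0)"
        unfolding rep_mult rep_word_s_star ent_mult_term_mat Let_def z v eq
        using that(2) x by (simp add: mult_single)
      thus ?thesis using True by auto
    next
      case False
      thus ?thesis
        by (auto simp: rep_mult rep_word_s_star ent_mult_term_mat v Let_def mult_single lookup_single)
    qed
    have "0 = coeff (ent (rep g) x (\<beta> \<frown> x)) (- int (length \<beta>))"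
      using assms(2) by simp
    also have "\<dots> = (\<Sum>\<gamma>\<in>B. if \<gamma> = \<beta> then v \<beta> x else 0)"
      by (simp add: h(3) rep_sum ent_sum lookup_sum e)
    finally show ?thesis using h(1) that(1) by simp
  qed
  have "g \<approx> (\<Sum>\<beta>\<in>B. 0)"
    unfolding h(3)
  proof (rule rel_sum)
    fix \<beta> assume \<beta>: "\<beta> \<in> B"
    have "h \<beta> * wt \<beta> \<approx> h \<beta> * (gp (C_set X \<beta> []) * wt \<beta>)" by (intro rel_right rel_sym[OF gp_wt])
    also have "\<dots> = h \<beta> * gp (C_set X \<beta> []) * wt \<beta>" by (simp add: mult.assoc)
    also have "\<dots> \<approx> scal 0 * gp (C_set X \<beta> []) * wt \<beta>"
    proof (rule rel_left[OF diagonal_constant[OF h(2) C_set_bool_alg]])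
      fix x assume "x \<in> C_set X \<beta> []"
      thus "ent (rep (h \<beta>)) x x = monom 0 0" using zero[OF \<beta>] by (simp add: v)
    qed
    finally show "h \<beta> * wt \<beta> \<approx> 0" by simp
  qed
  thus ?thesis by simp
qed

section \<open>Splitting off first letters\<close>

definition tail_proj :: "'a set \<Rightarrow> 'a word set" where
  "tail_proj F = X - (\<Union>a\<in>F. C_set X [] [a])"

lemma tail_proj_bool_alg: "finite F \<Longrightarrow> tail_proj F \<in> \<U>"
  and gp_partition: "finite F \<Longrightarrow> 1 \<approx> (\<Sum>a\<in>F. gs a * gt a) + gp (tail_proj F)"
proof -
  assume F: "finite F"
  have *: "(\<Union>a\<in>F. C_set X [] [a]) \<in> \<U> \<and>
      gp (\<Union>a\<in>F. C_set X [] [a]) \<approx> (\<Sum>a\<in>F. gs a * gt a)"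
    using F
  proof (induction F)
    case empty
    show ?case using rel_gen_p_empty by (simp add: empty_bool_alg)
  next
    case (insert a F)
    have "gp (C_set X [] [a] \<union> (\<Union>a\<in>F. C_set X [] [a])) \<approx> gp (C_set X [] [a]) + gp (\<Union>a\<in>F. C_set X [] [a])"
      by (rule gp_union_disjoint) (use insert in \<open>auto simp: C_set_bool_alg, auto simp: in_C_set\<close>)
    also have "\<dots> \<approx> gs a * gt a + (\<Sum>a\<in>F. gs a * gt a)"
      using insert.IH by (intro rel_add rel_sym[OF gs_gt]) simp
    finally show ?case using insert by (simp add: bool_alg.union C_set_bool_alg)
  qed
  thus "tail_proj F \<in> \<U>" by (simp add: tail_proj_def bool_alg.compl)
  have "gp (\<Union>a\<in>F. C_set X [] [a]) + gp (tail_proj F) \<approx> gp (\<Union>a\<in>F. C_set X [] [a]) + (1 - gp (\<Union>a\<in>F. C_set X [] [a]))"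
    unfolding tail_proj_def by (intro rel_add rel_refl gp_compl conjunct1[OF *])
  also have "\<dots> = 1" by simp
  finally have "1 \<approx> gp (\<Union>a\<in>F. C_set X [] [a]) + gp (tail_proj F)" by (rule rel_sym)
  also have "\<dots> \<approx> (\<Sum>a\<in>F. gs a * gt a) + gp (tail_proj F)" by (intro rel_add rel_refl conjunct2[OF *])
  finally show "1 \<approx> (\<Sum>a\<in>F. gs a * gt a) + gp (tail_proj F)" .
qed

lemma tail_proj_gs:
  assumes "finite F" "b \<in> F"
  shows "gp (tail_proj F) * gs b \<approx> 0"
proof -
  have "gp (tail_proj F) * gs b \<approx> gp (tail_proj F) * (gp (C_set X [] [b]) * gs b)"
    by (rule rel_right[OF rel_sym[OF gp_gs]])
  also have "\<dots> = gp (tail_proj F) * gp (C_set X [] [b]) * gs b" by (simp add: mult.assoc)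
  also have "\<dots> \<approx> 0 * gs b"
    by (intro rel_left gp_disjoint tail_proj_bool_alg C_set_bool_alg assms)
      (use assms(2) in \<open>auto simp: tail_proj_def\<close>)
  finally show ?thesis by simp
qed

text \<open>Once \<open>F'\<close> contains the first letters of all left words, the remainder
  projection annihilates every monomial with a nonempty left word. The statement covers all larger
  finite sets so that the choices for two summands can be united.\<close>

lemma normal_tail_proj:
  assumes "g \<in> add_closure (monomials n)"
  shows "\<exists>F. finite F \<and> (\<forall>F'. finite F' \<and> F \<subseteq> F' \<longrightarrow> gp (tail_proj F') * g \<in> normal 0)"
  using assms
proof induction
  case zero
  show ?case by (intro exI[of _ "{}"]) (simp add: normal_0)
next
  case (add k g)
  then obtain F where F: "finite F" "\<And>F'. finite F' \<Longrightarrow> F \<subseteq> F' \<Longrightarrow> gp (tail_proj F') * g \<in> normal 0"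
    by blast
  obtain c \<alpha> A \<beta> where k: "k = scal c * (ws \<alpha> * gp A * wt \<beta>)" "A \<in> \<U>"
    using add.hyps(1) unfolding monomials_def by blast
  have "gp (tail_proj F') * k \<in> normal 0" if F': "finite F'" "set (take 1 \<alpha>) \<subseteq> F'" for F'
  proof -
    have eq: "gp (tail_proj F') * k = scal c * (gp (tail_proj F') * (ws \<alpha> * gp A * wt \<beta>))"
      unfolding k(1) by (simp only: mult.assoc[symmetric] scal_commute[of c "gp (tail_proj F')"])
    have "gp (tail_proj F') * (ws \<alpha> * gp A * wt \<beta>) \<in> normal 0"
    proof (cases \<alpha>)
      case Nil
      show ?thesis
        by (rule normal_gp[OF monomial_normal]) (use Nil k F' in \<open>auto simp: tail_proj_bool_alg\<close>)
    next
      case (Cons b \<alpha>')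
      hence eq: "gp (tail_proj F') * (ws \<alpha> * gp A * wt \<beta>)
          = gp (tail_proj F') * gs b * (ws \<alpha>' * gp A * wt \<beta>)"
        by (simp add: word_s_Cons mult.assoc)
      have "b \<in> F'" using Cons F' by simp
      show ?thesis unfolding eq
        by (rule normal_cong[OF rel_left[OF tail_proj_gs[OF F'(1) \<open>b \<in> F'\<close>]]]) (simp add: normal_0)
    qed
    thus ?thesis unfolding eq by (rule normal_scal)
  qed
  hence "gp (tail_proj F') * (k + g) \<in> normal 0" if "finite F'" "F \<union> set (take 1 \<alpha>) \<subseteq> F'" for F'
    using that F(2) by (simp add: distrib_left normal_add)
  thus ?case using F(1) by (intro exI[of _ "F \<union> set (take 1 \<alpha>)"]) blast
qed

text \<open>Split 1 as in \<open>gp_partition\<close>. Each s_a^* g has a smaller bound and still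
  acts as 0, so the induction hypothesis removes it; the remainder has only empty left words and
  falls under \<open>faithful_0\<close>.\<close>

lemma faithful_normal:
  assumes "f \<in> normal n" "f \<in> \<F>" "rep f = 0"
  shows "f \<approx> 0"
  using assms
proof (induction n arbitrary: f)
  case 0
  then obtain g where g: "g \<in> add_closure (monomials 0)" "f \<approx> g" unfolding normal_def by blast
  have "rep g = 0" using rep_cong[OF g(2) 0(2)] monomials_carrier g(1) 0(3) by fastforce
  thus ?case using faithful_0[OF g(1)] rel_trans[OF g(2)] by blast
next
  case (Suc n)
  then obtain g where g: "g \<in> add_closure (monomials (Suc n))" "f \<approx> g" unfolding normal_def by blast
  have gF: "g \<in> \<F>" using monomials_carrier g(1) by blast
  have rg: "rep g = 0" using rep_cong[OF g(2) Suc.prems(2) gF] Suc.prems(3) by simp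
  obtain F where F: "finite F" "gp (tail_proj F) * g \<in> normal 0"
    using normal_tail_proj[OF g(1)] by blast
  have gn: "g \<in> normal (Suc n)" using g(1) unfolding normal_def by blast
  have 1: "gt a * g \<approx> 0" for a
    by (rule Suc.IH) (simp_all add: normal_gt gn carrier_free_algebra_mult gen_s_gens gen_s_star_gens gF rep_mult rg)
  have 2: "gp (tail_proj F) * g \<approx> 0"
  proof -
    let ?f = "gp (tail_proj F) * g"
    have fF: "?f \<in> \<F>"
      by (intro carrier_free_algebra_mult gen_p_gens tail_proj_bool_alg F gF)
    obtain h where h: "h \<in> add_closure (monomials 0)" "?f \<approx> h" using F(2) unfolding normal_def by blast
    have "rep h = rep ?f" using rep_cong[OF h(2) fF] monomials_carrier h(1) by fastforce
    hence "rep h = 0" by (simp add: rep_mult rg)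
    thus ?thesis using faithful_0[OF h(1)] rel_trans[OF h(2)] by blast
  qed
  have "f \<approx> 1 * g" using g(2) by simp
  also have "\<dots> \<approx> ((\<Sum>a\<in>F. gs a * gt a) + gp (tail_proj F)) * g" by (rule rel_left[OF gp_partition[OF F(1)]])
  also have "\<dots> = (\<Sum>a\<in>F. gs a * (gt a * g)) + gp (tail_proj F) * g"
    by (simp add: distrib_right sum_distrib_right mult.assoc)
  also have "\<dots> \<approx> (\<Sum>a\<in>F. gs a * 0) + 0" by (intro rel_add rel_sum rel_right 1 2)
  finally show ?case by simp
qed

lemma kernel_rep:
  assumes "f \<in> \<F>" "rep f = 0"
  shows "(f :: 'a gen fmon \<Rightarrow>\<^sub>0 'r) \<in> relation_ideal X"
proof -
  obtain n where "f \<in> normal n" using normal_exists by blast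
  hence "f \<approx> 0" using faithful_normal assms by blast
  thus ?thesis using assms(1) by (simp add: rel_cong_iff carrier_free_algebra)
qed

lemma rep_in_span:
  "f \<in> \<F> \<Longrightarrow>
    rep f \<in> add_closure {term_mat X (c :: 'r) \<alpha> A \<beta> | c \<alpha> A \<beta>. A \<in> \<U>}"
proof -
  assume f: "f \<in> \<F>"
  obtain n where "f \<in> normal n" using normal_exists by blast
  then obtain g where g: "g \<in> add_closure (monomials n)" "f \<approx> g" unfolding normal_def by blast
  have "rep f = rep g" using rep_cong[OF g(2) f] monomials_carrier g(1) by blast
  moreover have "rep g \<in> add_closure {term_mat X c \<alpha> A \<beta> | c \<alpha> A \<beta>. A \<in> \<U>}"
  proof (rule add_closure_map[OF g(1)])
    fix k assume "k \<in> monomials n"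
    then obtain c \<alpha> A \<beta> where "k = scal c * (ws \<alpha> * gp A * wt \<beta>)" "A \<in> \<U>"
      unfolding monomials_def by blast
    hence "rep k = term_mat X c \<alpha> A \<beta>" "A \<in> \<U>"
      by (simp_all add: rep_scale rep_monomial smat_mult_term_mat)
    thus "rep k \<in> add_closure {term_mat X c \<alpha> A \<beta> | c \<alpha> A \<beta>. A \<in> \<U>}"
      by (intro add_closure_incl) blast
  qed (simp_all add: rep_add)
  ultimately show ?thesis by simp
qed

section \<open>The socle\<close>


definition terms :: "('a, 'r) orbit_matrix set" where
  "terms = {term_mat X c \<alpha> A \<beta> | c \<alpha> A \<beta>. A \<in> \<U>}"

definition mat_alg :: "('a, 'r) orbit_matrix set" where
  "mat_alg = add_closure terms"

lemma rep_image: "rep ` \<F> = mat_alg"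
proof
  show "rep ` \<F> \<subseteq> mat_alg"
    using rep_in_span unfolding mat_alg_def terms_def by blast
  show "mat_alg \<subseteq> rep ` \<F>"
    unfolding mat_alg_def
  proof (rule add_closure_minimal)
    show "terms \<subseteq> rep ` \<F>"
    proof
      fix M assume "M \<in> terms"
      then obtain c \<alpha> A \<beta> where M: "M = term_mat X c \<alpha> A \<beta>" "A \<in> \<U>"
        unfolding terms_def by blast
      have "M = rep (monom 0 c * (word_s \<alpha> * gen_p A * word_s_star \<beta>))"
        by (simp add: M rep_scale rep_monomial smat_mult_term_mat)
      thus "M \<in> rep ` \<F>"
        by (rule image_eqI) (intro carrier_free_algebra_mult carrier_free_algebra_consts gen_p_gens
            word_s_gens word_s_star_gens M)
    qed
    show "0 \<in> rep ` \<F>"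
      by (rule image_eqI[of _ _ 0]) (simp_all add: carrier_free_algebra_consts)
    show "x + y \<in> rep ` \<F>"
      if "x \<in> rep ` \<F>" "y \<in> rep ` \<F>"
      for x y :: "('a, 'r) orbit_matrix"
      using that by (auto simp: rep_add[symmetric] carrier_free_algebra_mult)
  qed
qed

lemma terms_mat_alg: "A \<in> \<U> \<Longrightarrow> term_mat X c \<alpha> A \<beta> \<in> mat_alg"
  unfolding mat_alg_def terms_def by (rule add_closure_incl) blast

lemma mat_alg_0: "0 \<in> mat_alg"
  and mat_alg_add: "a \<in> mat_alg \<Longrightarrow> b \<in> mat_alg \<Longrightarrow> a + b \<in> mat_alg"
  unfolding mat_alg_def by (auto intro: add_closure.zero add_closure_add)

lemma mat_alg_mult: "a \<in> mat_alg \<Longrightarrow> b \<in> mat_alg \<Longrightarrow> a * b \<in> mat_alg"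
  unfolding rep_image[symmetric] by (auto simp: rep_mult[symmetric] carrier_free_algebra_mult)

lemma proj_X_mult: "a \<in> mat_alg \<Longrightarrow> proj X * a = a"
  unfolding rep_image[symmetric] by (auto simp: rep_def proj_X_idem mult.assoc[symmetric])

text \<open>A term has entries only at positions
  \<open>(\<alpha> \<frown> z, \<beta> \<frown> z)\<close>, where its degree is a lag; sums create
  no new powers of t.\<close>

lemma mat_alg_lag:
  assumes "b \<in> mat_alg" "coeff (ent b x y) k \<noteq> 0"
  shows "lag x y k" "x \<in> X" "y \<in> X"
proof -
  have "\<forall>x y k. coeff (ent b x y) k \<noteq> 0 \<longrightarrow> lag x y k \<and> x \<in> X \<and> y \<in> X"
    using assms(1) unfolding mat_alg_def
  proof induction
    case (add t b)
    then obtain c \<alpha> A \<beta> where t: "t = term_mat X c \<alpha> A \<beta>" unfolding terms_def by blast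
    have "lag x y k \<and> x \<in> X \<and> y \<in> X" if "coeff (ent t x y) k \<noteq> 0" for x y k
      using that lag_conc unfolding t by (auto simp: ent_term_mat lookup_single when_def split: if_splits)
    thus ?case using add.IH by (metis add_0 ent_simps(2) lookup_add)
  qed simp
  thus "lag x y k" "x \<in> X" "y \<in> X" using assms(2) by blast+
qed

lemma mat_alg_entryE:
  assumes "b \<in> mat_alg" "ent b x y \<noteq> 0"
  obtains k where "lag x y k" "x \<in> X" "y \<in> X" "coeff (ent b x y) k \<noteq> 0"
proof -
  obtain k where "coeff (ent b x y) k \<noteq> 0"
    using assms(2) by (metis lookup_zero poly_mapping_eqI)
  thus thesis using mat_alg_lag[OF assms(1)] that by blast
qed

text \<open>Lags are unique in rows from \<open>Q_set X\<close>, so only one power of t can occur.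
  Nonzero entries there are thus units of the Laurent polynomials.\<close>

lemma mat_alg_entry_single:
  assumes "b \<in> mat_alg" "x \<in> Q_set X" "lag x y k"
  shows "ent b x y = monom k (coeff (ent b x y) k)"
proof (rule poly_mapping_eqI)
  fix l
  show "coeff (ent b x y) l =
      coeff (monom k (coeff (ent b x y) k)) l"
    using mat_alg_lag(1)[OF assms(1), of x y l] Q_set_lag_unique[OF assms(2,3), of l]
    by (cases "k = l") (auto simp: lookup_single)
qed

lemma mat_alg_row_finite:
  assumes "b \<in> mat_alg"
  shows "finite {y. ent b x y \<noteq> 0}"
  using assms unfolding mat_alg_def
proof induction
  case (add t b)
  then obtain c \<alpha> A \<beta> where t: "t = term_mat X c \<alpha> A \<beta>" unfolding terms_def by blast
  have "{y. ent (t + b) x y \<noteq> 0} \<subseteq> insert (\<beta> \<frown> suffix (length \<alpha>) x) {y. ent b x y \<noteq> 0}"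
    by (auto simp: t ent_term_mat split: if_splits)
  thus ?case using add.IH finite_subset by blast
qed simp

text \<open>With \<open>x = \<alpha> \<frown> z\<close> and \<open>y = \<beta> \<frown> z\<close>,
  the one-point set \<open>{z}\<close> is a relative range of \<open>{y}\<close>. The matrix unit is
  therefore a single term, and its words give its degree.\<close>

lemma unitm_termE:
  assumes "x \<in> X" "{y} \<in> \<U>" "lag x y k"
  obtains \<alpha> \<beta> z where "unitm x y (monom k r) = (term_mat X r \<alpha> {z} \<beta> :: ('a, 'r) orbit_matrix)" "{z} \<in> \<U>"
    "\<alpha> \<in> language X" "\<beta> \<in> language X" "k = deg \<alpha> \<beta>"
proof -
  obtain \<alpha> \<beta> z where z: "x = \<alpha> \<frown> z" "y = \<beta> \<frown> z" "k = deg \<alpha> \<beta>"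
    using assms(3) by (rule lagE)
  have y: "y \<in> X" using bool_alg_subset[OF assms(2)] by blast
  have "rng {y} \<beta> = {z}" using z by auto
  hence "{z} \<in> \<U>" using rng_bool_alg[OF assms(2)] by metis
  moreover have "unitm x y (monom k r) = term_mat X r \<alpha> {z} \<beta>"
    by (rule cmat_eqI) (use assms(1) y in \<open>auto simp: ent_unitm ent_term_mat z\<close>)
  moreover have "\<alpha> \<in> language X" "\<beta> \<in> language X" using assms(1) y z language_conc by blast+
  ultimately show thesis using that z(3) by blast
qed

lemma unitm_mat_alg:
  assumes "x \<in> X" "{y} \<in> \<U>" "lag x y k"
  shows "unitm x y (monom k r) \<in> mat_alg"
  using unitm_termE[OF assms, of r] terms_mat_alg by metis

section \<open>Left ideals of the matrix algebra and the span of matrix units\<close>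

definition lideal :: "('a, 'r) orbit_matrix set \<Rightarrow> bool" where
  "lideal L \<longleftrightarrow> L \<subseteq> mat_alg \<and> 0 \<in> L \<and> (\<forall>x\<in>L. \<forall>y\<in>L. x + y \<in> L) \<and> (\<forall>b\<in>mat_alg. \<forall>x\<in>L. b * x \<in> L)"

definition mlideal :: "('a, 'r) orbit_matrix set \<Rightarrow> bool" where
  "mlideal L \<longleftrightarrow> lideal L \<and> L \<noteq> {0} \<and> (\<forall>I. lideal I \<and> I \<subseteq> L \<longrightarrow> I = {0} \<or> I = L)"

lemma lidealD:
  assumes "lideal L"
  shows "x \<in> L \<Longrightarrow> x \<in> mat_alg" "0 \<in> L" "x \<in> L \<Longrightarrow> y \<in> L \<Longrightarrow> x + y \<in> L"
    "b \<in> mat_alg \<Longrightarrow> x \<in> L \<Longrightarrow> b * x \<in> L"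
  using assms unfolding lideal_def by blast+

lemma mlidealD: "mlideal L \<Longrightarrow> lideal L"
  unfolding mlideal_def by (rule conjunct1)

definition finitary_gens :: "('a, 'r) orbit_matrix set" where
  "finitary_gens = {unitm x y (monom k r) | x y k r. x \<in> Q_set X \<and> y \<in> Q_set X \<and> lag x y k}"

definition finitary :: "('a, 'r) orbit_matrix set" where
  "finitary = add_closure finitary_gens"

lemma lideal_principal:
  assumes "a \<in> mat_alg"
  shows "lideal ((\<lambda>b. b * a) ` mat_alg)"
proof -
  have "x + y \<in> (\<lambda>b. b * a) ` mat_alg" if xy: "x \<in> (\<lambda>b. b * a) ` mat_alg" "y \<in> (\<lambda>b. b * a) ` mat_alg" for x y
  proof -
    obtain b c where "x = b * a" "y = c * a" "b \<in> mat_alg" "c \<in> mat_alg" using xy by blast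
    thus ?thesis by (intro image_eqI[of _ _ "b + c"]) (simp_all add: distrib_right mat_alg_add)
  qed
  moreover have "d * x \<in> (\<lambda>b. b * a) ` mat_alg" if dx: "d \<in> mat_alg" "x \<in> (\<lambda>b. b * a) ` mat_alg" for d x
  proof -
    obtain b where "x = b * a" "b \<in> mat_alg" using dx by blast
    thus ?thesis using dx(1) by (intro image_eqI[of _ _ "d * b"]) (simp_all add: mult.assoc mat_alg_mult)
  qed
  moreover have "0 \<in> (\<lambda>b. b * a) ` mat_alg" by (rule image_eqI[of _ _ 0]) (simp_all add: mat_alg_0)
  ultimately show ?thesis using assms mat_alg_mult unfolding lideal_def by blast
qed

lemma mlideal_principal:
  assumes "mlideal L" "a \<in> L" "a \<noteq> 0"
  shows "L = (\<lambda>b. b * a) ` mat_alg"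
proof -
  have L: "lideal L" by (rule mlidealD[OF assms(1)])
  hence a: "a \<in> mat_alg" using assms(2) unfolding lideal_def by blast
  have "(\<lambda>b. b * a) ` mat_alg \<subseteq> L" using L assms(2) unfolding lideal_def by blast
  moreover have "a \<in> (\<lambda>b. b * a) ` mat_alg"
    by (rule image_eqI[of _ _ "proj X"]) (simp_all add: proj_X_mult[OF a] terms_mat_alg X_bool_alg)
  ultimately show ?thesis using assms(1,3) lideal_principal[OF a] unfolding mlideal_def by blast
qed

text \<open>Right translation of a minimal left ideal is a module homomorphism on a simple module.\<close>

lemma mlideal_translate:
  assumes L: "mlideal L" and b: "b \<in> mat_alg" and l: "l \<in> L" "l * b \<noteq> 0"
  shows "mlideal ((\<lambda>l. l * b) ` L)"
proof -
  let ?N = "(\<lambda>l. l * b) ` L"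
  have L': "lideal L" by (rule mlidealD[OF L])
  have N: "lideal ?N"
    unfolding lideal_def
  proof (intro conjI ballI)
    show "?N \<subseteq> mat_alg" using L' b mat_alg_mult unfolding lideal_def by blast
    show "0 \<in> ?N" using L' unfolding lideal_def by (intro image_eqI[of _ _ 0]) simp_all
    fix x y assume "x \<in> ?N" "y \<in> ?N"
    then obtain u v where "x = u * b" "y = v * b" "u \<in> L" "v \<in> L" by blast
    thus "x + y \<in> ?N" using L' unfolding lideal_def
      by (intro image_eqI[of _ _ "u + v"]) (simp_all add: distrib_right)
  next
    fix c x assume "c \<in> mat_alg" "x \<in> ?N"
    then obtain u where "x = u * b" "u \<in> L" by blast
    thus "c * x \<in> ?N" using L' \<open>c \<in> mat_alg\<close> unfolding lideal_def
      by (intro image_eqI[of _ _ "c * u"]) (simp_all add: mult.assoc)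
  qed
  have "I = {0} \<or> I = ?N" if I: "lideal I" "I \<subseteq> ?N" for I
  proof -
    define J where "J = {u \<in> L. u * b \<in> I}"
    have "lideal J"
      unfolding lideal_def
    proof (intro conjI ballI)
      show "J \<subseteq> mat_alg" using L' unfolding J_def lideal_def by blast
      show "0 \<in> J" using L' I unfolding J_def lideal_def by simp
      show "x + y \<in> J" if "x \<in> J" "y \<in> J" for x y
        using that L' I unfolding J_def lideal_def by (simp add: distrib_right)
      show "c * x \<in> J" if "c \<in> mat_alg" "x \<in> J" for c x
        using that L' I unfolding J_def lideal_def by (simp add: mult.assoc)
    qed
    hence "J = {0} \<or> J = L" using L unfolding mlideal_def J_def by blast
    moreover have "I = (\<lambda>l. l * b) ` J" using I(2) unfolding J_def by blast
    ultimately show ?thesis by auto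
  qed
  moreover have "?N \<noteq> {0}" using l by blast
  ultimately show ?thesis using N unfolding mlideal_def by blast
qed

lemma unitm_finitary:
  "x \<in> Q_set X \<Longrightarrow> y \<in> Q_set X \<Longrightarrow> lag x y k \<Longrightarrow> unitm x y (monom k r) \<in> finitary"
  unfolding finitary_def finitary_gens_def by (rule add_closure_incl) blast

lemma Q_set_bool_alg: "x \<in> Q_set X \<Longrightarrow> {x} \<in> \<U>"
  unfolding Q_set_iff by blast

lemma finitary_mat_alg: "finitary \<subseteq> mat_alg"
  unfolding finitary_def
  by (rule add_closure_minimal)
    (auto simp: finitary_gens_def mat_alg_0 mat_alg_add intro!: unitm_mat_alg dest: Q_set_subset Q_set_bool_alg)

lemma mat_alg_mult_finitary:
  assumes "b \<in> mat_alg" "f \<in> finitary"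
  shows "b * f \<in> finitary"
  using assms(2) unfolding finitary_def
proof (rule add_closure_mult_left)
  fix g assume "g \<in> finitary_gens"
  then obtain x y k r where g: "g = unitm x y (monom k r)" "x \<in> Q_set X" "y \<in> Q_set X" "lag x y k"
    unfolding finitary_gens_def by blast
  have "unitm w y (ent b w x * monom k r) \<in> finitary" if w: "ent b w x \<noteq> 0" for w
  proof -
    obtain l where l: "lag w x l" "w \<in> X" using mat_alg_entryE[OF assms(1) w] by blast
    have wQ: "w \<in> Q_set X" using Q_set_lag[OF g(2) l(2,1)] .
    have "ent b w x * monom k r = monom (l + k) (coeff (ent b w x) l * r)"
      by (subst mat_alg_entry_single[OF assms(1) wQ l(1)]) (simp add: mult_single)
    thus ?thesis using unitm_finitary[OF wQ g(3) lag_trans[OF l(1) g(4)]] by simp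
  qed
  thus "b * g \<in> add_closure finitary_gens"
    unfolding g mult_unitm_sum finitary_def[symmetric] by (subst finitary_def, intro add_closure_sum)
      (simp add: finitary_def[symmetric])
qed

lemma unitm_mult_finitary:
  assumes "x \<in> Q_set X" "b \<in> mat_alg"
  shows "unitm x x 1 * b \<in> finitary"
proof -
  have "unitm x w (1 * ent b x w) \<in> finitary" if w: "ent b x w \<noteq> 0" for w
  proof -
    obtain l where l: "lag x w l" "w \<in> X" using mat_alg_entryE[OF assms(2) w] by blast
    have wQ: "w \<in> Q_set X" using Q_set_lag[OF assms(1) l(2) lag_sym[OF l(1)]] .
    show ?thesis
      by (subst mat_alg_entry_single[OF assms(2,1) l(1)])
        (simp add: unitm_finitary[OF assms(1) wQ l(1)])
  qed
  thus ?thesis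
    unfolding unitm_mult_sum[OF mat_alg_row_finite[OF assms(2)]]
    by (subst finitary_def, intro add_closure_sum) (simp add: finitary_def[symmetric])
qed

lemma unitm_1_mat_alg: "{x} \<in> \<U> \<Longrightarrow> unitm x x 1 \<in> mat_alg"
  using unitm_mat_alg[of x x 0 1] bool_alg_subset lag_refl by fastforce

text \<open>A nonzero element of this column has a nonzero entry in some row of
  \<open>Q_set X\<close>. That entry is a unit, so a suitable matrix unit turns the element back
  into the generator of the column.\<close>

lemma mlideal_column:
  assumes "x \<in> Q_set X"
  shows "mlideal ((\<lambda>b. b * unitm x x 1) ` mat_alg)"
proof -
  let ?e = "unitm x x 1 :: ('a, 'r) orbit_matrix" and ?L = "(\<lambda>b. b * unitm x x 1) ` mat_alg"
  have e: "?e \<in> mat_alg" by (intro unitm_1_mat_alg Q_set_bool_alg assms)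
  have ee: "?e * ?e = ?e" by (simp add: unitm_mult_unitm)
  have eL: "?e \<in> ?L" using e ee by force
  have ne: "?e \<noteq> 0" by (rule cmat_neq_0I[of _ x x]) (simp add: ent_unitm)
  have "I = {0} \<or> I = ?L" if I: "lideal I" "I \<subseteq> ?L" for I
  proof (cases "I \<subseteq> {0}")
    case True
    thus ?thesis using I unfolding lideal_def by blast
  next
    case False
    then obtain m where m: "m \<in> I" "m \<noteq> 0" by blast
    have mm: "m \<in> mat_alg" using m I unfolding lideal_def by blast
    have me: "m * ?e = m"
      using m(1) I(2) by (auto simp: mult.assoc ee)
    have col: "ent m u w = 0" if "w \<noteq> x" for u w
      using arg_cong[OF me, of "\<lambda>m. ent m u w"] that by (simp add: ent_mult_unitm)
    obtain u where u: "ent m u x \<noteq> 0"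
      using m(2) col by (metis cmat_eqI zero_cmat.rep_eq)
    obtain k where k: "lag u x k" "u \<in> X" "coeff (ent m u x) k \<noteq> 0"
      using mat_alg_entryE[OF mm u] by blast
    have uQ: "u \<in> Q_set X" using Q_set_lag[OF assms k(2,1)] .
    define r where "r = coeff (ent m u x) k"
    have er: "ent m u x = monom k r"
      unfolding r_def by (rule mat_alg_entry_single[OF mm uQ k(1)])
    \<comment> \<open>The inverse of the monomial \<open>ent m u x\<close>, placed so that row
      \<open>u\<close> is moved to row \<open>x\<close>.\<close>
    let ?b = "unitm x u (monom (- k) (1 / r))"
    have "?b \<in> mat_alg"
      by (intro unitm_mat_alg Q_set_bool_alg uQ lag_sym k Q_set_subset assms)
    moreover have "?b * m = ?e"
      using k(3) by (intro cmat_eqI) (auto simp: ent_unitm_mult ent_unitm er col mult_single r_def[symmetric])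
    ultimately have "?e \<in> I" using I(1) m(1) unfolding lideal_def by metis
    hence "?L \<subseteq> I" using I(1) unfolding lideal_def by blast
    thus ?thesis using I(2) by blast
  qed
  moreover have "?L \<noteq> {0}" using eL ne by blast
  ultimately show ?thesis using lideal_principal[OF e] unfolding mlideal_def by blast
qed

text \<open>A minimal left ideal is generated by any of its nonzero elements. Cutting
  \<open>l\<close> to the row \<open>x\<close> gives a finite sum of matrix units, and
  \<open>finitary\<close> absorbs left multiplication.\<close>

lemma mlideal_subset_finitary:
  assumes "mlideal L" "l \<in> L" "x \<in> Q_set X" "unitm x x 1 * l \<noteq> 0"
  shows "L \<subseteq> finitary"
proof -
  have L: "lideal L" by (rule mlidealD[OF assms(1)])
  have "unitm x x 1 * l \<in> L"
    using L assms(2) unitm_1_mat_alg[OF Q_set_bool_alg[OF assms(3)]] unfolding lideal_def by blast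
  hence "L = (\<lambda>b. b * (unitm x x 1 * l)) ` mat_alg" using mlideal_principal assms(1,4) by blast
  moreover have "unitm x x 1 * l \<in> finitary"
    using unitm_mult_finitary[OF assms(3)] L assms(2) unfolding lideal_def by blast
  ultimately show ?thesis using mat_alg_mult_finitary by blast
qed

section \<open>Minimal left ideals and isolated points\<close>

text \<open>The corner at an isolated ultimately periodic point consists of Laurent polynomials, and
  multiplication by the nonunit \<open>1 + t\<^sup>d\<close> produces smaller left ideals.\<close>

lemma mlideal_isolated:
  assumes L: "mlideal L" "f \<in> L" and v: "{v} \<in> \<U>" "ent f v v \<noteq> 0"
  shows "v \<in> Q_set X"
proof (rule ccontr)
  assume "v \<notin> Q_set X"
  then obtain i j where ij: "i \<noteq> j" "suffix i v = suffix j v"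
    using v(1) unfolding Q_set_iff ultimately_periodic_def by blast
  define d where "d = int i - int j"
  have d: "d \<noteq> 0" "lag v v d" using ij unfolding d_def lag_def by auto
  let ?e = "unitm v v 1 :: ('a, 'r) orbit_matrix"
  let ?u = "?e + unitm v v (monom d 1)"
  have vX: "v \<in> X" using bool_alg_subset[OF v(1)] by blast
  have e: "?e \<in> mat_alg" by (rule unitm_1_mat_alg[OF v(1)])
  have u: "?u \<in> mat_alg" by (intro mat_alg_add e unitm_mat_alg vX v d)
  define c where "c = ent f v v"
  have fe: "f * ?e \<noteq> 0" by (rule cmat_neq_0I[of _ v v]) (simp add: v ent_mult_unitm)
  define N where "N = (\<lambda>l. l * ?e) ` L"
  have N: "mlideal N" unfolding N_def by (rule mlideal_translate[OF L(1) e L(2) fe])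
  hence N': "lideal N" by (rule mlidealD)
  have feN: "f * ?e \<in> N" unfolding N_def using L(2) by blast
  have "?e * (f * ?e) \<in> N" using N' e feN unfolding lideal_def by blast
  hence gN: "unitm v v c \<in> N" unfolding mult.assoc[symmetric] unitm_corner c_def .
  \<comment> \<open>Minimality puts the matrix unit with entry \<open>c\<close> into the left ideal
    generated by the one with entry \<open>?q\<close>. Cancelling \<open>c\<close>, as the Laurent
    polynomials have no zero divisors, would invert \<open>1 + monom d 1\<close>.\<close>
  let ?q = "(1 + monom d 1) * c"
  have ug: "?u * unitm v v c = unitm v v ?q"
    by (simp add: distrib_right unitm_mult_unitm) (rule cmat_eqI, simp add: ent_unitm)
  have ugN: "unitm v v ?q \<in> N" unfolding ug[symmetric] using N' u gN unfolding lideal_def by blast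
  have "1 + monom d 1 \<noteq> (0 :: int \<Rightarrow>\<^sub>0 'r)"
  proof
    assume "1 + monom d 1 = (0 :: int \<Rightarrow>\<^sub>0 'r)"
    hence "coeff (1 + monom d 1) 0 = coeff (0 :: int \<Rightarrow>\<^sub>0 'r) 0" by simp
    thus False using d(1) by (simp add: lookup_add lookup_one lookup_single)
  qed
  hence q: "?q \<noteq> 0" using v(2) unfolding c_def by simp
  hence "unitm v v ?q \<noteq> 0" by (intro cmat_neq_0I[of _ v v]) (simp add: ent_unitm)
  hence "unitm v v c \<in> (\<lambda>b. b * unitm v v ?q) ` mat_alg"
    using mlideal_principal[OF N ugN] gN by simp
  then obtain b where "unitm v v c = b * unitm v v ?q" by blast
  hence "ent (unitm v v c) v v = ent (b * unitm v v ?q) v v" by simp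
  hence "c = ent b v v * ((1 + monom d 1) * c)" by (simp add: ent_unitm ent_mult_unitm)
  hence "(ent b v v * (1 + monom d 1)) * c = 1 * c" by (simp add: mult.assoc)
  hence "ent b v v * (1 + monom d 1) = 1" using v(2) unfolding c_def mult_cancel_right by blast
  thus False using not_unit_one_plus_monomial[OF d(1)] by blast
qed

text \<open>Constant terms on the diagonal come only from terms with
  \<open>\<alpha> = \<beta>\<close>: different words of equal length never meet the diagonal, and
  unequal lengths give other powers of t. For \<open>\<alpha> = \<beta>\<close> the diagonal is a
  multiple of the indicator of \<open>ext \<alpha> A\<close>, a member of
  \<open>\<U>\<close>.\<close>

lemma mat_alg_diag_locally_constant:
  assumes "f \<in> mat_alg" "z \<in> X"
  shows "\<exists>C\<in>\<U>. z \<in> C \<and>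
    (\<forall>v\<in>C. coeff (ent f v v) 0 = coeff (ent f z z) 0)"
  using assms(1) unfolding mat_alg_def
proof induction
  case zero
  show ?case using assms(2) X_bool_alg by (intro bexI[of _ X]) auto
next
  case (add t f)
  then obtain c \<alpha> A \<beta> where t: "t = term_mat X c \<alpha> A \<beta>" "A \<in> \<U>" unfolding terms_def by blast
  obtain C where C: "C \<in> \<U>" "z \<in> C"
    "\<And>v. v \<in> C \<Longrightarrow> coeff (ent f v v) 0 = coeff (ent f z z) 0"
    using add.IH by blast
  have "\<exists>D\<in>\<U>. z \<in> D \<and> (\<forall>v\<in>D. coeff (ent t v v) 0 = coeff (ent t z z) 0)"
  proof (cases "\<alpha> = \<beta>")
    case True
    define D where "D = (if z \<in> ext \<alpha> A then ext \<alpha> A else X - ext \<alpha> A)"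
    have "v \<in> ext \<alpha> A \<longleftrightarrow> v \<in> X \<and> (\<exists>z\<in>A. v = \<alpha> \<frown> z)" for v by (auto simp: ext_def)
    hence l: "coeff (ent t v v) 0 = (if v \<in> ext \<alpha> A then c else 0)" for v
      unfolding t True ent_term_mat by auto
    have "D \<in> \<U>" unfolding D_def using ext_bool_alg[OF t(2)] by (simp add: bool_alg.compl)
    moreover have "z \<in> D" using assms(2) by (simp add: D_def)
    moreover have "coeff (ent t v v) 0 = coeff (ent t z z) 0" if "v \<in> D" for v
      unfolding l using that by (auto simp: D_def split: if_splits)
    ultimately show ?thesis by blast
  next
    case False
    have "coeff (ent t v v) 0 = 0" for v
      using False unfolding t ent_term_mat by (cases "length \<alpha> = length \<beta>") (auto simp: lookup_single)
    thus ?thesis using assms(2) X_bool_alg by (intro bexI[of _ X]) auto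
  qed
  then obtain D where D: "D \<in> \<U>" "z \<in> D"
    "\<And>v. v \<in> D \<Longrightarrow> coeff (ent t v v) 0 = coeff (ent t z z) 0" by blast
  have "coeff (ent (t + f) v v) 0 = coeff (ent (t + f) z z) 0"
    if "v \<in> C \<inter> D" for v
    using C(3)[of v] D(3)[of v] that by (simp add: lookup_add)
  moreover have "C \<inter> D \<in> \<U>" "z \<in> C \<inter> D" using C D by (simp_all add: bool_alg.inter)
  ultimately show ?case by blast
qed

text \<open>Suppose entries survive in every neighbourhood of \<open>v\<close>. Then
  \<open>v\<close> starts with both words, shrinking cylinders force the two remainders to agree,
  and the common remainder lies in \<open>A\<close>. So \<open>(v, v)\<close> is a position of the
  term, and its zero entry means \<open>c = 0\<close>.\<close>

lemma term_mat_isolated: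
  assumes t: "t = term_mat X c \<alpha> A \<beta>" "A \<in> \<U>" and v: "v \<in> X" "ent t v v = 0"
  shows "c = 0 \<or> (\<exists>C\<in>\<U>. v \<in> C \<and> (\<forall>x\<in>C. \<forall>y\<in>C. ent t x y = 0))"
proof (rule disjCI)
  assume neg: "\<not> (\<exists>C\<in>\<U>. v \<in> C \<and> (\<forall>x\<in>C. \<forall>y\<in>C. ent t x y = 0))"
  have *: "\<not> (\<forall>x\<in>C. \<forall>y\<in>C. ent t x y = 0)" if "C \<in> \<U>" "v \<in> C" for C using neg that by blast
  have pre: "\<exists>w. v = \<gamma> \<frown> w" if \<gamma>: "\<gamma> \<in> {\<alpha>, \<beta>}" for \<gamma>
  proof (rule ccontr)
    assume "\<nexists>w. v = \<gamma> \<frown> w"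
    hence "v \<in> X - C_set X [] \<gamma>" using v(1) by (auto simp: C_set_Nil_left)
    moreover have "\<forall>x\<in>X - C_set X [] \<gamma>. \<forall>y\<in>X - C_set X [] \<gamma>. ent t x y = 0"
      using \<gamma> by (auto simp: t ent_term_mat C_set_Nil_left)
    ultimately show False using * bool_alg.compl[OF C_set_bool_alg] by blast
  qed
  obtain w w' where w: "v = \<alpha> \<frown> w" and w': "v = \<beta> \<frown> w'" using pre by blast
  have "w = w'"
  proof
    fix j
    \<comment> \<open>Long enough for the cylinder to fix the letters at both positions
      \<open>length \<alpha> + j\<close> and \<open>length \<beta> + j\<close>.\<close>
    define n where "n = Suc (length \<alpha> + length \<beta> + j)"
    have "v \<in> cylinder n v" using v(1) by (simp add: in_cylinder)
    then obtain x y where xy: "x \<in> cylinder n v" "y \<in> cylinder n v" "ent t x y \<noteq> 0"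
      using *[OF cylinder_bool_alg] by blast
    then obtain u where u: "x = \<alpha> \<frown> u" "y = \<beta> \<frown> u"
      unfolding t ent_term_mat by (auto split: if_splits)
    have "x (length \<alpha> + j) = v (length \<alpha> + j)" "y (length \<beta> + j) = v (length \<beta> + j)"
      using xy(1,2) by (simp_all add: in_cylinder n_def)
    thus "w j = w' j" unfolding u using w w' by (metis conc_snd add_diff_cancel_left' not_add_less1)
  qed
  have "w \<in> A"
  proof (rule ccontr)
    assume "w \<notin> A"
    hence "v \<in> X - ext \<alpha> A" using v(1) by (auto simp: w ext_def)
    moreover have "\<forall>x\<in>X - ext \<alpha> A. \<forall>y\<in>X - ext \<alpha> A. ent t x y = 0"
      by (auto simp: t ent_term_mat ext_def)
    ultimately show False using * bool_alg.compl[OF ext_bool_alg[OF t(2)]] by blast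
  qed
  hence "v \<in> X \<and> v \<in> X \<and> (\<exists>z\<in>A. v = \<alpha> \<frown> z \<and> v = \<beta> \<frown> z)" using w w' v(1) \<open>w = w'\<close> by blast
  hence "monom (deg \<alpha> \<beta>) c = 0"
    using v(2) unfolding t ent_term_mat by simp
  thus "c = 0" by (metis lookup_single_eq lookup_zero)
qed

text \<open>Compressed to a small neighbourhood of \<open>v\<close>, such a matrix is a scalar and,
  if nonzero, can be inverted there.\<close>

definition locally_diagonal :: "('a, 'r) orbit_matrix \<Rightarrow> 'a word \<Rightarrow> bool" where
  "locally_diagonal f v \<longleftrightarrow> (\<exists>c. ent f v v = monom 0 c \<and>
    (\<exists>C\<in>\<U>. v \<in> C \<and> (\<forall>x\<in>C. \<forall>y\<in>C. ent f x y = (if x = y then monom 0 c else 0))))"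

text \<open>A term contributes at most one exceptional point, a solution of
  \<open>\<alpha> \<frown> z = \<beta> \<frown> z\<close> with words of different lengths. At other
  points a nonzero diagonal entry forces \<open>\<alpha> = \<beta>\<close>, and a zero one is
  handled by \<open>term_mat_isolated\<close>.\<close>

lemma mat_alg_locally_diagonal:
  assumes "f \<in> mat_alg"
  shows "\<exists>N. finite N \<and> (\<forall>v\<in>X - N. locally_diagonal f v)"
  using assms unfolding mat_alg_def
proof induction
  case zero
  show ?case unfolding locally_diagonal_def using X_bool_alg
    by (intro exI[of _ "{}"]) (auto intro!: exI[of _ 0])
next
  case (add t f)
  then obtain c \<alpha> A \<beta> where t: "t = term_mat X c \<alpha> A \<beta>" "A \<in> \<U>" unfolding terms_def by blast
  obtain N where N: "finite N" "\<And>v. v \<in> X - N \<Longrightarrow> locally_diagonal f v"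
    using add.IH by blast
  define M where "M = {v. length \<alpha> \<noteq> length \<beta> \<and> ent t v v \<noteq> 0}"
  have "finite M"
  proof (rule finite_subset)
    have "v = v'" if vv: "v \<in> M" "v' \<in> M" for v v'
    proof -
      have "length \<alpha> \<noteq> length \<beta> \<and> (\<exists>z. v = \<alpha> \<frown> z \<and> v = \<beta> \<frown> z)" if "v \<in> M" for v
        using that unfolding M_def t ent_term_mat by (simp split: if_splits) blast
      then obtain z z' where z: "v = \<alpha> \<frown> z" "v = \<beta> \<frown> z" "v' = \<alpha> \<frown> z'" "v' = \<beta> \<frown> z'" "length \<alpha> \<noteq> length \<beta>"
        using vv by meson
      hence "z = z'" using conc_fixed_unique[of \<alpha> z \<beta> z'] conc_fixed_unique[of \<beta> z \<alpha> z']
        by (metis nat_neq_iff)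
      thus ?thesis using z by simp
    qed
    \<comment> \<open>\<open>M\<close> has at most one element, so any choice exhausts it.\<close>
    thus "M \<subseteq> {SOME v. v \<in> M}" by (metis singletonI someI subsetI)
  qed simp
  have T: "locally_diagonal t v"
    if v: "v \<in> X" "v \<notin> M" for v
  proof (cases "ent t v v = 0")
    case True
    have "\<exists>C\<in>\<U>. v \<in> C \<and> (\<forall>x\<in>C. \<forall>y\<in>C. ent t x y = 0)"
    proof (cases "c = 0")
      case True
      thus ?thesis using X_bool_alg v(1) by (intro bexI[of _ X]) (simp_all add: t(1))
    next
      case False
      thus ?thesis using term_mat_isolated[OF t v(1) True] by blast
    qed
    then obtain C where "C \<in> \<U>" "v \<in> C" "\<And>x y. x \<in> C \<Longrightarrow> y \<in> C \<Longrightarrow> ent t x y = 0" by blast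
    thus ?thesis using True unfolding locally_diagonal_def
      by (intro exI[of _ 0] conjI bexI[of _ C] ballI) simp_all
  next
    case False
    hence len: "length \<alpha> = length \<beta>" using v(2) by (simp add: M_def)
    obtain z where z: "z \<in> A" "v = \<alpha> \<frown> z" "v = \<beta> \<frown> z"
      using False unfolding t ent_term_mat by (auto split: if_splits)
    have ab: "\<alpha> = \<beta>" using z len by (metis concat_eq)
    have "v \<in> ext \<alpha> A" using z v(1) by (auto simp: ext_def)
    moreover have "ent t x y = (if x = y then monom 0 c else 0)"
      if "x \<in> ext \<alpha> A" "y \<in> ext \<alpha> A" for x y
      using that unfolding t ent_term_mat ab by (auto simp: ext_def)
    ultimately show ?thesis using ext_bool_alg[OF t(2), of \<alpha>] unfolding locally_diagonal_def
      by (intro exI[of _ c] conjI bexI[of _ "ext \<alpha> A"] ballI) simp_all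
  qed
  show ?case
  proof (intro exI[of _ "N \<union> M"] conjI ballI)
    show "finite (N \<union> M)" using N(1) \<open>finite M\<close> by simp
    fix v assume v: "v \<in> X - (N \<union> M)"
    obtain c C where C: "C \<in> \<U>" "v \<in> C" "ent f v v = monom 0 c"
      "\<And>x y. x \<in> C \<Longrightarrow> y \<in> C \<Longrightarrow> ent f x y = (if x = y then monom 0 c else 0)"
      using N(2)[of v] v unfolding locally_diagonal_def by blast
    obtain d D where D: "D \<in> \<U>" "v \<in> D" "ent t v v = monom 0 d"
      "\<And>x y. x \<in> D \<Longrightarrow> y \<in> D \<Longrightarrow> ent t x y = (if x = y then monom 0 d else 0)"
      using T[of v] v unfolding locally_diagonal_def by blast
    show "locally_diagonal (t + f) v"
      unfolding locally_diagonal_def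
      using C D by (intro exI[of _ "d + c"] conjI bexI[of _ "C \<inter> D"])
        (auto simp: single_add intro: bool_alg.inter)
  qed
qed

text \<open>If \<open>z\<close> is isolated, \<open>mlideal_isolated\<close> applies to it.
  Otherwise a nearby \<open>v\<close> is found at which \<open>f\<close> is locally a nonzero
  scalar, and minimality shows that \<open>v\<close> is isolated.\<close>

lemma mlideal_meets_Q_diag:
  assumes L: "mlideal L" "f \<in> L" and z: "z \<in> X" "coeff (ent f z z) 0 \<noteq> 0"
  shows "\<exists>x\<in>Q_set X. \<exists>l\<in>L. unitm x x 1 * l \<noteq> 0"
proof -
  have isolated: ?thesis if v: "{v} \<in> \<U>" "ent f v v \<noteq> 0" for v
  proof -
    have "v \<in> Q_set X" by (rule mlideal_isolated[OF L v])
    moreover have "unitm v v 1 * f \<noteq> 0"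
      by (rule cmat_neq_0I[of _ v v]) (simp add: v ent_unitm_mult)
    ultimately show ?thesis using L(2) by (intro bexI[of _ v] bexI[of _ f])
  qed
  have f: "f \<in> mat_alg" by (rule lidealD(1)[OF mlidealD[OF L(1)] L(2)])
  show ?thesis
  proof (cases "{z} \<in> \<U>")
    case True
    thus ?thesis using isolated z(2) by force
  next
    case False
    obtain C where C: "C \<in> \<U>" "z \<in> C"
      "\<And>v. v \<in> C \<Longrightarrow> coeff (ent f v v) 0 = coeff (ent f z z) 0"
      using mat_alg_diag_locally_constant[OF f z(1)] by blast
    obtain N where N: "finite N" "\<And>v. v \<in> X - N \<Longrightarrow> locally_diagonal f v"
      using mat_alg_locally_diagonal[OF f] by blast
    \<comment> \<open>A finite neighbourhood would isolate \<open>z\<close>. Being infinite,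
      \<open>C\<close> contains a point outside the exceptional set \<open>N\<close>.\<close>
    have "infinite C" using finite_singleton_bool_alg C(1,2) False by blast
    hence "\<not> C \<subseteq> N" using N(1) finite_subset by blast
    then obtain v where v: "v \<in> C" "v \<notin> N" by blast
    have vX: "v \<in> X" using v(1) bool_alg_subset C(1) by blast
    obtain c D where D: "ent f v v = monom 0 c" "D \<in> \<U>" "v \<in> D"
      "\<And>x y. x \<in> D \<Longrightarrow> y \<in> D \<Longrightarrow> ent f x y = (if x = y then monom 0 c else 0)"
      using N(2)[of v] v(2) vX unfolding locally_diagonal_def by blast
    have c: "c \<noteq> 0" using C(3)[OF v(1)] z(2) D(1) by auto
    have nz: "ent f v v \<noteq> 0" using C(3)[OF v(1)] z(2) by auto
    have fD: "f * proj D \<noteq> 0" by (rule cmat_neq_0I[of _ v v]) (simp add: nz D(3) vX)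
    define N' where "N' = (\<lambda>l. l * proj D) ` L"
    have N': "mlideal N'"
      unfolding N'_def by (rule mlideal_translate[OF L(1) terms_mat_alg[OF D(2)] L(2) fD])
    hence N'l: "lideal N'" by (rule mlidealD)
    have DX: "x \<in> X" if "x \<in> D" for x using bool_alg_subset[OF D(2)] that by blast
    \<comment> \<open>Right translation by \<open>proj D\<close> restricts the columns to
      \<open>D\<close>; the left factor restricts the rows and divides by the scalar
      \<open>c\<close>.\<close>
    have "term_mat X (1 / c) [] D [] * (f * proj D) = proj D"
    proof (rule cmat_eqI)
      fix x y
      show "ent (term_mat X (1 / c) [] D [] * (f * proj D)) x y = ent (proj D) x y"
        using D(4)[of x y] c DX
        by (auto simp: ent_term_mat_mult[of X "1 / c"] Let_def ent_proj mult_single)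
    qed
    moreover have "f * proj D \<in> N'" unfolding N'_def using L(2) by blast
    ultimately have pD: "proj D \<in> N'"
      using N'l terms_mat_alg[OF D(2), of "1 / c" "[]" "[]"] unfolding lideal_def by metis
    \<comment> \<open>A second point \<open>w\<close> would be separated from \<open>v\<close> by
      some \<open>E\<close>. The nonzero \<open>proj (E \<inter> D)\<close> would then generate the
      ideal, but all its left multiples vanish in column \<open>w\<close>.\<close>
    have "w = v" if w: "w \<in> D" for w
    proof (rule ccontr)
      assume "w \<noteq> v"
      then obtain E where E: "E \<in> \<U>" "v \<in> E" "w \<notin> E" using separation[OF vX] by blast
      have "proj (E \<inter> D) = proj E * proj D"
        by (rule cmat_eqI) (auto simp: ent_proj)
      hence "proj (E \<inter> D) \<in> N'" using pD N'l terms_mat_alg[OF E(1)] unfolding lideal_def by metis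
      moreover have "proj (E \<inter> D) \<noteq> (0 :: ('a, 'r) orbit_matrix)"
        by (rule cmat_neq_0I[of _ v v]) (simp add: ent_proj E D(3) vX)
      ultimately have "proj D \<in> (\<lambda>b. b * proj (E \<inter> D)) ` mat_alg"
        using mlideal_principal[OF N'] pD by metis
      then obtain b :: "('a, 'r) orbit_matrix" where "proj D = b * proj (E \<inter> D)" by blast
      hence "ent (proj D :: ('a, 'r) orbit_matrix) w w = ent (b * proj (E \<inter> D)) w w" by simp
      thus False using w E(3) DX by (simp add: ent_proj)
    qed
    hence "D = {v}" using D(3) by blast
    thus ?thesis using isolated D(2) nz by blast
  qed
qed

lemma mlideal_meets_Q:
  assumes L: "mlideal L"
  shows "\<exists>x\<in>Q_set X. \<exists>l\<in>L. unitm x x 1 * l \<noteq> 0"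
proof -
  have L': "lideal L" by (rule mlidealD[OF L])
  have "L \<noteq> {0}" using L unfolding mlideal_def by blast
  then obtain f where f: "f \<in> L" "f \<noteq> 0" using lidealD(2)[OF L'] by blast
  have fm: "f \<in> mat_alg" by (rule lidealD(1)[OF L' f(1)])
  obtain x y where "ent f x y \<noteq> 0" using f(2) by (metis cmat_eqI zero_cmat.rep_eq)
  then obtain k where k: "lag x y k" "x \<in> X" "y \<in> X" "coeff (ent f x y) k \<noteq> 0"
    using mat_alg_entryE[OF fm] by blast
  obtain \<alpha> \<beta> z where z: "x = \<alpha> \<frown> z" "y = \<beta> \<frown> z" "k = deg \<alpha> \<beta>"
    using k(1) by (rule lagE)
  have zX: "z \<in> X" using conc_in_X k(2) z(1) by blast
  let ?S = "term_mat X 1 \<beta> X [] :: ('a, 'r) orbit_matrix"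
  let ?g = "term_mat X 1 [] X \<alpha> * (f * ?S)"
  have S: "?S \<in> mat_alg" by (intro terms_mat_alg X_bool_alg)
  \<comment> \<open>The two powers of t add up to \<open>- k\<close>, so the coefficient of
    \<open>f\<close> at \<open>k\<close> becomes the constant term.\<close>
  have g: "ent ?g z z = monom (- int (length \<alpha>)) 1
      * (monom (int (length \<beta>)) 1 * ent f x y)"
    using k zX by (simp add: ent_term_mat_mult ent_mult_term_mat Let_def z)
  have g0: "coeff (ent ?g z z) 0 \<noteq> 0"
    unfolding g lookup_single_mult using k(4) by (simp add: z(3))
  have ne: "f * ?S \<noteq> 0" using g0 by auto
  have N: "mlideal ((\<lambda>l. l * ?S) ` L)" by (rule mlideal_translate[OF L S f(1) ne])
  have "f * ?S \<in> (\<lambda>l. l * ?S) ` L" using f(1) by blast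
  hence "?g \<in> (\<lambda>l. l * ?S) ` L"
    by (rule lidealD(4)[OF mlidealD[OF N] terms_mat_alg[OF X_bool_alg]])
  from mlideal_meets_Q_diag[OF N this zX g0]
  obtain q l where ql: "q \<in> Q_set X" "l \<in> L" "unitm q q 1 * (l * ?S) \<noteq> 0" by blast
  have "unitm q q 1 * l \<noteq> 0"
  proof
    assume "unitm q q 1 * l = 0"
    hence "unitm q q 1 * (l * ?S) = 0" by (simp add: mult.assoc[symmetric])
    thus False using ql(3) by blast
  qed
  thus ?thesis using ql by blast
qed

theorem socle_mat_alg: "add_closure (\<Union>{L. mlideal L}) = finitary"
proof
  show "add_closure (\<Union>{L. mlideal L}) \<subseteq> finitary"
  proof (rule add_closure_minimal)
    show "\<Union>{L. mlideal L} \<subseteq> finitary"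
      using mlideal_meets_Q mlideal_subset_finitary by blast
  qed (auto simp: finitary_def intro: add_closure.zero add_closure_add)
  show "finitary \<subseteq> add_closure (\<Union>{L. mlideal L})"
    unfolding finitary_def
  proof (rule add_closure_mono, rule)
    fix g assume "g \<in> finitary_gens"
    then obtain x y k r where g: "g = unitm x y (monom k r)" "x \<in> Q_set X" "y \<in> Q_set X" "lag x y k"
      unfolding finitary_gens_def by blast
    have "g \<in> mat_alg" unfolding g by (intro unitm_mat_alg Q_set_subset Q_set_bool_alg g)
    moreover have "g = g * unitm y y 1" by (simp add: g unitm_mult_unitm)
    ultimately have "g \<in> (\<lambda>b. b * unitm y y 1) ` mat_alg" by blast
    thus "g \<in> add_closure (\<Union>{L. mlideal L})"
      using mlideal_column[OF g(3)] by (intro add_closure_incl) blast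
  qed
qed

section \<open>Transfer to the subshift algebra\<close>


abbreviation free_alg :: "('a gen fmon \<Rightarrow>\<^sub>0 'r) ring" where
  "free_alg \<equiv> free_algebra (gens X)"

abbreviation alg :: "('r, ('a gen fmon \<Rightarrow>\<^sub>0 'r) set) module" where
  "alg \<equiv> subshift_algebra X"

lemma alg_sel:
  "carrier alg = carrier (free_alg Quot relation_ideal X)"
  "mult alg = mult (free_alg Quot relation_ideal X)"
  "add alg = add (free_alg Quot relation_ideal X)"
  "zero alg = zero (free_alg Quot relation_ideal X)"
  "smult alg = (\<lambda>r x. coset_of X (monom 0 r) \<otimes>\<^bsub>free_alg Quot relation_ideal X\<^esub> x)"
  by (simp_all add: subshift_algebra_def Let_def ring.defs module.defs)

lemma coset_hom: "coset_of X \<in> ring_hom free_alg (free_alg Quot relation_ideal X)"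
  using ideal.rcos_ring_hom[OF relation_ideal] unfolding coset_of_def[abs_def] .

lemma alg_carrier: "carrier alg = coset_of X ` carrier free_alg"
  unfolding alg_sel FactRing_def A_RCOSETS_def' coset_of_def[abs_def] by auto

lemma alg_ops:
  assumes "f \<in> carrier free_alg" "g \<in> carrier free_alg"
  shows "coset_of X f \<oplus>\<^bsub>alg\<^esub> coset_of X g = coset_of X (f + g)"
    "coset_of X f \<otimes>\<^bsub>alg\<^esub> coset_of X g = coset_of X (f * g)"
    "r \<odot>\<^bsub>alg\<^esub> coset_of X f = coset_of X (monom 0 r * f)"
  using ring_hom_add[OF coset_hom assms] ring_hom_mult[OF coset_hom assms]
    ring_hom_mult[OF coset_hom carrier_free_algebra_consts(3) assms(1), of r]
  by (simp_all add: alg_sel free_algebra_simps(2,5))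

lemma coset_of_eq: "coset_of X f = {i + f | i. i \<in> relation_ideal X}"
  unfolding coset_of_def a_r_coset_def r_coset_def by (auto simp: free_algebra_simps)

lemma alg_zero: "\<zero>\<^bsub>alg\<^esub> = coset_of X 0"
  by (simp add: alg_sel FactRing_def coset_of_eq)

lemma alg_abelian: "abelian_group alg"
proof -
  interpret Q: ring "free_alg Quot relation_ideal X"
    by (rule ideal.quotient_is_ring[OF relation_ideal])
  show ?thesis
  proof (rule abelian_groupI)
    show "\<exists>y\<in>carrier alg. y \<oplus>\<^bsub>alg\<^esub> x = \<zero>\<^bsub>alg\<^esub>" if "x \<in> carrier alg" for x
      using that Q.l_neg Q.a_inv_closed unfolding alg_sel by blast
  qed (simp_all add: alg_sel Q.a_ac)
qed

text \<open>Quotient elements are cosets, that is, sets of representatives. \<open>rep\<close>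
  vanishes on the relation ideal, so the chosen representative does not matter
  (\<open>alg_rep_coset\<close>).\<close>

definition alg_rep :: "('a gen fmon \<Rightarrow>\<^sub>0 'r) set \<Rightarrow> ('a, 'r) orbit_matrix" where
  "alg_rep U = rep (SOME f. f \<in> U)"

lemma alg_rep_coset: "alg_rep (coset_of X f) = rep f"
proof -
  have "f \<in> coset_of X f" unfolding coset_of_eq using relation_ideal_zero by force
  hence "(SOME g. g \<in> coset_of X f) \<in> coset_of X f" by (rule someI)
  then obtain i where "i \<in> relation_ideal X" "(SOME g. g \<in> coset_of X f) = i + f"
    unfolding coset_of_eq by blast
  thus ?thesis by (simp add: alg_rep_def rep_add rep_relation_ideal)
qed

lemma alg_rep_inj: "inj_on alg_rep (carrier alg)"
proof (rule inj_onI)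
  fix x y assume "x \<in> carrier alg" "y \<in> carrier alg" "alg_rep x = alg_rep y"
  then obtain f g where fg: "x = coset_of X f" "y = coset_of X g" "f \<in> carrier free_alg"
    "g \<in> carrier free_alg" "rep f = rep g"
    unfolding alg_carrier by (auto simp: alg_rep_coset)
  have I: "f - g \<in> relation_ideal X"
    by (rule kernel_rep) (simp_all add: carrier_free_algebra fg rep_minus)
  have "i + f = (i + (f - g)) + g" "i + g = (i - (f - g)) + f" for i by simp_all
  moreover have "i + (f - g) \<in> relation_ideal X" "i - (f - g) \<in> relation_ideal X"
    if "i \<in> relation_ideal X" for i
    using relation_ideal_add[OF that I] relation_ideal_add[OF that relation_ideal_uminus[OF I]]
    by (simp_all only: diff_conv_add_uminus)
  ultimately show "x = y" unfolding fg(1,2) coset_of_eq by blast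
qed

lemma alg_rep_image: "alg_rep ` carrier alg = mat_alg"
  unfolding alg_carrier rep_image[symmetric] image_image alg_rep_coset ..

lemma alg_rep_mem: "x \<in> carrier alg \<Longrightarrow> alg_rep x \<in> mat_alg"
  using alg_rep_image by blast

lemma alg_rep_eqD: "alg_rep x = alg_rep y \<Longrightarrow> x \<in> carrier alg \<Longrightarrow> y \<in> carrier alg \<Longrightarrow> x = y"
  using alg_rep_inj by (rule inj_onD)

lemma alg_rep_add: "x \<in> carrier alg \<Longrightarrow> y \<in> carrier alg \<Longrightarrow> alg_rep (x \<oplus>\<^bsub>alg\<^esub> y) = alg_rep x + alg_rep y"
  and alg_rep_mult: "x \<in> carrier alg \<Longrightarrow> y \<in> carrier alg \<Longrightarrow> alg_rep (x \<otimes>\<^bsub>alg\<^esub> y) = alg_rep x * alg_rep y"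
  and alg_rep_zero: "alg_rep \<zero>\<^bsub>alg\<^esub> = 0"
  and alg_closed: "x \<in> carrier alg \<Longrightarrow> y \<in> carrier alg \<Longrightarrow> x \<otimes>\<^bsub>alg\<^esub> y \<in> carrier alg"
    "x \<in> carrier alg \<Longrightarrow> y \<in> carrier alg \<Longrightarrow> x \<oplus>\<^bsub>alg\<^esub> y \<in> carrier alg"
    "x \<in> carrier alg \<Longrightarrow> r \<odot>\<^bsub>alg\<^esub> x \<in> carrier alg" "\<zero>\<^bsub>alg\<^esub> \<in> carrier alg"
  unfolding alg_carrier
  by (auto simp: alg_ops alg_zero alg_rep_coset rep_add rep_mult carrier_free_algebra)

lemma alg_rep_smult:
  "x \<in> carrier alg \<Longrightarrow> alg_rep (r \<odot>\<^bsub>alg\<^esub> x) = smat (monom 0 r) * alg_rep x"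
  unfolding alg_carrier by (auto simp: alg_ops alg_rep_coset rep_scale)

lemma alg_inv:
  assumes "x \<in> carrier alg"
  shows "inv\<^bsub>add_monoid alg\<^esub> x \<in> carrier alg" "alg_rep (inv\<^bsub>add_monoid alg\<^esub> x) = - alg_rep x"
proof -
  interpret abelian_group alg by (rule alg_abelian)
  have c: "\<ominus>\<^bsub>alg\<^esub> x \<in> carrier alg" using assms by simp
  thus "inv\<^bsub>add_monoid alg\<^esub> x \<in> carrier alg" by (simp add: a_inv_def)
  have "alg_rep (\<ominus>\<^bsub>alg\<^esub> x \<oplus>\<^bsub>alg\<^esub> x) = 0" using assms by (simp add: l_neg alg_rep_zero)
  hence "alg_rep (\<ominus>\<^bsub>alg\<^esub> x) + alg_rep x = 0" using alg_rep_add[OF c assms] by simp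
  thus "alg_rep (inv\<^bsub>add_monoid alg\<^esub> x) = - alg_rep x"
    by (simp add: a_inv_def eq_neg_iff_add_eq_0)
qed

section \<open>Subspaces, left ideals and generated subgroups under the isomorphism\<close>

definition preim :: "('a, 'r) orbit_matrix set \<Rightarrow> ('a gen fmon \<Rightarrow>\<^sub>0 'r) set set" where
  "preim M = {x \<in> carrier alg. alg_rep x \<in> M}"

lemma image_preim: "M \<subseteq> mat_alg \<Longrightarrow> alg_rep ` preim M = M"
  unfolding preim_def alg_rep_image[symmetric] by blast

lemma preim_image: "L \<subseteq> carrier alg \<Longrightarrow> preim (alg_rep ` L) = L"
  unfolding preim_def using alg_rep_eqD by blast

lemma preim_inj: "M \<subseteq> mat_alg \<Longrightarrow> N \<subseteq> mat_alg \<Longrightarrow> preim M = preim N \<longleftrightarrow> M = N"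
  using image_preim by metis

lemma preim_zero: "preim {0} = {\<zero>\<^bsub>alg\<^esub>}"
proof
  show "preim {0} \<subseteq> {\<zero>\<^bsub>alg\<^esub>}"
  proof
    fix x assume "x \<in> preim {0}"
    hence "x \<in> carrier alg" "alg_rep x = alg_rep \<zero>\<^bsub>alg\<^esub>" by (simp_all add: preim_def alg_rep_zero)
    thus "x \<in> {\<zero>\<^bsub>alg\<^esub>}" using alg_rep_eqD[OF _ _ alg_closed(4)] by blast
  qed
qed (use alg_rep_zero alg_closed(4) in \<open>simp add: preim_def\<close>)

lemma smat_uminus: "smat (monom 0 (- 1)) * M = - (M :: ('a, 'r) orbit_matrix)"
  by (rule cmat_eqI) (simp add: single_uminus)

lemma subspace_preim:
  assumes "0 \<in> M" "\<And>x y. x \<in> M \<Longrightarrow> y \<in> M \<Longrightarrow> x + y \<in> M"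
    and "\<And>r x. x \<in> M \<Longrightarrow> smat (monom 0 r) * x \<in> M"
  shows "subspace_of alg (preim M)"
proof -
  have u: "- x \<in> M" if "x \<in> M" for x using assms(3)[OF that, of "- 1"] by (simp only: smat_uminus)
  have "subgroup (preim M) (add_monoid alg)"
    by (rule subgroup.intro)
      (use assms(1,2) u in \<open>auto simp: preim_def alg_rep_add alg_rep_zero alg_closed alg_inv\<close>)
  thus ?thesis unfolding subspace_of_def additive_subgroup_def
    using assms(3) by (auto simp: preim_def alg_rep_smult alg_closed)
qed

text \<open>Scaling by \<open>r\<close> is left multiplication by the element r p_X of the algebra.
  Hence a \<open>lideal\<close>, whose definition does not mention scalars, is a subspace.\<close>

lemma smat_mult_mat_alg: "x \<in> mat_alg \<Longrightarrow> smat (monom 0 r) * x = term_mat X r [] X [] * x"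
  by (subst proj_X_mult[symmetric], assumption)
    (simp only: mult.assoc[symmetric] smat_mult_term_mat mult_1_right)

lemma smat_mult_lideal:
  assumes "lideal L" "x \<in> L"
  shows "smat (monom 0 r) * x \<in> L"
  unfolding smat_mult_mat_alg[OF lidealD(1)[OF assms]]
  by (rule lidealD(4)[OF assms(1) terms_mat_alg[OF X_bool_alg] assms(2)])

lemma left_ideal_preim:
  assumes "lideal M"
  shows "left_ideal alg (preim M)"
  unfolding left_ideal_def
proof (intro conjI ballI)
  show "subspace_of alg (preim M)"
    by (intro subspace_preim lidealD(2,3)[OF assms] smat_mult_lideal[OF assms])
  show "a \<otimes>\<^bsub>alg\<^esub> x \<in> preim M" if "a \<in> carrier alg" "x \<in> preim M" for a x
    using that lidealD(4)[OF assms alg_rep_mem] by (simp add: preim_def alg_rep_mult alg_closed)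
qed

lemma lideal_image:
  assumes "left_ideal alg L"
  shows "L \<subseteq> carrier alg" "lideal (alg_rep ` L)"
proof -
  have sub: "subgroup L (add_monoid alg)" and m: "\<And>a x. a \<in> carrier alg \<Longrightarrow> x \<in> L \<Longrightarrow> a \<otimes>\<^bsub>alg\<^esub> x \<in> L"
    using assms unfolding left_ideal_def subspace_of_def additive_subgroup_def by blast+
  show L: "L \<subseteq> carrier alg" using subgroup.subset[OF sub] by simp
  show "lideal (alg_rep ` L)"
    unfolding lideal_def
  proof (intro conjI ballI)
    show "alg_rep ` L \<subseteq> mat_alg" using L alg_rep_mem by blast
    show "0 \<in> alg_rep ` L" using subgroup.one_closed[OF sub] alg_rep_zero by force
    fix x y assume "x \<in> alg_rep ` L" "y \<in> alg_rep ` L"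
    then obtain u v where uv: "x = alg_rep u" "y = alg_rep v" "u \<in> L" "v \<in> L" by blast
    have "u \<oplus>\<^bsub>alg\<^esub> v \<in> L" using subgroup.m_closed[OF sub uv(3,4)] by simp
    moreover have "x + y = alg_rep (u \<oplus>\<^bsub>alg\<^esub> v)"
      unfolding uv(1,2) by (rule alg_rep_add[symmetric]) (use uv L in blast)+
    ultimately show "x + y \<in> alg_rep ` L" by blast
  next
    fix b x :: "('a, 'r) orbit_matrix" assume "b \<in> mat_alg" "x \<in> alg_rep ` L"
    then obtain a u where au: "b = alg_rep a" "a \<in> carrier alg" "x = alg_rep u" "u \<in> L"
      unfolding alg_rep_image[symmetric] by blast
    have "b * x = alg_rep (a \<otimes>\<^bsub>alg\<^esub> u)"
      unfolding au(1,3) by (rule alg_rep_mult[symmetric]) (use au L in blast)+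
    thus "b * x \<in> alg_rep ` L" using m[OF au(2,4)] by blast
  qed
qed

lemma minimal_left_ideal_iff:
  "minimal_left_ideal alg L \<longleftrightarrow> L \<subseteq> carrier alg \<and> mlideal (alg_rep ` L)"
proof
  assume L: "minimal_left_ideal alg L"
  hence l: "left_ideal alg L" "L \<noteq> {\<zero>\<^bsub>alg\<^esub>}"
    and min: "\<And>I. left_ideal alg I \<Longrightarrow> I \<subseteq> L \<Longrightarrow> I = {\<zero>\<^bsub>alg\<^esub>} \<or> I = L"
    unfolding minimal_left_ideal_def by auto
  note L = lideal_image[OF l(1)]
  have "alg_rep ` L \<noteq> {0}" using l(2) preim_image[OF L(1)] preim_zero by auto
  moreover have "I = {0} \<or> I = alg_rep ` L" if I: "lideal I" "I \<subseteq> alg_rep ` L" for I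
  proof -
    have "preim I \<subseteq> preim (alg_rep ` L)" using I(2) unfolding preim_def by blast
    hence "preim I = {\<zero>\<^bsub>alg\<^esub>} \<or> preim I = L"
      using min[OF left_ideal_preim[OF I(1)]] preim_image[OF L(1)] by simp
    moreover have "alg_rep ` preim I = I" using image_preim lidealD(1)[OF I(1)] by blast
    ultimately show ?thesis using alg_rep_zero by auto
  qed
  ultimately show "L \<subseteq> carrier alg \<and> mlideal (alg_rep ` L)"
    unfolding mlideal_def using L by blast
next
  assume "L \<subseteq> carrier alg \<and> mlideal (alg_rep ` L)"
  hence L: "L \<subseteq> carrier alg" "lideal (alg_rep ` L)" "alg_rep ` L \<noteq> {0}"
    and min: "\<And>I. lideal I \<Longrightarrow> I \<subseteq> alg_rep ` L \<Longrightarrow> I = {0} \<or> I = alg_rep ` L"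
    unfolding mlideal_def by auto
  have "left_ideal alg L" using left_ideal_preim[OF L(2)] preim_image[OF L(1)] by simp
  moreover have "L \<noteq> {\<zero>\<^bsub>alg\<^esub>}" using L(3) alg_rep_zero by auto
  moreover have "I = {\<zero>\<^bsub>alg\<^esub>} \<or> I = L" if I: "left_ideal alg I" "I \<subseteq> L" for I
  proof -
    have "alg_rep ` I = {0} \<or> alg_rep ` I = alg_rep ` L"
      using min[OF lideal_image(2)[OF I(1)]] I(2) by blast
    thus ?thesis using preim_image[OF lideal_image(1)[OF I(1)]] preim_image[OF L(1)] preim_zero by metis
  qed
  ultimately show "minimal_left_ideal alg L" unfolding minimal_left_ideal_def by blast
qed

lemma add_closure_mat_alg: "M \<subseteq> mat_alg \<Longrightarrow> add_closure M \<subseteq> mat_alg"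
  by (rule add_closure_minimal) (auto simp: mat_alg_0 mat_alg_add)

text \<open>\<open>generate\<close> adjoins inverses whereas \<open>add_closure\<close> only adds,
  which is where closure of the image under negation enters.\<close>

lemma generate_preim:
  assumes H: "H \<subseteq> carrier alg" and u: "\<And>m. m \<in> alg_rep ` H \<Longrightarrow> - m \<in> alg_rep ` H"
  shows "generate (add_monoid alg) H = preim (add_closure (alg_rep ` H))"
proof
  show "generate (add_monoid alg) H \<subseteq> preim (add_closure (alg_rep ` H))"
  proof
    fix x assume "x \<in> generate (add_monoid alg) H"
    thus "x \<in> preim (add_closure (alg_rep ` H))"
    proof induction
      case one
      show ?case using alg_rep_zero alg_closed(4) by (simp add: preim_def add_closure.zero)
    next
      case (incl h)
      thus ?case using H by (auto simp: preim_def intro: add_closure_incl)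
    next
      case (inv h)
      hence "h \<in> carrier alg" "- alg_rep h \<in> alg_rep ` H" using H u by blast+
      thus ?case by (simp add: preim_def alg_inv add_closure_incl)
    next
      case (eng h1 h2)
      thus ?case by (simp add: preim_def alg_rep_add alg_closed add_closure_add)
    qed
  qed
  show "preim (add_closure (alg_rep ` H)) \<subseteq> generate (add_monoid alg) H"
  proof
    fix x assume "x \<in> preim (add_closure (alg_rep ` H))"
    hence x: "x \<in> carrier alg" "alg_rep x \<in> add_closure (alg_rep ` H)" unfolding preim_def by auto
    have "\<forall>x\<in>carrier alg. alg_rep x = m \<longrightarrow> x \<in> generate (add_monoid alg) H"
      if "m \<in> add_closure (alg_rep ` H)" for m
      using that
    proof induction
      case zero
      show ?case
      proof (intro ballI impI)
        fix x assume "x \<in> carrier alg" "alg_rep x = 0"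
        hence "x = \<zero>\<^bsub>alg\<^esub>" using alg_rep_eqD alg_rep_zero alg_closed(4) by metis
        thus "x \<in> generate (add_monoid alg) H" using generate.one[of "add_monoid alg" H] by simp
      qed
    next
      case (add k m)
      show ?case
      proof (intro ballI impI)
        fix x assume x: "x \<in> carrier alg" "alg_rep x = k + m"
        obtain y where y: "y \<in> H" "k = alg_rep y" using add.hyps(1) by blast
        have "alg_rep ` H \<subseteq> mat_alg" using H alg_rep_mem by blast
        hence "m \<in> mat_alg" using add.hyps(2) add_closure_mat_alg by blast
        then obtain z where z: "z \<in> carrier alg" "m = alg_rep z" unfolding alg_rep_image[symmetric] by blast
        have yc: "y \<in> carrier alg" using y H by blast
        have "x = y \<oplus>\<^bsub>alg\<^esub> z"
          by (rule alg_rep_eqD) (simp_all add: x yc z y alg_rep_add alg_closed)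
        moreover have "z \<in> generate (add_monoid alg) H" using add.IH z by blast
        ultimately show "x \<in> generate (add_monoid alg) H"
          using generate.eng[OF generate.incl[OF y(1), of "add_monoid alg"]] by simp
      qed
    qed
    thus "x \<in> generate (add_monoid alg) H" using x by blast
  qed
qed

lemma socle_alg: "socle alg = preim finitary"
proof -
  let ?H = "\<Union>{L. minimal_left_ideal alg L}"
  have H: "alg_rep ` ?H = \<Union>{M. mlideal M}"
  proof
    show "alg_rep ` ?H \<subseteq> \<Union>{M. mlideal M}" using minimal_left_ideal_iff by blast
    show "\<Union>{M. mlideal M} \<subseteq> alg_rep ` ?H"
    proof
      fix m :: "('a, 'r) orbit_matrix" assume "m \<in> \<Union>{M. mlideal M}"
      then obtain M where M: "mlideal M" "m \<in> M" by blast
      have eq: "alg_rep ` preim M = M" using image_preim lidealD(1)[OF mlidealD[OF M(1)]] by blast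
      have "minimal_left_ideal alg (preim M)"
        unfolding minimal_left_ideal_iff eq using M(1) by (auto simp: preim_def)
      thus "m \<in> alg_rep ` ?H" using M(2) eq by blast
    qed
  qed
  have "- m \<in> alg_rep ` ?H" if m: "m \<in> alg_rep ` ?H" for m
  proof -
    obtain M where M: "mlideal M" "m \<in> M" using m unfolding H by blast
    have "- m \<in> M" using smat_mult_lideal[OF mlidealD[OF M(1)] M(2), of "- 1"] by (simp only: smat_uminus)
    thus ?thesis unfolding H using M(1) by blast
  qed
  moreover have "?H \<subseteq> carrier alg" using minimal_left_ideal_iff by blast
  ultimately show ?thesis
    unfolding socle_def using generate_preim[of ?H] by (simp add: H socle_mat_alg)
qed

section \<open>The grading\<close>

definition homog_gens :: "int \<Rightarrow> ('a, 'r) orbit_matrix set" where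
  "homog_gens n = {unitm x y (monom n r) | x y r. x \<in> Q_set X \<and> y \<in> Q_set X \<and> lag x y n}"

definition homog :: "int \<Rightarrow> ('a, 'r) orbit_matrix set" where
  "homog n = add_closure (homog_gens n)"

definition homog_terms :: "int \<Rightarrow> ('a, 'r) orbit_matrix set" where
  "homog_terms n = {term_mat X c \<alpha> A \<beta> | c \<alpha> A \<beta>. \<alpha> \<in> language X \<and> \<beta> \<in> language X \<and>
    A \<in> \<U> \<and> deg \<alpha> \<beta> = n}"

lemma component_alg: "subshift_component X n = preim (add_closure (homog_terms n))"
proof -
  let ?S = "{coset_of X (word_s \<alpha> * gen_p A * word_s_star \<beta>) | \<alpha> A \<beta>.
        \<alpha> \<in> language X \<and> \<beta> \<in> language X \<and> A \<in> \<U> \<and>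
        deg \<alpha> \<beta> = n} :: ('a gen fmon \<Rightarrow>\<^sub>0 'r) set set"
  let ?H = "{r \<odot>\<^bsub>alg\<^esub> x | r x. x \<in> ?S}"
  have m: "word_s \<alpha> * gen_p A * word_s_star \<beta> \<in> carrier free_alg" if "A \<in> \<U>" for \<alpha> A \<beta>
    by (intro carrier_free_algebra_mult gen_p_gens word_s_gens word_s_star_gens that)
  have S: "?S \<subseteq> carrier alg" unfolding alg_carrier using m by blast
  have eq: "alg_rep (r \<odot>\<^bsub>alg\<^esub> coset_of X (word_s \<alpha> * gen_p A * word_s_star \<beta>)) = term_mat X r \<alpha> A \<beta>"
    if "A \<in> \<U>" for r \<alpha> A \<beta>
  proof -
    have "coset_of X (word_s \<alpha> * gen_p A * word_s_star \<beta>) \<in> carrier alg"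
      unfolding alg_carrier using m[OF that] by blast
    thus ?thesis by (simp add: alg_rep_smult alg_rep_coset rep_monomial smat_mult_term_mat)
  qed
  have H: "alg_rep ` ?H = homog_terms n"
  proof
    show "alg_rep ` ?H \<subseteq> homog_terms n" unfolding homog_terms_def using eq by blast
    show "homog_terms n \<subseteq> alg_rep ` ?H"
    proof
      fix M assume "M \<in> homog_terms n"
      then obtain c \<alpha> A \<beta> where M: "M = term_mat X c \<alpha> A \<beta>" "\<alpha> \<in> language X" "\<beta> \<in> language X"
        "A \<in> \<U>" "deg \<alpha> \<beta> = n" unfolding homog_terms_def by blast
      show "M \<in> alg_rep ` ?H"
      proof (rule image_eqI)
        show "M = alg_rep (c \<odot>\<^bsub>alg\<^esub> coset_of X (word_s \<alpha> * gen_p A * word_s_star \<beta>))"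
          by (simp only: eq[OF M(4)] M(1))
      qed (use M in blast)
    qed
  qed
  have "- M \<in> homog_terms n" if M: "M \<in> homog_terms n" for M
  proof -
    obtain c \<alpha> A \<beta> where "M = term_mat X c \<alpha> A \<beta>" "\<alpha> \<in> language X" "\<beta> \<in> language X"
        "A \<in> \<U>" "deg \<alpha> \<beta> = n" using M unfolding homog_terms_def by blast
    moreover from this have "- M = term_mat X (- c) \<alpha> A \<beta>" by (simp add: term_mat_uminus)
    ultimately show ?thesis unfolding homog_terms_def by blast
  qed
  moreover have "?H \<subseteq> carrier alg" using S alg_closed(3) by blast
  ultimately show ?thesis
    unfolding subshift_component_def span_of_def using generate_preim[of ?H] H by simp
qed

lemma homog_gens_mem: "x \<in> Q_set X \<Longrightarrow> y \<in> Q_set X \<Longrightarrow> lag x y n \<Longrightarrow>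
    unitm x y (monom n (r::'r)) \<in> homog n"
  unfolding homog_def homog_gens_def by (rule add_closure_incl) blast

lemma homog_0: "(0 :: ('a, 'r) orbit_matrix) \<in> homog n"
  and homog_add: "M \<in> homog n \<Longrightarrow> N \<in> homog n \<Longrightarrow> M + N \<in> homog n"
  unfolding homog_def by (auto intro: add_closure.zero add_closure_add)

lemma homog_smult:
  assumes "M \<in> homog n"
  shows "smat (monom 0 c) * M \<in> homog n"
  using assms unfolding homog_def
proof (rule add_closure_mult_left)
  fix k :: "('a, 'r) orbit_matrix" assume "k \<in> homog_gens n"
  then obtain x y r where k: "k = unitm x y (monom n r)" "x \<in> Q_set X" "y \<in> Q_set X" "lag x y n"
    unfolding homog_gens_def by blast
  show "smat (monom 0 c) * k \<in> add_closure (homog_gens n)"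
    using homog_gens_mem[OF k(2-4), of "c * r"] by (simp add: k(1) smat_mult_unitm mult_single homog_def)
qed

lemma homog_finitary: "homog n \<subseteq> finitary"
  unfolding homog_def finitary_def
  by (intro add_closure_mono subsetI add_closure_incl) (auto simp: homog_gens_def finitary_gens_def)

lemma homog_mat_alg: "homog n \<subseteq> mat_alg"
  using homog_finitary finitary_mat_alg by blast

lemma degree_part_homog:
  assumes "M \<in> homog n"
  shows "degree_part k M = (if k = n then M else 0)"
  using assms unfolding homog_def
  by induction (auto simp: degree_part_add homog_gens_def degree_part_unitm)

lemma degree_part_finitary:
  assumes "M \<in> finitary"
  shows "degree_part n M \<in> homog n"
  using assms unfolding finitary_def
proof induction
  case (add g M)
  then obtain x y k r where g: "g = unitm x y (monom k r)" "x \<in> Q_set X" "y \<in> Q_set X" "lag x y k"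
    unfolding finitary_gens_def by blast
  have "degree_part n g \<in> homog n"
    using homog_gens_mem[OF g(2,3), of n r] g(4) homog_0 by (auto simp: g(1) degree_part_unitm)
  thus ?case using add.IH by (simp add: degree_part_add homog_add)
qed (simp add: homog_0)

text \<open>An element of the component equals its own degree part, and the degree part of a sum of
  matrix units retains just those of that degree. Conversely, each such matrix unit is itself a term
  of that degree.\<close>

lemma finitary_inter_component:
  "finitary \<inter> add_closure (homog_terms n) = homog n"
proof
  show "finitary \<inter> add_closure (homog_terms n) \<subseteq> homog n"
  proof
    fix M :: "('a, 'r) orbit_matrix" assume M: "M \<in> finitary \<inter> add_closure (homog_terms n)"
    have "M \<in> add_closure (homog_terms n)" using M by blast
    hence "degree_part n M = M"
      by induction (auto simp: degree_part_add homog_terms_def degree_part_term_mat)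
    thus "M \<in> homog n" using degree_part_finitary[of M n] M by simp
  qed
  show "homog n \<subseteq> finitary \<inter> add_closure (homog_terms n)"
  proof (intro Int_greatest homog_finitary)
    show "homog n \<subseteq> add_closure (homog_terms n)"
      unfolding homog_def
    proof (intro add_closure_mono subsetI add_closure_incl)
      fix M :: "('a, 'r) orbit_matrix" assume "M \<in> homog_gens n"
      then obtain x y r where M: "M = unitm x y (monom n r)" "x \<in> Q_set X" "y \<in> Q_set X" "lag x y n"
        unfolding homog_gens_def by blast
      obtain \<alpha> \<beta> z where "M = term_mat X r \<alpha> {z} \<beta>" "{z} \<in> \<U>"
        "\<alpha> \<in> language X" "\<beta> \<in> language X" "n = deg \<alpha> \<beta>"
        unfolding M(1) by (rule unitm_termE[OF Q_set_subset[OF M(2)] Q_set_bool_alg[OF M(3)] M(4)])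
      thus "M \<in> homog_terms n" unfolding homog_terms_def by blast
    qed
  qed
qed

lemma socle_component:
  "socle alg \<inter> subshift_component X n = preim (homog n)"
  unfolding socle_alg component_alg finitary_inter_component[symmetric] by (auto simp: preim_def)

lemma homog_gens_mult:
  assumes "a \<in> homog_gens m" "b \<in> homog_gens n"
  shows "a * b \<in> homog (m + n)"
proof -
  obtain x y r where a: "a = unitm x y (monom m r)" "x \<in> Q_set X" "y \<in> Q_set X" "lag x y m"
    using assms(1) unfolding homog_gens_def by blast
  obtain u v s where b: "b = unitm u v (monom n s)" "u \<in> Q_set X" "v \<in> Q_set X" "lag u v n"
    using assms(2) unfolding homog_gens_def by blast
  show ?thesis
  proof (cases "y = u")
    case True
    thus ?thesis using homog_gens_mem[OF a(2) b(3), of "m + n" "r * s"] lag_trans[OF a(4)] b(4)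
      by (simp add: a(1) b(1) unitm_mult_unitm mult_single)
  next
    case False
    thus ?thesis by (simp add: a(1) b(1) unitm_mult_unitm homog_0)
  qed
qed

lemma homog_mult:
  assumes "a \<in> homog m" "b \<in> homog n"
  shows "a * b \<in> homog (m + n)"
  using assms homog_gens_mult unfolding homog_def by (rule add_closure_mult)

lemma finite_degrees:
  assumes "M \<in> finitary"
  shows "finite {n. degree_part n M \<noteq> 0}"
  using assms unfolding finitary_def
proof induction
  case (add g M)
  then obtain x y k r where g: "g = unitm x y (monom k r)" unfolding finitary_gens_def by blast
  have "{n. degree_part n (g + M) \<noteq> 0} \<subseteq> insert k {n. degree_part n M \<noteq> 0}"
    by (auto simp: g degree_part_add degree_part_unitm split: if_splits)
  thus ?case using add.IH finite_subset by blast
qed simp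

lemma sum_degree_parts:
  fixes M :: "('a, 'r) orbit_matrix"
  assumes "finite {n. degree_part n M \<noteq> 0}"
  shows "(\<Sum>n | degree_part n M \<noteq> 0. degree_part n M) = M"
proof (rule cmat_eqI, rule poly_mapping_eqI)
  fix x y k
  let ?S = "{n. degree_part n M \<noteq> 0}"
  have "coeff (ent (\<Sum>n\<in>?S. degree_part n M) x y) k
      = (\<Sum>n\<in>?S. if n = k then coeff (ent M x y) k else 0)"
    unfolding ent_sum lookup_sum by (rule sum.cong) (auto simp: ent_degree_part lookup_single)
  also have "\<dots> = (if k \<in> ?S then coeff (ent M x y) k else 0)"
    using assms by simp
  also have "\<dots> = coeff (ent M x y) k"
  proof (cases "k \<in> ?S")
    case False
    hence "ent (degree_part k M) x y = 0" by simp
    hence "coeff (ent M x y) k = 0"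
      unfolding ent_degree_part by (metis lookup_single_eq lookup_zero)
    thus ?thesis by simp
  qed simp
  finally show "coeff (ent (\<Sum>n\<in>?S. degree_part n M) x y) k = coeff (ent M x y) k" .
qed

lemma alg_rep_finsum:
  fixes f :: "int \<Rightarrow> ('a gen fmon \<Rightarrow>\<^sub>0 'r) set"
  assumes "finite S" "\<And>n. f n \<in> carrier alg"
  shows "finsum alg f S \<in> carrier alg" "alg_rep (finsum alg f S) = (\<Sum>n\<in>S. alg_rep (f n))"
proof -
  interpret A: abelian_group alg by (rule alg_abelian)
  have f: "f \<in> S \<rightarrow> carrier alg" for S using assms(2) by blast
  show "finsum alg f S \<in> carrier alg" using A.finsum_closed[OF f] .
  show "alg_rep (finsum alg f S) = (\<Sum>n\<in>S. alg_rep (f n))"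
    using assms(1)
  proof (induction S)
    case (insert n S)
    have "finsum alg f (insert n S) = f n \<oplus>\<^bsub>alg\<^esub> finsum alg f S"
      by (rule A.finsum_insert) (use insert f assms(2) in auto)
    thus ?case using insert alg_rep_add[OF assms(2) A.finsum_closed[OF f], of n S] by simp
  qed (simp add: alg_rep_zero)
qed

text \<open>Applying \<open>degree_part n\<close> to any decomposition leaves exactly its summand of
  index \<open>n\<close>, so the degree parts are the only candidates. They work because a sum of
  matrix units has finitely many degrees.\<close>

lemma socle_decomposition:
  assumes x: "x \<in> preim finitary"
  shows "\<exists>!f. (\<forall>n. f n \<in> preim (homog n)) \<and> finite {n. f n \<noteq> \<zero>\<^bsub>alg\<^esub>} \<and>
        x = finsum alg f {n. f n \<noteq> \<zero>\<^bsub>alg\<^esub>}" (is "\<exists>!f. ?D f")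
proof (rule ex_ex1I)
  have xc: "x \<in> carrier alg" and xs: "alg_rep x \<in> finitary" using x by (auto simp: preim_def)
  define f where "f n = inv_into (carrier alg) alg_rep (degree_part n (alg_rep x))" for n
  have d: "degree_part n (alg_rep x) \<in> homog n" for n by (rule degree_part_finitary[OF xs])
  have im: "degree_part n (alg_rep x) \<in> alg_rep ` carrier alg" for n
    unfolding alg_rep_image using d homog_mat_alg by blast
  have fc: "f n \<in> carrier alg" and fr: "alg_rep (f n) = degree_part n (alg_rep x)" for n
    unfolding f_def using inv_into_into[OF im] f_inv_into_f[OF im] by auto
  have z: "f n = \<zero>\<^bsub>alg\<^esub> \<longleftrightarrow> degree_part n (alg_rep x) = 0" for n
    using alg_rep_eqD[OF _ fc alg_closed(4)] alg_rep_zero fr by metis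
  have fin: "finite {n. degree_part n (alg_rep x) \<noteq> 0}" by (rule finite_degrees[OF xs])
  have "x = finsum alg f {n. f n \<noteq> \<zero>\<^bsub>alg\<^esub>}"
    unfolding z
    by (rule alg_rep_eqD)
      (simp_all add: xc alg_rep_finsum[OF fin fc] fr sum_degree_parts[OF fin])
  moreover have "f n \<in> preim (homog n)" for n using fc fr d by (simp add: preim_def)
  ultimately show "\<exists>f. ?D f"
    using fin z by (intro exI[of _ f]) auto
next
  have uniq: "alg_rep (f n) = degree_part n (alg_rep x)"
    if f: "?D f"
    for f :: "int \<Rightarrow> ('a gen fmon \<Rightarrow>\<^sub>0 'r) set" and n
  proof -
    let ?S = "{n. f n \<noteq> \<zero>\<^bsub>alg\<^esub>}"
    have fc: "f m \<in> carrier alg" and fh: "alg_rep (f m) \<in> homog m" for m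
      using f by (auto simp: preim_def)
    have fin: "finite ?S" using f by blast
    have eq: "alg_rep x = (\<Sum>m\<in>?S. alg_rep (f m))" using f alg_rep_finsum(2)[OF fin fc] by simp
    have "degree_part n (alg_rep x) = (\<Sum>m\<in>?S. degree_part n (alg_rep (f m)))"
      by (simp only: eq degree_part_sum)
    also have "\<dots> = (\<Sum>m\<in>?S. if m = n then alg_rep (f n) else 0)"
      by (rule sum.cong) (auto simp: degree_part_homog[OF fh])
    also have "\<dots> = alg_rep (f n)" using fin alg_rep_zero by auto
    finally show ?thesis ..
  qed
  fix f g :: "int \<Rightarrow> ('a gen fmon \<Rightarrow>\<^sub>0 'r) set"
  assume f: "?D f" and g: "?D g"
  show "f = g"
  proof
    fix n
    have c: "f n \<in> carrier alg" "g n \<in> carrier alg" using f g by (auto simp: preim_def)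
    have "alg_rep (f n) = alg_rep (g n)" by (simp only: uniq[OF f] uniq[OF g])
    thus "f n = g n" using c by (rule alg_rep_eqD)
  qed
qed

lemma socle_graded:
  "graded_by alg (socle alg) (\<lambda>n. socle alg \<inter> subshift_component X n)"
  unfolding graded_by_def socle_component
proof (intro conjI allI ballI)
  have fin: "smat (monom 0 r) * M \<in> finitary" if M: "M \<in> finitary" for r M
    using mat_alg_mult_finitary[OF terms_mat_alg[OF X_bool_alg] M] finitary_mat_alg M
    by (simp add: smat_mult_mat_alg subset_iff)
  show "subspace_of alg (socle alg)"
    unfolding socle_alg
    by (rule subspace_preim) (use fin in \<open>auto simp: finitary_def intro: add_closure.zero add_closure_add\<close>)
  show "subspace_of alg (preim (homog n))" for n
    by (rule subspace_preim) (auto intro: homog_0 homog_add homog_smult)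
  show "preim (homog n) \<subseteq> socle alg" for n
    unfolding socle_alg using homog_finitary by (auto simp: preim_def)
  show "\<exists>!f. (\<forall>n. f n \<in> preim (homog n)) \<and> finite {n. f n \<noteq> \<zero>\<^bsub>alg\<^esub>} \<and>
        x = finsum alg f {n. f n \<noteq> \<zero>\<^bsub>alg\<^esub>}" if "x \<in> socle alg" for x :: "('a gen fmon \<Rightarrow>\<^sub>0 'r) set"
    by (rule socle_decomposition) (use that in \<open>unfold socle_alg\<close>)
  show "x \<otimes>\<^bsub>alg\<^esub> y \<in> preim (homog (m + n))" if "x \<in> preim (homog m)" "y \<in> preim (homog n)"
    for m n and x y :: "('a gen fmon \<Rightarrow>\<^sub>0 'r) set"
    using that by (simp add: preim_def alg_rep_mult alg_closed homog_mult)
qed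

section \<open>Strong grading and partners of every lag\<close>

definition homog_prods :: "int \<Rightarrow> int \<Rightarrow> ('a, 'r) orbit_matrix set" where
  "homog_prods m n = {a * b | a b. a \<in> homog m \<and> b \<in> homog n}"

lemma homog_prods_subset: "add_closure (homog_prods m n) \<subseteq> homog (m + n)"
  by (rule add_closure_minimal) (auto simp: homog_prods_def homog_mult homog_0 homog_add)

lemma generate_prods:
  "generate (add_monoid alg) (preim (homog m) <#>\<^bsub>alg\<^esub> preim (homog n)) = preim (add_closure (homog_prods m n))"
proof -
  let ?H = "preim (homog m) <#>\<^bsub>alg\<^esub> preim (homog n) :: ('a gen fmon \<Rightarrow>\<^sub>0 'r) set set"
  have H: "?H = {x \<otimes>\<^bsub>alg\<^esub> y | x y. x \<in> preim (homog m) \<and> y \<in> preim (homog n)}"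
    unfolding set_mult_def by blast
  have Hc: "?H \<subseteq> carrier alg" unfolding H using alg_closed(1) by (auto simp: preim_def)
  have im: "alg_rep ` ?H = homog_prods m n"
  proof
    show "alg_rep ` ?H \<subseteq> homog_prods m n"
    proof
      fix a :: "('a, 'r) orbit_matrix" assume "a \<in> alg_rep ` ?H"
      then obtain x y where xy: "a = alg_rep (x \<otimes>\<^bsub>alg\<^esub> y)" "x \<in> preim (homog m)" "y \<in> preim (homog n)"
        unfolding H by blast
      hence "a = alg_rep x * alg_rep y" "alg_rep x \<in> homog m" "alg_rep y \<in> homog n"
        by (simp_all add: preim_def alg_rep_mult)
      thus "a \<in> homog_prods m n" unfolding homog_prods_def by blast
    qed
    show "homog_prods m n \<subseteq> alg_rep ` ?H"
    proof
      fix c :: "('a, 'r) orbit_matrix" assume "c \<in> homog_prods m n"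
      then obtain a b where ab: "c = a * b" "a \<in> homog m" "b \<in> homog n" unfolding homog_prods_def by blast
      obtain x where x: "a = alg_rep x" "x \<in> preim (homog m)" using image_preim[OF homog_mat_alg] ab(2) by blast
      obtain y where y: "b = alg_rep y" "y \<in> preim (homog n)" using image_preim[OF homog_mat_alg] ab(3) by blast
      have "c = alg_rep (x \<otimes>\<^bsub>alg\<^esub> y)" using x y by (simp add: ab(1) preim_def alg_rep_mult)
      thus "c \<in> alg_rep ` ?H" unfolding H using x y by blast
    qed
  qed
  have "- c \<in> homog_prods m n" if c: "c \<in> homog_prods m n" for c
  proof -
    obtain a b where ab: "c = a * b" "a \<in> homog m" "b \<in> homog n" using c unfolding homog_prods_def by blast
    have "- a \<in> homog m" using homog_smult[OF ab(2), of "- 1"] by (simp only: smat_uminus)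
    moreover have "- c = - a * b" by (simp add: ab(1))
    ultimately show ?thesis using ab(3) unfolding homog_prods_def by blast
  qed
  thus ?thesis using generate_preim[OF Hc] by (simp add: im)
qed

lemma strongly_graded_iff_prods:
  "strongly_graded_by alg (socle alg)
      (\<lambda>n. socle alg \<inter> subshift_component X n)
    \<longleftrightarrow> (\<forall>m n. homog (m + n) \<subseteq> add_closure (homog_prods m n))"
proof -
  have "preim (add_closure (homog_prods m n)) = preim (homog (m + n))
      \<longleftrightarrow> homog (m + n) \<subseteq> add_closure (homog_prods m n)" for m n
  proof -
    have "add_closure (homog_prods m n) \<subseteq> mat_alg"
      using homog_prods_subset homog_mat_alg by (rule order.trans)
    hence "preim (add_closure (homog_prods m n)) = preim (homog (m + n))
        \<longleftrightarrow> add_closure (homog_prods m n) = homog (m + n)"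
      by (rule preim_inj[OF _ homog_mat_alg])
    thus ?thesis using homog_prods_subset[of m n] by blast
  qed
  thus ?thesis
    unfolding strongly_graded_by_def using socle_graded by (simp add: socle_component generate_prods)
qed

text \<open>The right-hand side describes the start \<open>y\<close> of a path of length
  \<open>i + 1\<close> in the graph that ends at the vertex of the \<open>i\<close>-th shift of
  \<open>x\<close>.\<close>

lemma lag_one_iff: "lag y x 1 \<longleftrightarrow> (\<exists>i. suffix (Suc i) y = suffix i x)"
proof
  assume "lag y x 1"
  then obtain m n where mn: "suffix m y = suffix n x" "1 = int m - int n" unfolding lag_def by blast
  hence "m = Suc n" by linarith
  thus "\<exists>i. suffix (Suc i) y = suffix i x" using mn(1) by blast
next
  assume "\<exists>i. suffix (Suc i) y = suffix i x"
  then obtain i where "suffix (Suc i) y = suffix i x" by blast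
  thus "lag y x 1" unfolding lag_def by (intro exI[of _ "Suc i"] exI[of _ i]) simp
qed

text \<open>A partner of lag 1 is tail equivalent to \<open>x\<close>, so it lies in
  \<open>Q_set X\<close> and has such a partner in turn; lags add up along the chain. Negative lags
  are those of the shifts of \<open>x\<close>.\<close>

lemma lag_all_degrees:
  assumes "\<forall>x\<in>Q_set X. \<exists>y\<in>X. lag y x 1" "x \<in> Q_set X"
  shows "\<exists>y\<in>Q_set X. lag y x n"
proof -
  have pos: "\<exists>y\<in>Q_set X. lag y x (int k)" for k
  proof (induction k)
    case 0
    show ?case using assms(2) lag_refl by auto
  next
    case (Suc k)
    then obtain y where y: "y \<in> Q_set X" "lag y x (int k)" by blast
    then obtain w where w: "w \<in> X" "lag w y 1" using assms(1) by blast
    have "lag w x (int (Suc k))" using lag_trans[OF w(2) y(2)] by simp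
    thus ?case using Q_set_lag[OF y(1) w] by blast
  qed
  have neg: "\<exists>y\<in>Q_set X. lag y x (- int k)" for k
  proof -
    have "suffix k x \<in> X" by (intro suffix_in_X Q_set_subset assms)
    thus ?thesis using Q_set_lag[OF assms(2)] lag_suffix by blast
  qed
  show ?thesis using pos neg by (cases n rule: int_cases2) auto
qed

text \<open>If the diagonal matrix unit at \<open>x\<close> is a sum of products of degrees -1 and
  1, some factor of degree 1 has a nonzero entry in column \<open>x\<close>, and the row of that
  entry is a partner of lag 1. Conversely, a partner of the right lag serves as the middle index
  that factors a matrix unit.\<close>

lemma strongly_graded_iff_lag:
  "strongly_graded_by alg (socle alg)
      (\<lambda>n. socle alg \<inter> subshift_component X n)
    \<longleftrightarrow> (\<forall>x\<in>Q_set X. \<exists>y\<in>X. lag y x 1)"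
  unfolding strongly_graded_iff_prods
proof
  assume strong: "\<forall>m n. homog (m + n) \<subseteq> add_closure (homog_prods m n)"
  show "\<forall>x\<in>Q_set X. \<exists>y\<in>X. lag y x 1"
  proof
    fix x assume x: "x \<in> Q_set X"
    let ?e = "unitm x x 1 :: ('a, 'r) orbit_matrix"
    have "?e \<in> homog 0" using homog_gens_mem[OF x x lag_refl, of 1] by simp
    moreover have "homog 0 \<subseteq> add_closure (homog_prods (- 1) 1)"
      using strong[rule_format, of "- 1" 1] by simp
    ultimately have e: "?e \<in> add_closure (homog_prods (- 1) 1)" by blast
    have "ent c x x = 0 \<or> (\<exists>y\<in>X. lag y x 1)" if "c \<in> add_closure (homog_prods (- 1) 1)" for c
      using that
    proof induction
      case (add p c)
      then obtain a b where ab: "p = a * b" "a \<in> homog (- 1)" "b \<in> homog 1" unfolding homog_prods_def by blast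
      show ?case
      proof (cases "ent p x x = 0")
        case False
        then obtain y where y: "ent b y x \<noteq> 0" unfolding ab(1) by (rule ent_mult_neq_zeroE)
        have "degree_part 1 b = b" using degree_part_homog[OF ab(3)] by simp
        hence "ent b y x = monom 1 (coeff (ent b y x) 1)"
          by (metis ent_degree_part)
        hence "coeff (ent b y x) 1 \<noteq> 0" using y by (metis single_zero)
        hence "lag y x 1" "y \<in> X" using mat_alg_lag homog_mat_alg ab(3) by blast+
        thus ?thesis by blast
      qed (use add.IH in auto)
    qed simp
    from this[OF e] show "\<exists>y\<in>X. lag y x 1" by (simp add: ent_unitm)
  qed
next
  assume lag: "\<forall>x\<in>Q_set X. \<exists>y\<in>X. lag y x 1"
  show "\<forall>m n. homog (m + n) \<subseteq> add_closure (homog_prods m n)"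
  proof (intro allI)
    fix m n
    show "homog (m + n) \<subseteq> add_closure (homog_prods m n)"
      unfolding homog_def[of "m + n"]
    proof (intro add_closure_mono subsetI add_closure_incl)
      fix M :: "('a, 'r) orbit_matrix" assume "M \<in> homog_gens (m + n)"
      then obtain x z r where M: "M = unitm x z (monom (m + n) r)" "x \<in> Q_set X" "z \<in> Q_set X"
        "lag x z (m + n)" unfolding homog_gens_def by blast
      \<comment> \<open>The middle index: lag \<open>m\<close> from \<open>x\<close> to
        \<open>y\<close> leaves lag \<open>n\<close> from \<open>y\<close> to
        \<open>z\<close>.\<close>
      obtain y where y: "y \<in> Q_set X" "lag y x (- m)" using lag_all_degrees[OF lag M(2)] by blast
      have xy: "lag x y m" using lag_sym[OF y(2)] by simp
      have yz: "lag y z n" using lag_trans[OF y(2) M(4)] by simp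
      have "M = unitm x y (monom m 1) * unitm y z (monom n r)"
        by (simp add: M(1) unitm_mult_unitm mult_single)
      thus "M \<in> homog_prods m n"
        unfolding homog_prods_def using homog_gens_mem[OF M(2) y(1) xy] homog_gens_mem[OF y(1) M(3) yz] by blast
    qed
  qed
qed

end

section \<open>Condition (Y)\<close>

text \<open>Subtracting the earlier levels makes the levels disjoint without changing their union,
  which is the closure of the forward orbit of \<open>p\<close> under preimages in
  \<open>X\<close>.\<close>

lemma J_set_iff:
  assumes "p \<in> X"
  shows "x \<in> J_set X p \<longleftrightarrow> x \<in> X \<and> tail_equiv x p"
proof
  have "x \<in> X \<and> tail_equiv x p" if "x \<in> J_level X p n" for n
    using that
  proof (induction n arbitrary: x)
    case 0
    then obtain k where "x = (shift ^^ k) p" by auto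
    thus ?case using suffix_in_X[OF assms, of k] unfolding tail_equiv_def shift_funpow
      by (metis suffix_0)
  next
    case (Suc n)
    hence "x \<in> X" "tail_equiv (shift x) p" by auto
    thus ?case unfolding tail_equiv_def by (metis funpow_swap1 funpow.simps(2) comp_apply)
  qed
  thus "x \<in> X \<and> tail_equiv x p" if "x \<in> J_set X p" using that unfolding J_set_def by blast
next
  assume x: "x \<in> X \<and> tail_equiv x p"
  then obtain m n where mn: "suffix m x = suffix n p" unfolding tail_equiv_def shift_funpow by blast
  have "\<forall>x\<in>X. suffix m x = suffix n p \<longrightarrow> (\<exists>k. x \<in> J_level X p k)"
  proof (induction m)
    case 0
    have "x \<in> J_level X p 0" if "suffix 0 x = suffix n p" for x
      using that by (auto simp: shift_funpow)
    thus ?case by blast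
  next
    case (Suc m)
    show ?case
    proof (intro ballI impI)
      fix x assume x: "x \<in> X" "suffix (Suc m) x = suffix n p"
      have "suffix m (shift x) = suffix n p" using x(2) by (simp add: shift_def)
      moreover have "shift x \<in> X" using suffix_in_X[OF x(1)] by (simp add: shift_def)
      ultimately obtain k where k: "shift x \<in> J_level X p k" using Suc.IH by blast
      \<comment> \<open>Either \<open>x\<close> already appeared at some level up to
        \<open>k\<close>, or nothing removes it from the next one.\<close>
      show "\<exists>k. x \<in> J_level X p k"
      proof (cases "\<exists>j\<le>k. x \<in> J_level X p j")
        case False
        hence "x \<in> J_level X p (Suc k)" using k x(1) by auto
        thus ?thesis by blast
      qed blast
    qed
  qed
  thus "x \<in> J_set X p" using mn x unfolding J_set_def by blast
qed

lemma tail_equiv_lag: "tail_equiv x y \<longleftrightarrow> (\<exists>k. lag x y k)"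
  unfolding tail_equiv_def lag_def shift_funpow by blast

lemma J_set_Q_set: "p \<in> Q_set X \<Longrightarrow> x \<in> J_set X p \<Longrightarrow> x \<in> Q_set X"
  unfolding J_set_iff[OF Q_set_subset] tail_equiv_lag using Q_set_lag by blast

lemma J_set_lag:
  "p \<in> Q_set X \<Longrightarrow> x \<in> J_set X p \<Longrightarrow> y \<in> X \<Longrightarrow> lag y x k \<Longrightarrow> y \<in> J_set X p"
  unfolding J_set_iff[OF Q_set_subset] tail_equiv_lag using lag_trans by blast

lemma subshift_graph_sel:
  "tail (subshift_graph X T) e = e" "head (subshift_graph X T) (p, z) = (p, shift z)"
  by (simp_all add: subshift_graph_def)

text \<open>Every vertex emits exactly one edge, so a walk is determined by its start and its length
  and follows the shift.\<close>

lemma cas_subshift_graph: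
  "pre_digraph.cas (subshift_graph X T) (p, y) es v \<longleftrightarrow>
    es = map (\<lambda>j. (p, suffix j y)) [0..<length es] \<and> v = (p, suffix (length es) y)"
proof (induction es arbitrary: y)
  case Nil
  show ?case by (auto simp: pre_digraph.cas.simps)
next
  case (Cons e es)
  have m: "map (\<lambda>j. (p, suffix j y)) [0..<length (e # es)] = (p, y) # map (\<lambda>j. (p, suffix j (shift y))) [0..<length es]"
    by (simp add: shift_def upt_conv_Cons map_Suc_upt[symmetric] del: upt_Suc)
  have s: "suffix (length (e # es)) y = suffix (length es) (shift y)" by (simp add: shift_def)
  have "pre_digraph.cas (subshift_graph X T) (p, y) (e # es) v
      \<longleftrightarrow> e = (p, y) \<and> pre_digraph.cas (subshift_graph X T) (p, shift y) es v"
    by (auto simp only: pre_digraph.cas.simps subshift_graph_sel)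
  thus ?case unfolding Cons.IH m s by blast
qed

text \<open>Infinite paths are the forward orbits of the vertices, and the second coordinates of the
  vertices are exactly the points of \<open>Q_set X\<close>. The path demanded by the condition
  therefore amounts to a partner of lag 1.\<close>

lemma condition_Y_iff:
  assumes T: "representatives X T"
  shows "condition_Y (subshift_graph X T) \<longleftrightarrow> (\<forall>x\<in>Q_set X. \<exists>y\<in>X. lag y x 1)"
proof
  let ?E = "subshift_graph X T"
  have TQ: "p \<in> Q_set X" if "p \<in> T" for p using T that unfolding representatives_def by blast
  {
    assume Y: "condition_Y ?E"
    show "\<forall>x\<in>Q_set X. \<exists>y\<in>X. lag y x 1"
    proof
      fix x assume x: "x \<in> Q_set X"
      then obtain p where p: "p \<in> T" "tail_equiv p x" using T unfolding representatives_def by blast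
      have pQ: "p \<in> Q_set X" by (rule TQ[OF p(1)])
      have "tail_equiv x p" using p(2) unfolding tail_equiv_lag using lag_sym by blast
      hence xJ: "x \<in> J_set X p" using J_set_iff[OF Q_set_subset[OF pQ]] Q_set_subset[OF x] by blast
      have "suffix i x \<in> J_set X p" for i
        by (rule J_set_lag[OF pQ xJ _ lag_suffix]) (intro suffix_in_X Q_set_subset x)
      hence "infinite_path ?E (\<lambda>i. (p, suffix i x))"
        using p(1) by (simp add: infinite_path_def subshift_graph_def shift_def)
      then obtain k \<alpha> u where k: "pre_digraph.awalk ?E u \<alpha> (tail ?E (p, suffix k x))" "length \<alpha> = k + 1"
        using Y unfolding condition_Y_def by blast
      obtain q y where u: "u = (q, y)" by (cases u)
      have "pre_digraph.cas ?E (q, y) \<alpha> (p, suffix k x)" "(q, y) \<in> verts ?E"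
        using k(1) unfolding pre_digraph.awalk_def u by (simp_all add: subshift_graph_def)
      hence "suffix k x = suffix (Suc k) y" "q \<in> T" "y \<in> J_set X q"
        using k(2) unfolding cas_subshift_graph by (simp_all add: subshift_graph_def)
      hence "lag y x 1" "y \<in> X" using lag_one_iff J_set_iff[OF Q_set_subset[OF TQ]] by metis+
      thus "\<exists>y\<in>X. lag y x 1" by blast
    qed
  }
  {
    assume lag: "\<forall>x\<in>Q_set X. \<exists>y\<in>X. lag y x 1"
    show "condition_Y ?E"
      unfolding condition_Y_def
    proof (intro allI impI)
      fix e assume e: "infinite_path ?E e"
      obtain p x where px: "e 0 = (p, x)" by (cases "e 0")
      have step: "e (Suc i) = head ?E (e i)" and arc: "e i \<in> arcs ?E" for i
        using e unfolding infinite_path_def by (simp_all add: subshift_graph_def)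
      have ei: "e i = (p, suffix i x)" for i
      proof (induction i)
        case (Suc i)
        have "suffix (Suc i) x = shift (suffix i x)" by (simp add: shift_def)
        thus ?case by (simp only: step Suc.IH subshift_graph_sel)
      qed (simp add: px)
      have pT: "p \<in> T" and xJ: "x \<in> J_set X p" using arc[of 0] by (auto simp: px subshift_graph_def)
      have pQ: "p \<in> Q_set X" by (rule TQ[OF pT])
      obtain y where y: "y \<in> X" "lag y x 1" using lag J_set_Q_set[OF pQ xJ] by blast
      obtain k where k: "suffix (Suc k) y = suffix k x" using y(2) unfolding lag_one_iff by blast
      have yJ: "y \<in> J_set X p" by (rule J_set_lag[OF pQ xJ y])
      have yjJ: "suffix j y \<in> J_set X p" for j
        by (rule J_set_lag[OF pQ yJ _ lag_suffix]) (intro suffix_in_X y)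
      \<comment> \<open>The path starts at \<open>y\<close>, which lies in the component of
        \<open>p\<close> by tail equivalence, and after \<open>Suc k\<close> edges it meets the
        orbit of \<open>x\<close> at its \<open>k\<close>-th shift.\<close>
      let ?\<alpha> = "map (\<lambda>j. (p, suffix j y)) [0..<Suc k]"
      have "pre_digraph.cas ?E (p, y) ?\<alpha> (p, suffix k x)"
        unfolding cas_subshift_graph by (simp add: k del: upt_Suc)
      moreover have "(p, y) \<in> verts ?E" "set ?\<alpha> \<subseteq> arcs ?E"
        using pT yJ yjJ by (auto simp: subshift_graph_def)
      ultimately have "pre_digraph.awalk ?E (p, y) ?\<alpha> (tail ?E (e k))"
        unfolding pre_digraph.awalk_def ei by (simp add: subshift_graph_def)
      moreover have "length ?\<alpha> = k + 1" by simp
      ultimately show "\<exists>k \<alpha> u. pre_digraph.awalk ?E u \<alpha> (tail ?E (e k)) \<and> length \<alpha> = k + 1" by blast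
    qed
  }
qed

end

theorem proposition5p10:
  fixes X T :: "'a word set"
    and A :: "('r::field, ('a gen fmon \<Rightarrow>\<^sub>0 'r) set) module"
  assumes "subshift X"
    and "all_letters_occur X"
    and "representatives X T"
    and "A = subshift_algebra X"
  shows "strongly_graded_by A (socle A) (\<lambda>n. socle A \<inter> subshift_component X n)
     \<longleftrightarrow> condition_Y (subshift_graph X T)"
proof -
  interpret subshift_space X by unfold_locales (rule assms)+
  show ?thesis
    unfolding assms(4) strongly_graded_iff_lag condition_Y_iff[OF assms(3)] ..
qed

end
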